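(* For every exponentially branching simplicial tree $T$ there exists a bilipschitz embedding $\phi:\mathbb{H}^2\to T\times T$ of the hyperbolic plane $\mathbb{H}^2$ into $T\times T$.
   Context: $\mathbb{H}^2$ is the hyperbolic plane with its standard metric. Trees carry the simplicial metric in which every edge has length $1$, and the product $T\times T$ carries the $l_1$-product metric (sum of the distances in the factors). A pointed simplicial tree $(T,t_0)$ (with $t_0$ a vertex) is called exponentially branching if there exists $\sigma>0$ such that every vertex $t\in T$ has more than $e^{\sigma d(t,t_0)}$ neighbours, where $d$ is the metric on $T$; a tree is called exponentially branching if it is so with respect to some base vertex. A map $f$ between metric spaces is a bilipschitz embedding if there is $L\ge 1$ with $L^{-1}d(x,y)\le d(f(x),f(y))\le L\,d(x,y)$ for all $x,y$. *)

theory Defs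
  imports "HOL-Analysis.Analysis"
begin

section \<open>The hyperbolic plane\<close>

text \<open>
  The upper half-plane model, with the distance function of the Riemannian metric
  \<open>(dx\<^sup>2 + dy\<^sup>2) / y\<^sup>2\<close> of constant curvature \<open>-1\<close>.
\<close>

definition hyperbolic_plane :: "complex set" where
  "hyperbolic_plane = {z. 0 < Im z}"

definition hyperbolic_dist :: "complex \<Rightarrow> complex \<Rightarrow> real" where
  "hyperbolic_dist z w = arcosh (1 + (cmod (z - w))\<^sup>2 / (2 * Im z * Im w))"

section \<open>Simplicial trees\<close>

text \<open>
  Vertex and edge sets may be infinite, and a vertex may have infinitely many neighbours.
\<close>

definition simple_graph :: "'v set \<Rightarrow> 'v set set \<Rightarrow> bool" where
  "simple_graph V E \<longleftrightarrow> (\<forall>e\<in>E. e \<subseteq> V \<and> card e = 2)"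

definition edge_walk :: "'v set \<Rightarrow> 'v set set \<Rightarrow> 'v list \<Rightarrow> bool" where
  "edge_walk V E xs \<longleftrightarrow>
     xs \<noteq> [] \<and> set xs \<subseteq> V \<and> successively (\<lambda>u v. {u, v} \<in> E) xs"

definition connected_graph :: "'v set \<Rightarrow> 'v set set \<Rightarrow> bool" where
  "connected_graph V E \<longleftrightarrow>
     (\<forall>u\<in>V. \<forall>v\<in>V. \<exists>xs. edge_walk V E xs \<and> hd xs = u \<and> last xs = v)"

definition simple_cycle :: "'v set \<Rightarrow> 'v set set \<Rightarrow> 'v list \<Rightarrow> bool" where
  "simple_cycle V E xs \<longleftrightarrow>
     edge_walk V E xs \<and> distinct xs \<and> 3 \<le> length xs \<and> {last xs, hd xs} \<in> E"

definition simplicial_tree :: "'v set \<Rightarrow> 'v set set \<Rightarrow> bool" where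
  "simplicial_tree V E \<longleftrightarrow>
     V \<noteq> {} \<and> simple_graph V E \<and> connected_graph V E \<and> (\<nexists>xs. simple_cycle V E xs)"

definition neighbours :: "'v set set \<Rightarrow> 'v \<Rightarrow> 'v set" where
  "neighbours E v = {u. {u, v} \<in> E}"

section \<open>Geometric realization and simplicial metric\<close>

text \<open>
  Points of the realization, including interior points of edges, are given by their barycentric
  coordinates.
\<close>

definition graph_simplices :: "'v set \<Rightarrow> 'v set set \<Rightarrow> 'v set set" where
  "graph_simplices V E = (\<lambda>v. {v}) ` V \<union> E"

definition closed_simplex :: "'v set \<Rightarrow> ('v \<Rightarrow> real) set" where
  "closed_simplex s = {p. (\<forall>v. 0 \<le> p v) \<and> (\<forall>v. v \<notin> s \<longrightarrow> p v = 0) \<and> (\<Sum>v\<in>s. p v) = 1}"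

definition realization :: "'v set \<Rightarrow> 'v set set \<Rightarrow> ('v \<Rightarrow> real) set" where
  "realization V E = (\<Union>s\<in>graph_simplices V E. closed_simplex s)"

definition vertex_point :: "'v \<Rightarrow> 'v \<Rightarrow> real" where
  "vertex_point v = indicator {v}"

text \<open>
  For two points of a common closed edge \<open>{u, v}\<close> the two summands below agree, so the value is
  \<open>\<bar>p u - q u\<bar>\<close>, the distance in the edge identified with the unit interval. The function is only
  applied to such pairs.
\<close>

definition simplex_dist :: "('v \<Rightarrow> real) \<Rightarrow> ('v \<Rightarrow> real) \<Rightarrow> real" where
  "simplex_dist p q = (\<Sum>v | p v \<noteq> 0 \<or> q v \<noteq> 0. \<bar>p v - q v\<bar>) / 2"

text \<open>
  The simplicial metric is the induced length metric: the infimum of the lengths of piecewise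
  linear paths, a path being given by its break points, consecutive ones lying in a common closed
  simplex.
\<close>

definition simplicial_path ::
  "'v set \<Rightarrow> 'v set set \<Rightarrow> ('v \<Rightarrow> real) \<Rightarrow> ('v \<Rightarrow> real) \<Rightarrow> ('v \<Rightarrow> real) list \<Rightarrow> bool" where
  "simplicial_path V E p q xs \<longleftrightarrow>
     xs \<noteq> [] \<and> hd xs = p \<and> last xs = q \<and> set xs \<subseteq> realization V E \<and>
     successively (\<lambda>x y. \<exists>s\<in>graph_simplices V E. x \<in> closed_simplex s \<and> y \<in> closed_simplex s) xs"

definition path_length :: "('v \<Rightarrow> real) list \<Rightarrow> real" where
  "path_length xs = (\<Sum>(x, y)\<leftarrow>zip xs (tl xs). simplex_dist x y)"

definition simplicial_dist ::
  "'v set \<Rightarrow> 'v set set \<Rightarrow> ('v \<Rightarrow> real) \<Rightarrow> ('v \<Rightarrow> real) \<Rightarrow> real" where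
  "simplicial_dist V E p q = Inf (path_length ` {xs. simplicial_path V E p q xs})"

section \<open>Exponential branching\<close>

text \<open>
  The disjunct \<open>infinite\<close> is needed because \<^const>\<open>card\<close> is \<open>0\<close> on infinite sets.
\<close>

definition exponentially_branching_at :: "'v set \<Rightarrow> 'v set set \<Rightarrow> 'v \<Rightarrow> bool" where
  "exponentially_branching_at V E t0 \<longleftrightarrow>
     (\<exists>\<sigma>>0. \<forall>t\<in>V. infinite (neighbours E t) \<or>
        exp (\<sigma> * simplicial_dist V E (vertex_point t) (vertex_point t0))
          < real (card (neighbours E t)))"

definition exponentially_branching :: "'v set \<Rightarrow> 'v set set \<Rightarrow> bool" where
  "exponentially_branching V E \<longleftrightarrow> (\<exists>t0\<in>V. exponentially_branching_at V E t0)"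

section \<open>Products and bilipschitz embeddings\<close>

definition l1_prod_dist ::
  "('a \<Rightarrow> 'a \<Rightarrow> real) \<Rightarrow> ('b \<Rightarrow> 'b \<Rightarrow> real) \<Rightarrow> 'a \<times> 'b \<Rightarrow> 'a \<times> 'b \<Rightarrow> real" where
  "l1_prod_dist d1 d2 x y = d1 (fst x) (fst y) + d2 (snd x) (snd y)"

definition bilipschitz_embedding ::
  "'a set \<Rightarrow> ('a \<Rightarrow> 'a \<Rightarrow> real) \<Rightarrow> 'b set \<Rightarrow> ('b \<Rightarrow> 'b \<Rightarrow> real) \<Rightarrow> ('a \<Rightarrow> 'b) \<Rightarrow> bool" where
  "bilipschitz_embedding A dA B dB f \<longleftrightarrow>
     f \<in> A \<rightarrow> B \<and>
     (\<exists>L\<ge>1. \<forall>x\<in>A. \<forall>y\<in>A. inverse L * dA x y \<le> dB (f x) (f y) \<and> dB (f x) (f y) \<le> L * dA x y)"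

end

theory Submission
  imports Defs "HOL-Library.Sublist"
begin

text \<open>In polar coordinates the hyperbolic plane is bilipschitz to a surface tiled by squares whose vertices all have
  even degree at least four. Its two families of walls are each pairwise disjoint, so the surface
  embeds, isometrically for the path metric of its square grid, into the product of the two trees dual to
  the families. These trees have vertices of infinite degree, but they may be folded: the folding
  only has to keep apart branches that belong to nearby points of the surface, because points that
  are far apart and get identified in one tree are still separated by the other tree, or later on. It is enough
  that a branch at depth \<open>k\<close> remembers a finite amount of information about its history that grows with
  \<open>k\<close>, and the number of labels needed for this is exponential in \<open>k\<close>. The folded trees embed, up to scaling, into any
  exponentially branching tree.\<close>

section \<open>The words of the rays\<close>

text \<open>A level takes two units of height and multiplies the number of rays by five: a cell of
  grid length 2 or 3 is cut at distance one from both ends, and two rays of different colours at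
  each cut keep every gap 0 or 1. So circles grow like \<open>5 powr (h / 2)\<close>, as hyperbolic
  circles do after rescaling the radius. A quarter turn shifts indices by the odd number
  \<open>5 ^ N\<close> and swaps colours, so one coordinate, \<open>branch_point\<close>, serves
  both trees.

  Folding works because of the order of the constants. Diaries agreeing on \<open>e\<close> letters
  beyond the first difference of the words cost at most \<open>2 * e\<close> in a tree, which must
  stay below a small multiple of the distance. Such agreement makes codes congruent modulo
  \<open>Q ^ e\<close>, a gap exponential in \<open>e\<close>, and this forces a distance linear in
  \<open>e\<close>, with slope \<open>C\<close> once \<open>Q\<close> is large. The unfolded
  constants fix \<open>C\<close>, and \<open>C\<close> fixes \<open>Q\<close>. The label count may
  then outgrow the branching of the given tree; stretching every edge to \<open>\<kappa>\<close>
  edges repairs this.\<close>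

text \<open>At level \<open>N\<close> there is a ray at \<open>i / 5 ^ N\<close> for every integer \<open>i\<close>; its colour is the parity of \<open>i\<close>. In the
  dual tree of its own colour the ray stays at one vertex, of depth \<open>ray_val N i\<close>. In the tree of
  the other colour it runs down a branch that grows by two edges with every level, and
  \<open>ray_word N i\<close> lists the edges of this branch from the root. The two edges created on the ray \<open>i\<close> of
  level \<open>n\<close> have the codes \<open>(n, 2 * i)\<close> and \<open>(n, 2 * i + 1)\<close>.

  The depths of a point in the two trees add up to its height. At height \<open>2 * N + 2\<close> four new rays
  are born between any two neighbours: a pair of different colours near either end, at the point
  whose depth exceeds the depth of this end ray by one, in the tree of the colour of this end ray.\<close>

primrec ray_val :: "nat \<Rightarrow> int \<Rightarrow> int" where
  "ray_val 0 = (\<lambda>i. 0)"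
| "ray_val (Suc N) = (\<lambda>i. let k = (i + 2) div 5; d = i - 5 * k in
     if d = 0 then ray_val N k
     else if \<bar>d\<bar> = 1 then 2 * int N + 1 - ray_val N k
     else ray_val N k + 1)"

primrec ray_word :: "nat \<Rightarrow> int \<Rightarrow> (nat \<times> int) list" where
  "ray_word 0 = (\<lambda>i. [(0, 2 * i), (0, 2 * i + 1)])"
| "ray_word (Suc N) = (\<lambda>i. let k = (i + 2) div 5; d = i - 5 * k in
     (if d = 0 then ray_word N k
      else if \<bar>d\<bar> = 1 then take (nat (ray_val N k + 1)) (ray_word N (k + d))
      else butlast (ray_word N k)) @ [(Suc N, 2 * i), (Suc N, 2 * i + 1)])"

lemma nearest5 [simp]:
  fixes k :: int
  shows "(5 * k + 2) div 5 = k" "(5 * k + 1 + 2) div 5 = k" "(5 * k - 1 + 2) div 5 = k"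
    "(5 * k + 2 + 2) div 5 = k" "(5 * k - 2 + 2) div 5 = k"
  by presburger+

text \<open>The two depths at a birth point add up to the birth height \<open>2 * N + 2\<close>. The
  newborn ray with the colour of \<open>k\<close> takes \<open>ray_val N k + 1\<close> as its value,
  the other one takes the rest.\<close>

lemma ray_val_Suc:
  "ray_val (Suc N) (5 * k) = ray_val N k"
  "ray_val (Suc N) (5 * k + 1) = 2 * int N + 1 - ray_val N k"
  "ray_val (Suc N) (5 * k - 1) = 2 * int N + 1 - ray_val N k"
  "ray_val (Suc N) (5 * k + 2) = ray_val N k + 1"
  "ray_val (Suc N) (5 * k - 2) = ray_val N k + 1"
  by (simp_all only: ray_val.simps nearest5 Let_def) simp_all

text \<open>The ray \<open>5 * k + 1\<close> has the colour opposite to \<open>k\<close>, so its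
  word lies in the tree of the colour of \<open>k\<close>, where the neighbouring branch is the word
  of \<open>k + 1\<close>; it leaves this branch one edge below the vertex of \<open>k\<close>. The
  word of \<open>5 * k + 2\<close> lies in the same tree as that of \<open>k\<close>, and at birth
  the depth there is one less than the length of \<open>ray_word N k\<close>, hence
  \<open>butlast\<close>.\<close>

lemma ray_word_Suc:
  "ray_word (Suc N) (5 * k) = ray_word N k @ [(Suc N, 2 * (5 * k)), (Suc N, 2 * (5 * k) + 1)]"
  "ray_word (Suc N) (5 * k + 1) = take (nat (ray_val N k + 1)) (ray_word N (k + 1))
     @ [(Suc N, 2 * (5 * k + 1)), (Suc N, 2 * (5 * k + 1) + 1)]"
  "ray_word (Suc N) (5 * k - 1) = take (nat (ray_val N k + 1)) (ray_word N (k - 1))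
     @ [(Suc N, 2 * (5 * k - 1)), (Suc N, 2 * (5 * k - 1) + 1)]"
  "ray_word (Suc N) (5 * k + 2) = butlast (ray_word N k)
     @ [(Suc N, 2 * (5 * k + 2)), (Suc N, 2 * (5 * k + 2) + 1)]"
  "ray_word (Suc N) (5 * k - 2) = butlast (ray_word N k)
     @ [(Suc N, 2 * (5 * k - 2)), (Suc N, 2 * (5 * k - 2) + 1)]"
  by (simp_all only: ray_word.simps nearest5 Let_def) simp_all

declare ray_val.simps(2) [simp del] ray_word.simps(2) [simp del]

lemma nearest5_cases:
  fixes i :: int
  obtains (c0) k where "i = 5 * k" | (p1) k where "i = 5 * k + 1" | (m1) k where "i = 5 * k - 1"
    | (p2) k where "i = 5 * k + 2" | (m2) k where "i = 5 * k - 2"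
proof -
  have "i mod 5 = 0 \<or> i mod 5 = 1 \<or> i mod 5 = 2 \<or> i mod 5 = 3 \<or> i mod 5 = 4" by presburger
  moreover have "i mod 5 = 0 \<Longrightarrow> \<exists>k. i = 5 * k" by presburger
  moreover have "i mod 5 = 1 \<Longrightarrow> \<exists>k. i = 5 * k + 1" by presburger
  moreover have "i mod 5 = 2 \<Longrightarrow> \<exists>k. i = 5 * k + 2" by presburger
  moreover have "i mod 5 = 3 \<Longrightarrow> \<exists>k. i = 5 * k - 2" by presburger
  moreover have "i mod 5 = 4 \<Longrightarrow> \<exists>k. i = 5 * k - 1" by presburger
  ultimately show ?thesis using that by metis
qed

lemma shift5: fixes k :: int
  shows "5 * k + 1 + 1 = 5 * k + 2" "5 * k + 2 + 1 = 5 * (k + 1) - 2"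
    "5 * k - 2 + 1 = 5 * k - 1" "5 * k - 1 + 1 = 5 * k"
    "5 * k + 1 - 1 = 5 * k" "5 * k + 2 - 1 = 5 * k + 1" "5 * k - 2 - 1 = 5 * (k - 1) + 2"
    "5 * k - 1 - 1 = 5 * k - 2"
  by simp_all

text \<open>Grid length of the cell at height \<open>2 * N\<close>: the depth in one tree runs from
  the value of one end ray to the height minus the value of the other. At height
  \<open>2 * N + s\<close> the length is \<open>cell_gap N i + s\<close>.\<close>

definition cell_gap :: "nat \<Rightarrow> int \<Rightarrow> int" where
  "cell_gap N i = 2 * int N - ray_val N i - ray_val N (i + 1)"

lemma cell_gap_0 [simp]: "cell_gap 0 i = 0" by (simp add: cell_gap_def)

text \<open>A cell of gap \<open>g\<close> has length \<open>g + 2\<close> when it is cut at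
  distance one from both ends by pairs of coinciding rays; the pieces have lengths 1, 0,
  \<open>g\<close>, 0, 1.\<close>

lemma cell_gap_Suc:
  "cell_gap (Suc N) (5 * k) = 1"
  "cell_gap (Suc N) (5 * k + 1) = 0"
  "cell_gap (Suc N) (5 * k + 2) = cell_gap N k"
  "cell_gap (Suc N) (5 * k - 2) = 0"
  "cell_gap (Suc N) (5 * k - 1) = 1"
  by (simp_all only: cell_gap_def shift5 ray_val_Suc) simp_all

lemma cell_gap_01: "cell_gap N i = 0 \<or> cell_gap N i = 1"
proof (induction N arbitrary: i)
  case (Suc N)
  show ?case by (cases i rule: nearest5_cases) (simp_all only: cell_gap_Suc Suc, simp_all)
qed simp

lemma ray_val_sum: "ray_val N i + ray_val N (i + 1) \<le> 2 * int N"
  using cell_gap_01[of N i] by (auto simp: cell_gap_def)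

lemma ray_val_sum': "ray_val N (i - 1) + ray_val N i \<le> 2 * int N"
  using ray_val_sum[of N "i - 1"] by simp

lemma ray_val_nonneg: "0 \<le> ray_val N i"
proof (induction N arbitrary: i)
  case (Suc N)
  have "ray_val N k \<le> 2 * int N" for k using Suc[of "k + 1"] ray_val_sum[of N k] by linarith
  then have "ray_val N k \<le> 2 * int N + 1" for k by (smt (verit))
  then show ?case using Suc
    by (cases i rule: nearest5_cases) (simp_all only: ray_val_Suc, simp_all add: add_nonneg_nonneg)
qed simp

lemma ray_val_le: "ray_val N i \<le> 2 * int N"
  using ray_val_nonneg[of N "i + 1"] ray_val_sum[of N i] by linarith

lemma ray_val_refine: "ray_val (N + K) (5 ^ K * i) = ray_val N i"
proof (induction K)
  case (Suc K)
  have "5 ^ Suc K * i = 5 * (5 ^ K * i)" by simp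
  then show ?case using Suc ray_val_Suc(1)[of "N + K" "5 ^ K * i"]
    by (simp only: add_Suc_right)
qed simp

text \<open>Symmetry under quarter turns. For odd \<open>t\<close> the shift exchanges the colours,
  which is how both trees are treated by one construction.\<close>

lemma ray_val_shift: "ray_val N (i + 5 ^ N * t) = ray_val N i"
proof (induction N arbitrary: i)
  case (Suc N)
  have e: "5 * k + 5 ^ Suc N * t = 5 * (k + 5 ^ N * t)" for k by (simp add: algebra_simps)
  have e': "5 * k + d + 5 ^ Suc N * t = 5 * (k + 5 ^ N * t) + d"
    "5 * k - d + 5 ^ Suc N * t = 5 * (k + 5 ^ N * t) - d" for k d by (simp_all add: algebra_simps)
  show ?case by (cases i rule: nearest5_cases) (simp_all only: e e' ray_val_Suc Suc)
qed simp

lemma cell_gap_shift: "cell_gap N (i + 5 ^ N * t) = cell_gap N i"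
  using ray_val_shift[of N i t] ray_val_shift[of N "i + 1" t] by (simp add: cell_gap_def algebra_simps)

text \<open>A level ends at height \<open>2 * N + 2\<close>; whatever is not depth in the tree of
  the ray's own colour is depth in the other tree.\<close>

lemma length_ray_word: "length (ray_word N i) = nat (2 * int N + 2 - ray_val N i)"
proof (induction N arbitrary: i)
  case (Suc N)
  note b = ray_val_nonneg[of N] ray_val_le[of N] ray_val_sum[of N] ray_val_sum'[of N]
  show ?case
  proof (cases i rule: nearest5_cases)
    case (c0 k) show ?thesis unfolding c0 ray_val_Suc ray_word_Suc using b(1)[of k] b(2)[of k] by (simp add: Suc nat_diff_distrib)
  next
    case (p1 k) show ?thesis unfolding p1 ray_val_Suc ray_word_Suc using b(1)[of k] b(3)[of k] by (simp add: Suc min_def) linarith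
  next
    case (m1 k) show ?thesis unfolding m1 ray_val_Suc ray_word_Suc using b(1)[of k] b(4)[of k] by (simp add: Suc min_def) linarith
  next
    case (p2 k) show ?thesis unfolding p2 ray_val_Suc ray_word_Suc using b(1)[of k] b(2)[of k] by (simp add: Suc)
  next
    case (m2 k) show ?thesis unfolding m2 ray_val_Suc ray_word_Suc using b(1)[of k] b(2)[of k] by (simp add: Suc)
  qed
qed simp

text \<open>Both words live in the tree of the colour of \<open>i\<close>, where the ray
  \<open>i\<close> sits at a vertex of depth \<open>ray_val N i\<close>; the cells on either side of
  the ray leave from this vertex. This gives continuity across a ray.\<close>

lemma take_ray_word_neighbours:
  "take (nat (ray_val N i)) (ray_word N (i - 1)) = take (nat (ray_val N i)) (ray_word N (i + 1))"
proof (induction N arbitrary: i)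
  case (Suc N)
  note b = ray_val_nonneg[of N] ray_val_le[of N] ray_val_sum[of N] ray_val_sum'[of N]
  show ?case
  proof (cases i rule: nearest5_cases)
    case (c0 k)
    have "take (nat (ray_val N k)) (ray_word N (k - 1)) = take (nat (ray_val N k)) (ray_word N (k + 1))" by (rule Suc)
    moreover have "nat (ray_val N k) \<le> nat (ray_val N k + 1)" by simp
    ultimately show ?thesis unfolding c0 ray_val_Suc ray_word_Suc using b(1)[of k] b(3)[of k] b(4)[of k]
      by (simp add: length_ray_word min_def)
  next
    case (p1 k) show ?thesis unfolding p1 shift5 ray_val_Suc ray_word_Suc using b(1)[of k] b(2)[of k]
      by (simp add: length_ray_word butlast_conv_take min_def nat_diff_distrib) linarith
  next
    case (m1 k) show ?thesis unfolding m1 shift5 ray_val_Suc ray_word_Suc using b(1)[of k] b(2)[of k]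
      by (simp add: length_ray_word butlast_conv_take min_def nat_diff_distrib) linarith
  next
    case (p2 k) show ?thesis unfolding p2 shift5 ray_val_Suc ray_word_Suc using b(1)[of k] b(3)[of k]
      by (simp add: length_ray_word butlast_conv_take min_def)
  next
    case (m2 k) show ?thesis unfolding m2 shift5 ray_val_Suc ray_word_Suc using b(1)[of k] b(4)[of k]
      by (simp add: length_ray_word butlast_conv_take min_def)
  qed
qed simp

text \<open>The ray on which an edge was created, reindexed at level \<open>N\<close>;
  \<open>div 2\<close> forgets which of its two edges it is.\<close>

definition code_pos :: "nat \<Rightarrow> nat \<times> int \<Rightarrow> int" where
  "code_pos N c = (snd c div 2) * 5 ^ (N - fst c)"

lemma code_pos_Suc: "fst c \<le> N \<Longrightarrow> code_pos (Suc N) c = 5 * code_pos N c"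
  by (simp add: code_pos_def Suc_diff_le)

lemma set_ray_word_Suc:
  assumes "c \<in> set (ray_word (Suc N) i)"
  obtains "c = (Suc N, 2 * i) \<or> c = (Suc N, 2 * i + 1)"
    | k where "c \<in> set (ray_word N k)" "\<bar>5 * k - i\<bar> \<le> 4" "even (k + i)"
  using assms
proof (cases i rule: nearest5_cases)
  case (c0 k)
  with assms show ?thesis using that(1) that(2)[of k] by (auto simp: ray_word_Suc)
next
  case (p1 k)
  from assms[unfolded p1 ray_word_Suc] have "c = (Suc N, 2 * i) \<or> c = (Suc N, 2 * i + 1) \<or> c \<in> set (ray_word N (k + 1))"
    using set_take_subset p1 by fastforce
  then show ?thesis using that(1) that(2)[of "k + 1"] p1 by auto
next
  case (m1 k)
  from assms[unfolded m1 ray_word_Suc] have "c = (Suc N, 2 * i) \<or> c = (Suc N, 2 * i + 1) \<or> c \<in> set (ray_word N (k - 1))"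
    using set_take_subset m1 by fastforce
  then show ?thesis using that(1) that(2)[of "k - 1"] m1 by auto
next
  case (p2 k)
  from assms[unfolded p2 ray_word_Suc] have "c = (Suc N, 2 * i) \<or> c = (Suc N, 2 * i + 1) \<or> c \<in> set (ray_word N k)"
    using p2 by (auto dest: in_set_butlastD)
  then show ?thesis using that(1) that(2)[of k] p2 by auto
next
  case (m2 k)
  from assms[unfolded m2 ray_word_Suc] have "c = (Suc N, 2 * i) \<or> c = (Suc N, 2 * i + 1) \<or> c \<in> set (ray_word N k)"
    using m2 by (auto dest: in_set_butlastD)
  then show ?thesis using that(1) that(2)[of k] m2 by auto
qed

lemma ray_word_level: "c \<in> set (ray_word N i) \<Longrightarrow> fst c \<le> N"
proof (induction N arbitrary: i)
  case (Suc N)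
  from Suc.prems show ?case by (rule set_ray_word_Suc) (auto dest: Suc.IH)
qed auto

text \<open>A letter is inherited through a chain of rays whose step into level \<open>m\<close>
  moves the position by at most \<open>4 / 5 ^ m\<close>; the geometric sum of these steps stays
  below the bound.\<close>

lemma ray_word_near:
  "c \<in> set (ray_word N i) \<Longrightarrow> \<bar>real_of_int i / 5 ^ N - real_of_int (snd c div 2) / 5 ^ fst c\<bar> \<le> 5 / 4 * (1 / 5 ^ fst c - 1 / 5 ^ N)"
proof (induction N arbitrary: i)
  case (Suc N)
  from Suc.prems show ?case
  proof (cases rule: set_ray_word_Suc)
    case (2 k)
    have "real_of_int i / 5 ^ Suc N - real_of_int k / 5 ^ N = - real_of_int (5 * k - i) / 5 ^ Suc N"
      by (simp add: field_simps)
    then have "\<bar>real_of_int i / 5 ^ Suc N - real_of_int k / 5 ^ N\<bar> = \<bar>real_of_int (5 * k - i)\<bar> / 5 ^ Suc N"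
      by (simp add: abs_divide)
    also have "\<dots> \<le> 4 / 5 ^ Suc N" using 2(2) by (intro divide_right_mono) (linarith, simp)
    finally have "\<bar>real_of_int i / 5 ^ Suc N - real_of_int k / 5 ^ N\<bar> \<le> 4 / 5 ^ Suc N" .
    moreover have "(4::real) / 5 ^ Suc N \<le> 5 / 4 * (1 / 5 ^ N - 1 / 5 ^ Suc N)" by (simp add: field_simps)
    ultimately show ?thesis using Suc.IH[OF 2(1)] by (simp only: right_diff_distrib)
  qed auto
qed auto

text \<open>The parity hypothesis puts the word of \<open>k\<close> into the tree of the colour of
  \<open>c\<close>, where \<open>c\<close> is a vertex. A branch that has passed this vertex can no
  longer reach the other side of the ray, so its deeper letters were all created on the side of
  \<open>k\<close>. The induction replaces \<open>k\<close> by the ray it inherits from and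
  \<open>c\<close> by a coarser ray of the same colour.\<close>

lemma ray_word_side:
  assumes "odd (c + k)" "e \<in> set (drop (nat (ray_val N c)) (ray_word N k))"
  shows "(c < k \<longrightarrow> c < code_pos N e) \<and> (k < c \<longrightarrow> code_pos N e < c)"
  using assms
proof (induction N arbitrary: c k)
  case 0
  then show ?case by (auto simp: code_pos_def)
next
  case (Suc N)
  note b = ray_val_nonneg[of N] ray_val_le[of N] ray_val_sum[of N] ray_val_sum'[of N]
  define new where "new = [(Suc N, 2 * k), (Suc N, 2 * k + 1)]"
  \<comment> \<open>\<open>K\<close> is the ray whose word \<open>k\<close> inherits, cut to
    \<open>m\<close> letters. For \<open>k = 5 * j + 1\<close> it is \<open>j + 1\<close>, which
    gives the form \<open>5 * K - 4\<close>.\<close>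
  obtain K m where K: "ray_word (Suc N) k = take m (ray_word N K) @ new" "even (K + k)" and
    Kc: "(k = 5 * K \<and> m = length (ray_word N K))
      \<or> (k = 5 * K - 4 \<and> m = nat (ray_val N (K - 1) + 1)) \<or> (k = 5 * K + 4 \<and> m = nat (ray_val N (K + 1) + 1))
      \<or> ((k = 5 * K + 2 \<or> k = 5 * K - 2) \<and> m = nat (2 * int N + 1 - ray_val N K))"
  proof (cases k rule: nearest5_cases)
    case (c0 j) then show ?thesis by (intro that[where K=j and m="length (ray_word N j)"]) (auto simp: ray_word_Suc new_def)
  next
    case (p1 j) then show ?thesis by (intro that[where K="j+1" and m="nat (ray_val N j + 1)"]) (auto simp: ray_word_Suc new_def)
  next
    case (m1 j) then show ?thesis by (intro that[where K="j-1" and m="nat (ray_val N j + 1)"]) (auto simp: ray_word_Suc new_def)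
  next
    case (p2 j)
    have "length (ray_word N j) - 1 = nat (2 * int N + 1 - ray_val N j)"
      using b(2)[of j] by (simp add: length_ray_word)
    with p2 show ?thesis
      by (intro that[where K="j" and m="nat (2 * int N + 1 - ray_val N j)"])
       (auto simp: ray_word_Suc new_def butlast_conv_take)
  next
    case (m2 j)
    have "length (ray_word N j) - 1 = nat (2 * int N + 1 - ray_val N j)"
      using b(2)[of j] by (simp add: length_ray_word)
    with m2 show ?thesis
      by (intro that[where K="j" and m="nat (2 * int N + 1 - ray_val N j)"])
       (auto simp: ray_word_Suc new_def butlast_conv_take)
  qed
  \<comment> \<open>\<open>C\<close> has the colour of \<open>c\<close> and no larger value, so a
    position beyond the value of \<open>c\<close> is also beyond that of \<open>C\<close>.\<close>
  obtain C where C: "even (C + c)" "ray_val N C \<le> ray_val (Suc N) c"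
    "c = 5 * C \<or> ((c = 5 * C + 2 \<or> c = 5 * C - 2) \<and> ray_val (Suc N) c = ray_val N C + 1)
      \<or> (c = 5 * C - 4 \<and> ray_val (Suc N) c = 2 * int N + 1 - ray_val N (C - 1)) \<or> (c = 5 * C + 4 \<and> ray_val (Suc N) c = 2 * int N + 1 - ray_val N (C + 1))"
  proof (cases c rule: nearest5_cases)
    case (c0 j) then show ?thesis by (intro that[of j]) (auto simp: ray_val_Suc)
  next
    case (p1 j) then show ?thesis using b(3)[of j] by (intro that[of "j+1"]) (auto simp: ray_val_Suc)
  next
    case (m1 j) then show ?thesis using b(4)[of j] by (intro that[of "j-1"]) (auto simp: ray_val_Suc)
  next
    case (p2 j) then show ?thesis by (intro that[of j]) (auto simp: ray_val_Suc)
  next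
    case (m2 j) then show ?thesis by (intro that[of j]) (auto simp: ray_val_Suc)
  qed
  have odd: "odd (C + K)" using Suc.prems(1) C(1) K(2) by presburger
  from Suc.prems(2) K(1) consider "e \<in> set new" | "e \<in> set (drop (nat (ray_val (Suc N) c)) (take m (ray_word N K)))"
    using set_drop_subset by fastforce
  then show ?case
  proof cases
    case 1
    then show ?thesis by (auto simp: new_def code_pos_def)
  next
    case 2
    then have m: "nat (ray_val (Suc N) c) < m" by (metis drop_take empty_iff list.set(1) not_less take0 zero_diff diff_is_0_eq')
    from 2 have "e \<in> set (drop (nat (ray_val (Suc N) c)) (ray_word N K))"
      by (metis drop_take in_set_takeD)
    then have "e \<in> set (drop (nat (ray_val N C)) (ray_word N K))"
      using C(2) by (meson nat_mono set_drop_subset_set_drop subsetD)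
    note IH = Suc.IH[OF odd this]
    have "e \<in> set (ray_word N K)" using 2 by (meson in_set_dropD in_set_takeD)
    then have p: "code_pos (Suc N) e = 5 * code_pos N e" using ray_word_level code_pos_Suc by blast
    have CK: "C \<noteq> K" using odd by auto
    show ?thesis
    proof (cases "C < K")
      case True
      with IH have "C < code_pos N e" by simp
      \<comment> \<open>Only neighbouring \<open>C\<close> and \<open>K\<close> could let the finer
        rays change order; but then the prefix inherited by \<open>k\<close> is too short to contain
        a position beyond the value of \<open>c\<close>.\<close>
      moreover have "c < k"
      proof (rule ccontr)
        assume "\<not> c < k"
        then have "k \<le> c" by simp
        have "c \<le> 5 * C + 4" "5 * K - 4 \<le> k" using C(3) Kc by auto
        with True \<open>k \<le> c\<close> have "K = C + 1" by linarith
        with C(3) Kc m \<open>k \<le> c\<close> b(1)[of C] b(1)[of "C+1"] b(3)[of C] show False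
          by auto
      qed
      ultimately show ?thesis using p C(3) by auto
    next
      case False
      with CK have lt: "K < C" by simp
      with IH have "code_pos N e < C" by simp
      moreover have "k < c"
      proof (rule ccontr)
        assume "\<not> k < c"
        then have "c \<le> k" by simp
        have "5 * C - 4 \<le> c" "k \<le> 5 * K + 4" using C(3) Kc by auto
        with lt \<open>c \<le> k\<close> have "C = K + 1" by linarith
        with C(3) Kc m \<open>c \<le> k\<close> b(1)[of K] b(1)[of "K+1"] b(3)[of K] show False
          by auto
      qed
      ultimately show ?thesis using p C(3) by auto
    qed
  qed
qed

section \<open>Distances in the two trees\<close>

text \<open>A pair \<open>(w, r)\<close> stands for the point at depth \<open>r\<close> on the
  branch \<open>w\<close> of a rooted tree, and this is the Gromov product at the root. Different
  pairs may denote the same point, so \<open>branch_dist\<close> is only a pseudometric.\<close>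

definition meet_depth :: "'c list \<times> real \<Rightarrow> 'c list \<times> real \<Rightarrow> real" where
  "meet_depth a b = min (min (snd a) (snd b)) (length (longest_common_prefix (fst a) (fst b)))"

definition branch_dist :: "'c list \<times> real \<Rightarrow> 'c list \<times> real \<Rightarrow> real" where
  "branch_dist a b = snd a + snd b - 2 * meet_depth a b"

lemma le_length_lcp_iff:
  fixes xs ys :: "'a list"
  shows "k \<le> length (longest_common_prefix xs ys) \<longleftrightarrow> k \<le> length xs \<and> k \<le> length ys \<and> take k xs = take k ys"
proof
  let ?p = "longest_common_prefix xs ys"
  assume k: "k \<le> length ?p"
  have "prefix ?p xs" "prefix ?p ys"
    by (rule longest_common_prefix_prefix1 longest_common_prefix_prefix2)+
  moreover have "take (length p) zs = p \<and> length p \<le> length zs" if "prefix p zs" for p zs :: "'a list"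
    using that by (auto simp: prefix_def)
  ultimately have "take (length ?p) xs = ?p" "take (length ?p) ys = ?p" "length ?p \<le> length xs" "length ?p \<le> length ys"
    by blast+
  then show "k \<le> length xs \<and> k \<le> length ys \<and> take k xs = take k ys"
    using k by (metis min.absorb1 take_take order_trans)
next
  assume "k \<le> length xs \<and> k \<le> length ys \<and> take k xs = take k ys"
  then have "prefix (take k xs) (longest_common_prefix xs ys)"
    by (metis longest_common_prefix_max_prefix take_is_prefix)
  then show "k \<le> length (longest_common_prefix xs ys)"
    using \<open>k \<le> length xs \<and> _\<close> by (auto dest: prefix_length_le)
qed

lemma lcp_le_iff:
  "length (longest_common_prefix xs ys) \<le> k \<longleftrightarrow> \<not> (k < length xs \<and> k < length ys \<and> take (Suc k) xs = take (Suc k) ys)"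
  using le_length_lcp_iff[of "Suc k" xs ys] by (auto simp: not_le Suc_le_eq)

lemma lcp_commute: "length (longest_common_prefix xs ys) = length (longest_common_prefix ys xs)"
  by (rule order_antisym) (metis le_length_lcp_iff order_refl)+

lemma meet_depth_commute: "meet_depth a b = meet_depth b a"
  by (simp add: meet_depth_def min.commute lcp_commute[of "fst a"])

lemma branch_dist_commute: "branch_dist a b = branch_dist b a"
  by (simp add: branch_dist_def meet_depth_commute[of a])

lemma meet_depth_ultra: "min (meet_depth a b) (meet_depth b c) \<le> meet_depth a c"
proof -
  define k where "k = min (length (longest_common_prefix (fst a) (fst b))) (length (longest_common_prefix (fst b) (fst c)))"
  have "k \<le> length (longest_common_prefix (fst a) (fst b))" "k \<le> length (longest_common_prefix (fst b) (fst c))"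
    by (simp_all add: k_def)
  then have "k \<le> length (longest_common_prefix (fst a) (fst c))" unfolding le_length_lcp_iff by simp
  then have "real (length (longest_common_prefix (fst a) (fst b))) \<le> length (longest_common_prefix (fst a) (fst c))
    \<or> real (length (longest_common_prefix (fst b) (fst c))) \<le> length (longest_common_prefix (fst a) (fst c))"
    unfolding k_def by (auto simp: min_le_iff_disj)
  then show ?thesis unfolding meet_depth_def by linarith
qed

lemma branch_dist_triangle: "branch_dist a c \<le> branch_dist a b + branch_dist b c"
proof -
  have "meet_depth a b \<le> snd b" "meet_depth b c \<le> snd b" by (simp_all add: meet_depth_def)
  with meet_depth_ultra[of a b c] show ?thesis unfolding branch_dist_def by linarith
qed

lemma branch_dist_nonneg: "0 \<le> branch_dist a b"
  by (simp add: branch_dist_def meet_depth_def)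

lemma branch_dist_ge: "\<bar>snd a - snd b\<bar> \<le> branch_dist a b"
  by (simp add: branch_dist_def meet_depth_def)

lemma branch_dist_eq_abs:
  assumes "take k (fst a) = take k (fst b)" "k \<le> length (fst a)" "k \<le> length (fst b)" "snd a \<le> k" "snd b \<le> k"
  shows "branch_dist a b = \<bar>snd a - snd b\<bar>"
proof -
  have "k \<le> length (longest_common_prefix (fst a) (fst b))" using assms by (simp add: le_length_lcp_iff)
  then have "meet_depth a b = min (snd a) (snd b)" using assms(4,5) unfolding meet_depth_def by linarith
  then show ?thesis unfolding branch_dist_def by linarith
qed

lemma branch_dist_ge_lcp:
  assumes "length (longest_common_prefix (fst a) (fst b)) \<le> k"
  shows "snd a - k \<le> branch_dist a b" "snd b - k \<le> branch_dist a b" "snd a + snd b - 2 * k \<le> branch_dist a b"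
  using assms by (auto simp: branch_dist_def meet_depth_def)

section \<open>Cells of a circle and their images in the tree of the even rays\<close>

definition odd_end :: "int \<Rightarrow> int" where "odd_end i = (if odd i then i else i + 1)"
definition even_end :: "int \<Rightarrow> int" where "even_end i = (if odd i then i + 1 else i)"

lemma odd_odd_end [simp]: "odd (odd_end i)" and even_even_end [simp]: "even (even_end i)"
  by (auto simp: odd_end_def even_end_def)

text \<open>Angles are measured in quarter turns, so that the circle has length four and indices count modulo
  \<open>4 * 5 ^ N\<close>.\<close>

definition cell_word :: "nat \<Rightarrow> int \<Rightarrow> (nat \<times> int) list" where
  "cell_word N i = ray_word N (odd_end (i mod (4 * 5 ^ N)))"

text \<open>Linear interpolation away from the even end, where the depth is the value of that ray.
  The fraction \<open>f\<close> is measured from the left end, hence \<open>1 - f\<close> if the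
  even ray is the right one.\<close>

definition cell_depth :: "nat \<Rightarrow> int \<Rightarrow> real \<Rightarrow> real \<Rightarrow> real" where
  "cell_depth N i f s = real_of_int (ray_val N (even_end i)) + (if even i then f else 1 - f) * (real_of_int (cell_gap N i) + s)"

definition cell_point :: "nat \<Rightarrow> int \<Rightarrow> real \<Rightarrow> real \<Rightarrow> (nat \<times> int) list \<times> real" where
  "cell_point N i f s = (cell_word N i, cell_depth N i f s)"

lemma ray_val_mod: "ray_val N (i mod (4 * 5 ^ N)) = ray_val N i"
  using ray_val_shift[of N i "- 4 * (i div (4 * 5 ^ N))"] by (simp add: minus_div_mult_eq_mod[symmetric] algebra_simps)

lemma ray_val_mod1: "ray_val N (i mod (4 * 5 ^ N) + 1) = ray_val N (i + 1)"
  using ray_val_shift[of N "i + 1" "- 4 * (i div (4 * 5 ^ N))"] by (simp add: minus_div_mult_eq_mod[symmetric] algebra_simps)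

lemma even_mod_circ: "even (i mod (4 * 5 ^ N)) \<longleftrightarrow> even (i::int)"
  by (simp add: dvd_mod_iff)

lemma ends_sum: "ray_val N (odd_end i) + ray_val N (even_end i) = 2 * int N - cell_gap N i"
  by (auto simp: odd_end_def even_end_def cell_gap_def)

lemma length_cell_word: "length (cell_word N i) = nat (2 * int N + 2 - ray_val N (odd_end i))"
  by (auto simp: cell_word_def length_ray_word odd_end_def ray_val_mod ray_val_mod1 even_mod_circ)

lemma real_length_cell_word: "real (length (cell_word N i)) = ray_val N (even_end i) + cell_gap N i + 2"
  using ends_sum[of N i] ray_val_le[of N "odd_end i"] by (simp add: length_cell_word)

lemma cell_depth_bounds:
  fixes f s :: real
  assumes "0 \<le> f" "f \<le> 1" "0 \<le> s" "s \<le> 2"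
  shows "ray_val N (even_end i) \<le> cell_depth N i f s" "cell_depth N i f s \<le> length (cell_word N i)"
    "cell_depth N i f s \<le> real_of_int (ray_val N (even_end i)) + real_of_int (cell_gap N i) + s"
proof -
  let ?u = "if even i then f else 1 - f" and ?l = "real_of_int (cell_gap N i) + s"
  have g: "0 \<le> cell_gap N i" using cell_gap_01[of N i] by auto
  have u: "0 \<le> ?u" "?u \<le> 1" using assms by auto
  have "0 \<le> ?u * ?l" using u g assms by (intro mult_nonneg_nonneg) auto
  then show "ray_val N (even_end i) \<le> cell_depth N i f s" by (simp add: cell_depth_def)
  have "?u * ?l \<le> ?l" using u g assms by (intro mult_left_le_one_le) auto
  then show 3: "cell_depth N i f s \<le> real_of_int (ray_val N (even_end i)) + real_of_int (cell_gap N i) + s"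
    unfolding cell_depth_def by linarith
  show "cell_depth N i f s \<le> length (cell_word N i)"
    using 3 assms unfolding real_length_cell_word by linarith
qed

lemma cell_point_same_cell:
  fixes f s f' s' :: real
  assumes "0 \<le> f" "f \<le> 1" "0 \<le> s" "s \<le> 2" "0 \<le> f'" "f' \<le> 1" "0 \<le> s'" "s' \<le> 2"
  shows "branch_dist (cell_point N i f s) (cell_point N i f' s') = \<bar>cell_depth N i f s - cell_depth N i f' s'\<bar>"
  using branch_dist_eq_abs[of "length (cell_word N i)" "cell_point N i f s" "cell_point N i f' s'"]
    cell_depth_bounds(2)[of f s N i] cell_depth_bounds(2)[of f' s' N i] assms
  by (simp add: cell_point_def)

lemma cell_point_same_level:
  fixes f s f' :: real
  assumes "0 \<le> f" "f \<le> 1" "0 \<le> s" "s \<le> 2" "0 \<le> f'" "f' \<le> 1"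
  shows "branch_dist (cell_point N i f s) (cell_point N i f' s) = \<bar>f - f'\<bar> * (real_of_int (cell_gap N i) + s)"
proof -
  have "cell_depth N i f s - cell_depth N i f' s = (if even i then f - f' else f' - f) * (real_of_int (cell_gap N i) + s)"
    by (simp add: cell_depth_def algebra_simps)
  moreover have "0 \<le> cell_gap N i" using cell_gap_01[of N i] by auto
  ultimately show ?thesis using cell_point_same_cell[of f s f' s] assms
    by (simp add: abs_mult abs_minus_commute)
qed

lemma cell_point_same_fraction:
  fixes f s s' :: real
  assumes "0 \<le> f" "f \<le> 1" "0 \<le> s" "s \<le> 2" "0 \<le> s'" "s' \<le> 2"
  shows "branch_dist (cell_point N i f s) (cell_point N i f s') \<le> \<bar>s - s'\<bar>"
proof -
  have "cell_depth N i f s - cell_depth N i f s' = (if even i then f else 1 - f) * (s - s')"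
    by (simp add: cell_depth_def algebra_simps)
  moreover have "\<bar>(if even i then f else 1 - f) * (s - s')\<bar> \<le> 1 * \<bar>s - s'\<bar>"
    unfolding abs_mult using assms by (intro mult_right_mono) auto
  ultimately show ?thesis using cell_point_same_cell[of f s f s'] assms by simp
qed

text \<open>If the common ray is odd, both cells have the same word. If it is even, both points have
  its value as depth, and up to this depth the two words agree.\<close>

lemma cell_point_join:
  fixes s :: real
  assumes "0 \<le> s" "s \<le> 2"
  shows "branch_dist (cell_point N i 1 s) (cell_point N (i + 1) 0 s) = 0"
proof -
  let ?n = "4 * 5 ^ N :: int"
  have g: "cell_gap N i = 2 * int N - ray_val N i - ray_val N (i + 1)"
     "cell_gap N (i + 1) = 2 * int N - ray_val N (i + 1) - ray_val N (i + 2)"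
    by (simp_all add: cell_gap_def algebra_simps)
  have d: "cell_depth N i 1 s = cell_depth N (i + 1) 0 s"
    using g by (auto simp: cell_depth_def even_end_def algebra_simps)
  have m: "(i + 1) mod ?n = (if i mod ?n = ?n - 1 then 0 else i mod ?n + 1)"
  proof -
    have "(i + 1) mod ?n = (i mod ?n + 1) mod ?n" by (simp add: mod_add_left_eq)
    moreover have "0 \<le> i mod ?n" "i mod ?n < ?n" by (simp_all del: mult_less_0_iff)
    ultimately show ?thesis
      by (cases "i mod ?n = ?n - 1") (simp_all add: mod_pos_pos_trivial del: mod_add_left_eq mod_mult_self1)
  qed
  show ?thesis
  proof (cases "even i")
    case True
    have "odd (?n - 1)" by simp
    then have "i mod ?n \<noteq> ?n - 1" using True even_mod_circ[of i N] by metis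
    then have "cell_word N (i + 1) = cell_word N i"
      using True by (simp add: cell_word_def m odd_end_def even_mod_circ)
    then show ?thesis using d cell_point_same_cell[of 1 s 1 s N i] assms
      by (simp add: cell_point_def branch_dist_def)
  next
    case False
    let ?v = "ray_val N (i + 1)"
    have d1: "cell_depth N i 1 s = ?v" "cell_depth N (i + 1) 0 s = ?v"
      using False by (simp_all add: cell_depth_def even_end_def)
    have vle: "nat ?v \<le> length (cell_word N j)" if "j = i \<or> j = i + 1" for j
    proof -
      have "?v = ray_val N (even_end j)" using that False by (auto simp: even_end_def)
      then show ?thesis using real_length_cell_word[of N j] cell_gap_01[of N j] ray_val_nonneg[of N "i+1"] by linarith
    qed
    have "take (nat ?v) (cell_word N i) = take (nat ?v) (cell_word N (i + 1))"
    \<comment> \<open>At the seam of the circle the words of the two sides are unrelated, but the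
      ray there has value 0, so both points are the root.\<close>
    proof (cases "i mod ?n = ?n - 1")
      case True
      then have "?v = ray_val N (0 + 5 ^ N * 4)" using ray_val_mod1[of N i] by (simp add: mult.commute)
      also have "\<dots> = ray_val N (5 ^ N * 0)" by (simp only: ray_val_shift) simp
      also have "\<dots> = 0" using ray_val_refine[of 0 N 0] by simp
      finally show ?thesis by simp
    next
      case F: False
      have "ray_val N (i mod ?n + 1) = ?v" by (rule ray_val_mod1)
      moreover have "odd_end (i mod ?n) = (i mod ?n + 1) - 1" "odd_end ((i + 1) mod ?n) = (i mod ?n + 1) + 1"
        using F False by (auto simp: odd_end_def m even_mod_circ)
      ultimately show ?thesis using take_ray_word_neighbours[of N "i mod ?n + 1"]
        by (simp add: cell_word_def)
    qed
    then show ?thesis using branch_dist_eq_abs[of "nat ?v" "cell_point N i 1 s" "cell_point N (i+1) 0 s"] vle d1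
        ray_val_nonneg[of N "i+1"] by (simp add: cell_point_def)
  qed
qed

lemma cell_point_chain:
  fixes f s :: real
  assumes "0 \<le> s" "s \<le> 2" "0 \<le> f" "f \<le> 1"
  shows "branch_dist (cell_point N i f s) (cell_point N (i + int n) 1 s)
    \<le> (1 - f) * (real_of_int (cell_gap N i) + s) + (\<Sum>k=1..n. real_of_int (cell_gap N (i + int k)) + s)"
proof (induction n)
  case 0
  then show ?case using cell_point_same_level[of f s 1 N i] assms by simp
next
  case (Suc n)
  let ?P = "\<lambda>i f. cell_point N i f s"
  have "branch_dist (?P i f) (?P (i + int (Suc n)) 1) \<le> branch_dist (?P i f) (?P (i + int n) 1)
    + (branch_dist (?P (i + int n) 1) (?P (i + int n + 1) 0) + branch_dist (?P (i + int n + 1) 0) (?P (i + int n + 1) 1))"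
    using branch_dist_triangle[of "?P i f" "?P (i + int n + 1) 1" "?P (i + int n) 1"]
      branch_dist_triangle[of "?P (i + int n) 1" "?P (i + int n + 1) 1" "?P (i + int n + 1) 0"] by (simp add: algebra_simps)
  also have "\<dots> \<le> (1 - f) * (real_of_int (cell_gap N i) + s) + (\<Sum>k=1..n. real_of_int (cell_gap N (i + int k)) + s) + (0 + (real_of_int (cell_gap N (i + int n + 1)) + s))"
    using Suc cell_point_join[of s N "i + int n"] cell_point_same_level[of 0 s 1 N "i + int n + 1"] assms by simp
  finally show ?case by (simp add: algebra_simps)
qed

text \<open>A common letter beyond the vertex of \<open>c\<close> would have been created on both
  sides of \<open>c\<close>.\<close>

lemma lcp_ray_word_le:
  assumes "odd (c + k)" "odd (c + k')" "k < c" "c < k'"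
  shows "length (longest_common_prefix (ray_word N k) (ray_word N k')) \<le> nat (ray_val N c)"
proof (rule ccontr)
  let ?v = "nat (ray_val N c)"
  assume "\<not> ?thesis"
  then have *: "?v < length (ray_word N k)" "?v < length (ray_word N k')"
    "take (Suc ?v) (ray_word N k) = take (Suc ?v) (ray_word N k')"
    by (simp_all add: lcp_le_iff)
  let ?e = "ray_word N k ! ?v"
  have "?e = ray_word N k' ! ?v" using * by (metis lessI nth_take)
  moreover have "ray_word N j ! ?v \<in> set (drop ?v (ray_word N j))" if "?v < length (ray_word N j)" for j
    using that by (metis Cons_nth_drop_Suc list.set_intros(1))
  ultimately have "?e \<in> set (drop ?v (ray_word N k))" "?e \<in> set (drop ?v (ray_word N k'))"
    using *(1,2) by metis+
  then show False using ray_word_side[OF assms(1), of ?e N] ray_word_side[OF assms(2), of ?e N] assms(3,4) by simp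
qed

lemma lcp_cell_word_le:
  assumes "i < c" "c \<le> j" "j - i \<le> 2 * 5 ^ N" "even c"
  shows "length (longest_common_prefix (cell_word N i) (cell_word N j)) \<le> nat (ray_val N c)"
proof -
  let ?n = "4 * 5 ^ N :: int"
  have n: "0 < ?n" by simp
  have r: "0 \<le> i mod ?n" "i mod ?n < ?n" "0 \<le> j mod ?n" "j mod ?n < ?n" using n by simp_all
  have eq: "i = ?n * (i div ?n) + i mod ?n" "j = ?n * (j div ?n) + j mod ?n" by simp_all
  have par: "odd (2 * c + odd_end k)" for c k by simp
  have lt0: "odd_end k < c'" if "k < c'" "even c'" for k c'
    using that by (cases "k + 1 = c'") (auto simp: odd_end_def)
  have lt: "odd_end (k mod ?n) < c'" if "k mod ?n < c'" "even c'" for k c'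
    using that by (rule lt0)
  have gt0: "c' < odd_end k" if "c' \<le> k" "even c'" for k c'
    using that by (cases "k = c'") (auto simp: odd_end_def)
  have gt: "c' < odd_end (k mod ?n)" if "c' \<le> k mod ?n" "even c'" for k c'
    using that by (rule gt0)
  have "i div ?n \<le> j div ?n" using assms(1,2) by (intro zdiv_mono1) auto
  moreover have "j div ?n \<le> i div ?n + 1"
  proof (rule ccontr)
    assume "\<not> ?thesis"
    then have "?n * (i div ?n + 2) \<le> ?n * (j div ?n)" using n by (intro mult_left_mono) auto
    then have "?n * (i div ?n) + 2 * ?n \<le> ?n * (j div ?n)" by (simp add: distrib_left)
    then show False using eq r assms(3) n by linarith
  qed
  ultimately consider "j div ?n = i div ?n" | "j div ?n = i div ?n + 1" by linarith
  then show ?thesis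
  proof cases
    case 1
    define c' where "c' = c - ?n * (i div ?n)"
    have "even c'" using assms(4) by (simp add: c'_def)
    moreover have "i mod ?n < c'" "c' \<le> j mod ?n" using assms(1,2) eq arg_cong[OF 1, of "\<lambda>x. ?n * x"] unfolding c'_def by linarith+
    moreover have "ray_val N c' = ray_val N c"
      using ray_val_shift[of N c "- 4 * (i div ?n)"] by (simp add: c'_def algebra_simps)
    ultimately show ?thesis unfolding cell_word_def
      using lcp_ray_word_le[of c' "odd_end (i mod ?n)" "odd_end (j mod ?n)" N] lt gt by simp
  next
    \<comment> \<open>The arc crosses the seam. As it is at most half a turn, the reduced cells lie
      on either side of the ray at angle two; its value is 0, so the words share no letter.\<close>
    case 2
    let ?c = "2 * 5 ^ N :: int"
    have "?n * (j div ?n) = ?n * (i div ?n) + ?n" using 2 by (simp add: distrib_left)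
    then have "j mod ?n < ?c" "?c \<le> i mod ?n" using eq r assms(3) by linarith+
    moreover have "ray_val N ?c = 0" using ray_val_shift[of N 0 2] ray_val_refine[of 0 N 0] by (simp add: mult.commute)
    ultimately have "length (longest_common_prefix (cell_word N j) (cell_word N i)) \<le> 0" unfolding cell_word_def
      using lcp_ray_word_le[of ?c "odd_end (j mod ?n)" "odd_end (i mod ?n)" N] lt gt by simp
    then show ?thesis by (simp add: lcp_commute)
  qed
qed

section \<open>Which letters of a cell word survive on later levels\<close>

text \<open>Cell \<open>i\<close> lies in the coarser cell \<open>i div 5\<close>, whose word is cut
  before two new letters are appended. Births happen at distance one from the ends, so at least one
  letter beyond the vertex of the coarser even ray is kept.\<close>

lemma ray_word_descend:
  "\<exists>m. nat (ray_val N (even_end (i div 5))) + 1 \<le> m \<and> m \<le> length (ray_word N (odd_end (i div 5)))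
    \<and> ray_val N (even_end (i div 5)) \<le> ray_val (Suc N) (even_end i)
    \<and> ray_word (Suc N) (odd_end i) = take m (ray_word N (odd_end (i div 5))) @ [(Suc N, 2 * odd_end i), (Suc N, 2 * odd_end i + 1)]"
proof -
  define k where "k = i div 5"
  note b = ray_val_nonneg[of N k] ray_val_nonneg[of N "k+1"] ray_val_le[of N k] ray_val_le[of N "k+1"] ray_val_sum[of N k]
  have "i mod 5 = 0 \<or> i mod 5 = 1 \<or> i mod 5 = 2 \<or> i mod 5 = 3 \<or> i mod 5 = 4" by presburger
  moreover have "i = 5 * k + i mod 5" by (simp add: k_def)
  ultimately consider "i = 5 * k" | "i = 5 * k + 1" | "i = 5 * k + 2" | "i = 5 * (k + 1) - 2" | "i = 5 * (k + 1) - 1"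
    by auto
  then show ?thesis
  proof cases
    case 1
    show ?thesis
    proof (cases "even k")
      case True
      have e: "odd_end i = 5 * k + 1" "even_end i = 5 * k" "odd_end k = k + 1" "even_end k = k"
        using True by (simp_all add: 1 odd_end_def even_end_def)
      show ?thesis using b unfolding k_def[symmetric] e ray_word_Suc ray_val_Suc
        by (intro exI[of _ "nat (ray_val N k + 1)"]) (simp add: length_ray_word butlast_conv_take; ((intro conjI)?; linarith))
    next
      case False
      have e: "odd_end i = 5 * k" "even_end i = 5 * k + 1" "odd_end k = k" "even_end k = k + 1"
        using False by (simp_all add: 1 odd_end_def even_end_def)
      show ?thesis using b unfolding k_def[symmetric] e ray_word_Suc ray_val_Suc
        by (intro exI[of _ "length (ray_word N k)"]) (simp add: length_ray_word butlast_conv_take; ((intro conjI)?; linarith))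
    qed
  next
    case 2
    show ?thesis
    proof (cases "even k")
      case True
      have e: "odd_end i = 5 * k + 1" "even_end i = 5 * k + 2" "odd_end k = k + 1" "even_end k = k"
        using True by (simp_all add: 2 odd_end_def even_end_def)
      show ?thesis using b unfolding k_def[symmetric] e ray_word_Suc ray_val_Suc
        by (intro exI[of _ "nat (ray_val N k + 1)"]) (simp add: length_ray_word butlast_conv_take; ((intro conjI)?; linarith))
    next
      case False
      have e: "odd_end i = 5 * k + 2" "even_end i = 5 * k + 1" "odd_end k = k" "even_end k = k + 1"
        using False by (simp_all add: 2 odd_end_def even_end_def)
      show ?thesis using b unfolding k_def[symmetric] e ray_word_Suc ray_val_Suc
        by (intro exI[of _ "length (ray_word N k) - 1"]) (simp add: length_ray_word butlast_conv_take; ((intro conjI)?; linarith))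
    qed
  next
    case 3
    show ?thesis
    proof (cases "even k")
      case True
      have e: "odd_end i = 5 * (k + 1) - 2" "even_end i = 5 * k + 2" "odd_end k = k + 1" "even_end k = k"
        using True by (simp_all add: 3 odd_end_def even_end_def)
      show ?thesis using b unfolding k_def[symmetric] e ray_word_Suc ray_val_Suc
        by (intro exI[of _ "length (ray_word N (k + 1)) - 1"]) (simp add: length_ray_word butlast_conv_take; ((intro conjI)?; linarith))
    next
      case False
      have e: "odd_end i = 5 * k + 2" "even_end i = 5 * (k + 1) - 2" "odd_end k = k" "even_end k = k + 1"
        using False by (simp_all add: 3 odd_end_def even_end_def)
      show ?thesis using b unfolding k_def[symmetric] e ray_word_Suc ray_val_Suc
        by (intro exI[of _ "length (ray_word N k) - 1"]) (simp add: length_ray_word butlast_conv_take; ((intro conjI)?; linarith))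
    qed
  next
    case 4
    show ?thesis
    proof (cases "even k")
      case True
      have e: "odd_end i = 5 * (k + 1) - 2" "even_end i = 5 * (k + 1) - 1" "odd_end k = k + 1" "even_end k = k"
        using True by (simp_all add: 4 odd_end_def even_end_def)
      show ?thesis using b unfolding k_def[symmetric] e ray_word_Suc ray_val_Suc
        by (intro exI[of _ "length (ray_word N (k + 1)) - 1"]) (simp add: length_ray_word butlast_conv_take; ((intro conjI)?; linarith))
    next
      case False
      have e: "odd_end i = 5 * (k + 1) - 1" "even_end i = 5 * (k + 1) - 2" "odd_end k = k" "even_end k = k + 1"
        using False by (simp_all add: 4 odd_end_def even_end_def)
      show ?thesis using b unfolding k_def[symmetric] e ray_word_Suc ray_val_Suc
        by (intro exI[of _ "nat (ray_val N (k + 1) + 1)"]) (simp add: length_ray_word butlast_conv_take; ((intro conjI)?; linarith))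
    qed
  next
    case 5
    show ?thesis
    proof (cases "even k")
      case True
      have e: "odd_end i = 5 * (k + 1)" "even_end i = 5 * (k + 1) - 1" "odd_end k = k + 1" "even_end k = k"
        using True by (simp_all add: 5 odd_end_def even_end_def)
      show ?thesis using b unfolding k_def[symmetric] e ray_word_Suc ray_val_Suc
        by (intro exI[of _ "length (ray_word N (k + 1))"]) (simp add: length_ray_word butlast_conv_take; ((intro conjI)?; linarith))
    next
      case False
      have e: "odd_end i = 5 * (k + 1) - 1" "even_end i = 5 * (k + 1)" "odd_end k = k" "even_end k = k + 1"
        using False by (simp_all add: 5 odd_end_def even_end_def)
      show ?thesis using b unfolding k_def[symmetric] e ray_word_Suc ray_val_Suc
        by (intro exI[of _ "nat (ray_val N (k + 1) + 1)"]) (simp add: length_ray_word butlast_conv_take; ((intro conjI)?; linarith))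
    qed
  qed
qed

text \<open>Iterated descent. \<open>m\<close> is the least number of letters kept in any step, so
  everything from position \<open>m\<close> on is younger than level \<open>M\<close>.\<close>

lemma ray_word_ancestor:
  "\<exists>m. nat (ray_val M (even_end (i div 5 ^ K))) + 1 \<le> m \<and> m \<le> length (ray_word M (odd_end (i div 5 ^ K)))
    \<and> m \<le> length (ray_word (M + K) (odd_end i))
    \<and> ray_val M (even_end (i div 5 ^ K)) \<le> ray_val (M + K) (even_end i)
    \<and> take m (ray_word (M + K) (odd_end i)) = take m (ray_word M (odd_end (i div 5 ^ K)))
    \<and> (\<forall>j. m \<le> j \<longrightarrow> j < length (ray_word (M + K) (odd_end i)) \<longrightarrow> M < fst (ray_word (M + K) (odd_end i) ! j))"
proof (induction K arbitrary: i)
  case 0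
  have "nat (ray_val M (even_end i)) + 1 \<le> length (ray_word M (odd_end i))"
    using ends_sum[of M i] cell_gap_01[of M i] ray_val_nonneg[of M "even_end i"] by (simp add: length_ray_word) linarith
  then show ?case by (intro exI[of _ "length (ray_word M (odd_end i))"]) auto
next
  case (Suc K)
  let ?p = "i div 5 ^ Suc K"
  have p: "i div 5 div 5 ^ K = ?p" by (simp add: zdiv_zmult2_eq)
  from Suc[of "i div 5"] obtain m where
    m: "nat (ray_val M (even_end ?p)) + 1 \<le> m" "m \<le> length (ray_word M (odd_end ?p))"
      "m \<le> length (ray_word (M + K) (odd_end (i div 5)))"
      "ray_val M (even_end ?p) \<le> ray_val (M + K) (even_end (i div 5))"
      "take m (ray_word (M + K) (odd_end (i div 5))) = take m (ray_word M (odd_end ?p))"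
      "\<And>j. m \<le> j \<Longrightarrow> j < length (ray_word (M + K) (odd_end (i div 5))) \<Longrightarrow> M < fst (ray_word (M + K) (odd_end (i div 5)) ! j)"
    unfolding p by blast
  from ray_word_descend[of "M + K" i] obtain m1 where
    m1: "nat (ray_val (M + K) (even_end (i div 5))) + 1 \<le> m1" "m1 \<le> length (ray_word (M + K) (odd_end (i div 5)))"
      "ray_val (M + K) (even_end (i div 5)) \<le> ray_val (Suc (M + K)) (even_end i)"
      and w: "ray_word (Suc (M + K)) (odd_end i) = take m1 (ray_word (M + K) (odd_end (i div 5))) @ [(Suc (M + K), 2 * odd_end i), (Suc (M + K), 2 * odd_end i + 1)]"
    by blast
  let ?w = "ray_word (M + Suc K) (odd_end i)"
  have "nat (ray_val M (even_end ?p)) + 1 \<le> min m m1"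
    using m(1,4) m1(1) by simp
  moreover have "min m m1 \<le> length (ray_word M (odd_end ?p))" "min m m1 \<le> length ?w" using m(2) m1(2) w by auto
  moreover have "ray_val M (even_end ?p) \<le> ray_val (M + Suc K) (even_end i)" using m(4) m1(3) by simp
  moreover have "take (min m m1) ?w = take (min m m1) (ray_word M (odd_end ?p))"
  proof -
    have "take (min m m1) ?w = take (min m m1) (ray_word (M + K) (odd_end (i div 5)))"
      using w m1(2) by (simp add: min_def)
    also have "\<dots> = take (min m m1) (take m (ray_word (M + K) (odd_end (i div 5))))" by simp
    finally show ?thesis by (simp only: m(5)) simp
  qed
  moreover have "M < fst (?w ! j)" if "min m m1 \<le> j" "j < length ?w" for j
  proof (cases "j < m1")
    case True
    then have "?w ! j = ray_word (M + K) (odd_end (i div 5)) ! j" using w m1(2) by (simp add: nth_append)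
    then show ?thesis using m(6)[of j] True that m1(2) by auto
  next
    case False
    with that w m1(2) have "j - m1 < 2" by auto
    then have "j = m1 \<or> j = Suc m1" using False by linarith
    then show ?thesis using w m1(2) by (auto simp: nth_append)
  qed
  ultimately show ?case by blast
qed

text \<open>The word reaches \<open>cell_gap M i + 2 <= 3\<close> letters beyond the vertex of the
  even end, and its last two letters were created at level \<open>M\<close>.\<close>

lemma ray_word_top_level:
  assumes "nat (ray_val M (even_end i)) + 1 \<le> j" "j < length (ray_word M (odd_end i))"
  shows "fst (ray_word M (odd_end i) ! j) = M"
proof (cases M)
  case 0
  then show ?thesis using assms by (auto simp: less_Suc_eq)
next
  case (Suc N)
  have "length (ray_word M (odd_end i)) = nat (ray_val M (even_end i) + cell_gap M i + 2)"
    using ends_sum[of M i] by (simp add: length_ray_word)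
  then have j: "length (ray_word M (odd_end i)) - 2 \<le> j"
    using assms(1) cell_gap_01[of M i] ray_val_nonneg[of M "even_end i"] by auto
  from ray_word_descend[of N i] obtain w where "ray_word M (odd_end i) = w @ [(M, 2 * odd_end i), (M, 2 * odd_end i + 1)]"
    unfolding Suc by blast
  then show ?thesis using j assms(2) by (auto simp: nth_append nth_Cons' less_Suc_eq)
qed

lemma ray_word_hd: "ray_word N i \<noteq> [] \<and> fst (hd (ray_word N i)) = 0"
proof (induction N arbitrary: i)
  case (Suc N)
  note b = ray_val_nonneg[of N] ray_val_le[of N]
  have *: "m > 0 \<Longrightarrow> fst (hd (take m (ray_word N k) @ ys)) = 0" for m k ys
    using Suc[of k] by (cases "ray_word N k"; cases m) auto
  have "length (ray_word N k) - 1 > 0" for k using b(2)[of k] by (simp add: length_ray_word)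
  with b show ?case using Suc
    by (cases i rule: nearest5_cases) (auto simp only: ray_word_Suc butlast_conv_take hd_append2 simp_thms append_is_Nil_conv list.distinct intro!: *, auto simp: zero_less_nat_eq add_nonneg_pos)
qed auto

section \<open>Positions of the rays on the circles\<close>

text \<open>During the phase \<open>s \<in> {0..2}\<close> of level \<open>N\<close> the rays move linearly from the positions \<open>ray_start\<close>, where
  the newborn rays of a pair coincide, to the positions \<open>i / 5 ^ N\<close>.\<close>

primrec ray_start :: "nat \<Rightarrow> int \<Rightarrow> real" where
  "ray_start 0 = (\<lambda>i. real_of_int i)"
| "ray_start (Suc N) = (\<lambda>i. let k = (i + 2) div 5; d = i - 5 * k in
     (real_of_int k + (if d = 0 then 0 else if d > 0 then 1 / (2 + real_of_int (cell_gap N k))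
       else - 1 / (2 + real_of_int (cell_gap N (k - 1))))) / 5 ^ N)"

definition ray_pos :: "nat \<Rightarrow> int \<Rightarrow> real \<Rightarrow> real" where
  "ray_pos N i s = (1 - s / 2) * ray_start N i + (s / 2) * (real_of_int i / 5 ^ N)"

text \<open>A pair is born at distance one from the end of a cell of length
  \<open>2 + cell_gap\<close>, hence the fraction.\<close>

lemma ray_start_Suc:
  "ray_start (Suc N) (5 * k) = k / 5 ^ N"
  "ray_start (Suc N) (5 * k + 1) = (k + 1 / (2 + real_of_int (cell_gap N k))) / 5 ^ N"
  "ray_start (Suc N) (5 * k + 2) = (k + 1 / (2 + real_of_int (cell_gap N k))) / 5 ^ N"
  "ray_start (Suc N) (5 * k - 1) = (k - 1 / (2 + real_of_int (cell_gap N (k - 1)))) / 5 ^ N"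
  "ray_start (Suc N) (5 * k - 2) = (k - 1 / (2 + real_of_int (cell_gap N (k - 1)))) / 5 ^ N"
  by (simp_all only: ray_start.simps nearest5 Let_def) simp_all

declare ray_start.simps(2) [simp del]

lemma ray_start_width:
  "real_of_int (cell_gap (Suc N) i) / 3 \<le> (ray_start (Suc N) (i + 1) - ray_start (Suc N) i) * 5 ^ N"
  "(ray_start (Suc N) (i + 1) - ray_start (Suc N) i) * 5 ^ N \<le> real_of_int (cell_gap (Suc N) i) / 2"
proof -
  have "real_of_int (cell_gap (Suc N) i) / 3 \<le> (ray_start (Suc N) (i + 1) - ray_start (Suc N) i) * 5 ^ N
    \<and> (ray_start (Suc N) (i + 1) - ray_start (Suc N) i) * 5 ^ N \<le> real_of_int (cell_gap (Suc N) i) / 2"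
  proof (cases i rule: nearest5_cases)
    case (c0 k) show ?thesis using cell_gap_01[of N k] unfolding c0 shift5 ray_start_Suc cell_gap_Suc by (auto simp: field_simps)
  next
    case (p1 k) show ?thesis unfolding p1 shift5 ray_start_Suc cell_gap_Suc by (auto simp: field_simps)
  next
    case (p2 k) show ?thesis using cell_gap_01[of N k] unfolding p2 shift5 ray_start_Suc cell_gap_Suc by (auto simp: field_simps)
  next
    case (m1 k) show ?thesis using cell_gap_01[of N "k - 1"] unfolding m1 shift5 ray_start_Suc cell_gap_Suc by (auto simp: field_simps)
  next
    case (m2 k) show ?thesis unfolding m2 shift5 ray_start_Suc cell_gap_Suc by (auto simp: field_simps)
  qed
  then show "real_of_int (cell_gap (Suc N) i) / 3 \<le> (ray_start (Suc N) (i + 1) - ray_start (Suc N) i) * 5 ^ N"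
    "(ray_start (Suc N) (i + 1) - ray_start (Suc N) i) * 5 ^ N \<le> real_of_int (cell_gap (Suc N) i) / 2" by auto
qed

lemma ray_start_close: "\<bar>ray_start N i - i / 5 ^ N\<bar> \<le> 2 / 5 ^ N"
proof (cases N)
  case (Suc M)
  have c: "cell_gap M k = 0 \<or> cell_gap M k = 1" for k by (rule cell_gap_01)
  have "\<bar>ray_start (Suc M) i - i / 5 ^ Suc M\<bar> * 5 ^ Suc M \<le> 2"
  proof -
    have "\<bar>ray_start (Suc M) i - i / 5 ^ Suc M\<bar> * 5 ^ Suc M = \<bar>(ray_start (Suc M) i - i / 5 ^ Suc M) * 5 ^ Suc M\<bar>" by (simp add: abs_mult)
    also have "\<dots> = \<bar>5 * (ray_start (Suc M) i * 5 ^ M) - i\<bar>" by (simp add: algebra_simps)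
    also have "\<dots> \<le> 2"
    proof (cases i rule: nearest5_cases)
      case (c0 k) show ?thesis unfolding c0 ray_start_Suc by simp
    next
      case (p1 k) show ?thesis using c[of k] unfolding p1 ray_start_Suc by auto
    next
      case (p2 k) show ?thesis using c[of k] unfolding p2 ray_start_Suc by auto
    next
      case (m1 k) show ?thesis using c[of "k-1"] unfolding m1 ray_start_Suc by auto
    next
      case (m2 k) show ?thesis using c[of "k-1"] unfolding m2 ray_start_Suc by auto
    qed
    finally show ?thesis .
  qed
  then show ?thesis unfolding Suc by (simp only: pos_le_divide_eq[symmetric] zero_less_power zero_less_numeral)
qed simp

lemma ray_start_parent:
  "real_of_int (i div 5) / 5 ^ N \<le> ray_start (Suc N) i" "ray_start (Suc N) i \<le> real_of_int (i div 5 + 1) / 5 ^ N"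
  "ray_start (Suc N) (i + 1) \<le> real_of_int (i div 5 + 1) / 5 ^ N"
proof -
  define k where "k = i div 5"
  have "i mod 5 = 0 \<or> i mod 5 = 1 \<or> i mod 5 = 2 \<or> i mod 5 = 3 \<or> i mod 5 = 4" by presburger
  moreover have "i = 5 * k + i mod 5" by (simp add: k_def)
  ultimately consider "i = 5 * k" | "i = 5 * k + 1" | "i = 5 * k + 2" | "i = 5 * (k + 1) - 2" | "i = 5 * (k + 1) - 1"
    by auto
  then have "real_of_int k / 5 ^ N \<le> ray_start (Suc N) i \<and> ray_start (Suc N) i \<le> real_of_int (k + 1) / 5 ^ N
    \<and> ray_start (Suc N) (i + 1) \<le> real_of_int (k + 1) / 5 ^ N"
  proof cases
    case 1 show ?thesis using cell_gap_01[of N k] unfolding 1 shift5 ray_start_Suc by (auto simp: divide_right_mono)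
  next
    case 2 show ?thesis using cell_gap_01[of N k] unfolding 2 shift5 ray_start_Suc by (auto simp: divide_right_mono)
  next
    case 3 show ?thesis using cell_gap_01[of N k] unfolding 3 shift5 ray_start_Suc by (auto simp: divide_right_mono)
  next
    case 4 show ?thesis using cell_gap_01[of N k] unfolding 4 shift5 ray_start_Suc by (auto simp: divide_right_mono)
  next
    case 5 show ?thesis using cell_gap_01[of N k] unfolding 5 shift5 ray_start_Suc by (auto simp: divide_right_mono)
  qed
  then show "real_of_int (i div 5) / 5 ^ N \<le> ray_start (Suc N) i" "ray_start (Suc N) i \<le> real_of_int (i div 5 + 1) / 5 ^ N"
  "ray_start (Suc N) (i + 1) \<le> real_of_int (i div 5 + 1) / 5 ^ N" by (simp_all add: k_def)
qed

lemma ray_start_shift: "ray_start N (i + 5 ^ N * t) = ray_start N i + t"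
proof (cases N)
  case (Suc M)
  have e: "5 * k + 5 ^ Suc M * t = 5 * (k + 5 ^ M * t)" for k by (simp add: algebra_simps)
  have e': "5 * k + d + 5 ^ Suc M * t = 5 * (k + 5 ^ M * t) + d"
    "5 * k - d + 5 ^ Suc M * t = 5 * (k + 5 ^ M * t) - d" for k d by (simp_all add: algebra_simps)
  have e'': "k + 5 ^ M * t - 1 = (k - 1) + 5 ^ M * t" for k by simp
  show ?thesis unfolding Suc
    by (cases i rule: nearest5_cases) (simp_all only: e e' e'' ray_start_Suc cell_gap_shift, simp_all add: field_simps)
qed simp

lemma ray_pos_shift: "ray_pos N (i + 5 ^ N * t) s = ray_pos N i s + t"
proof -
  have "real_of_int (i + 5 ^ N * t) / 5 ^ N = real_of_int i / 5 ^ N + t"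
    by (simp add: add_divide_distrib)
  then show ?thesis unfolding ray_pos_def ray_start_shift by (simp add: algebra_simps)
qed

definition cell_width :: "nat \<Rightarrow> int \<Rightarrow> real \<Rightarrow> real" where
  "cell_width N i s = ray_pos N (i + 1) s - ray_pos N i s"

text \<open>Grid length per quarter turn at height \<open>h\<close>, up to bounded factors.
  Subtracting 1 makes it vanish linearly at the centre, like \<open>sinh\<close>.\<close>

definition circumference :: "real \<Rightarrow> real" where
  "circumference h = 5 powr (h / 2) - 1"

lemma circumference_level:
  "circumference (2 * real N + s) = 5 ^ N * 5 powr (s / 2) - 1"
  by (simp add: circumference_def add_divide_distrib powr_add powr_realpow)

lemma circumference_nonneg: "0 \<le> h \<Longrightarrow> 0 \<le> circumference h"
  unfolding circumference_def by (simp add: ge_one_powr_ge_zero)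

lemma circumference_mono: "h \<le> h' \<Longrightarrow> circumference h \<le> circumference h'"
  unfolding circumference_def by simp

lemma powr_half_bounds:
  fixes s :: real
  assumes "0 \<le> s" "s \<le> 2"
  shows "1 + s / 2 \<le> 5 powr (s / 2)" "5 powr (s / 2) \<le> 1 + 2 * s" "5 powr (s / 2) \<le> 5"
proof -
  have "exp 1 \<le> (5::real)" using exp_le by linarith
  then have "exp 1 powr (s / 2) \<le> 5 powr (s / 2)" using assms by (intro powr_mono2) auto
  then have "exp (s / 2) \<le> 5 powr (s / 2)" by (simp add: exp_powr_real)
  then show "1 + s / 2 \<le> 5 powr (s / 2)" using exp_ge_add_one_self[of "s / 2"] by linarith
  have "exp ((1 - s / 2) *\<^sub>R 0 + (s / 2) *\<^sub>R ln 5) \<le> (1 - s / 2) * exp 0 + (s / 2) * exp (ln (5::real))"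
    using assms by (intro convex_onD[OF exp_convex]) auto
  then show 2: "5 powr (s / 2) \<le> 1 + 2 * s" by (simp add: powr_def)
  then show "5 powr (s / 2) \<le> 5" using assms by linarith
qed

lemma circumference_bounds:
  assumes "0 \<le> s" "s \<le> 2"
  shows "circumference (2 * real N + s) \<le> 5 * 5 ^ N" "N > 0 \<Longrightarrow> 4 / 5 * 5 ^ N \<le> circumference (2 * real N + s)"
    "circumference s \<le> 2 * s" "s / 2 \<le> circumference s"
proof -
  note b = powr_half_bounds[OF assms]
  have "5 ^ N * 5 powr (s / 2) \<le> 5 ^ N * (5::real)" using b by (intro mult_left_mono) auto
  then show "circumference (2 * real N + s) \<le> 5 * 5 ^ N" unfolding circumference_level by linarith
  have "5 ^ N * 1 \<le> 5 ^ N * 5 powr (s / 2)" using b assms by (intro mult_left_mono) auto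
  moreover have "N > 0 \<Longrightarrow> (5::real) \<le> 5 ^ N" using power_increasing[of 1 N "5::real"] by simp
  ultimately show "N > 0 \<Longrightarrow> 4 / 5 * 5 ^ N \<le> circumference (2 * real N + s)" unfolding circumference_level by linarith
  show "circumference s \<le> 2 * s" "s / 2 \<le> circumference s" using b by (simp_all add: circumference_def)
qed

text \<open>Angular width and grid length are compared. Scaled by \<open>5 ^ N\<close>, the width
  interpolates in \<open>s\<close> between a multiple of the gap and 1, so both quantities vanish
  together for newborn cells. Level 0 is separate because there the circumference itself tends to
  0.\<close>

lemma cell_width_bounds:
  assumes "0 \<le> s" "s \<le> 2"
  shows "circumference (2 * real N + s) * cell_width N i s \<le> 13 * (real_of_int (cell_gap N i) + s)"
    "real_of_int (cell_gap N i) + s \<le> 4 * (circumference (2 * real N + s) * cell_width N i s)"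
    "0 \<le> cell_width N i s" "s > 0 \<Longrightarrow> 0 < cell_width N i s"
proof -
  let ?c = "circumference (2 * real N + s)" and ?W = "cell_width N i s" and ?g = "real_of_int (cell_gap N i)"
  have "?c * ?W \<le> 13 * (?g + s) \<and> ?g + s \<le> 4 * (?c * ?W) \<and> 0 \<le> ?W \<and> (s > 0 \<longrightarrow> 0 < ?W)"
  proof (cases N)
    case 0
    then have "?W = 1" by (simp add: cell_width_def ray_pos_def field_simps)
    then show ?thesis using circumference_bounds(3,4)[OF assms] 0 assms by simp
  next
    case (Suc M)
    have g: "?g = 0 \<or> ?g = 1" using cell_gap_01[of N i] by auto
    define w where "w = (ray_start N (i + 1) - ray_start N i) * 5 ^ N"
    have w: "5 / 3 * ?g \<le> w" "w \<le> 5 / 2 * ?g"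
      using ray_start_width[of M i] unfolding Suc w_def by (simp_all add: field_simps)
    have W: "?W * 5 ^ N = (1 - s / 2) * w + s / 2"
      by (simp add: cell_width_def ray_pos_def w_def field_simps)
    have s: "0 \<le> 1 - s / 2" using assms by simp
    have "(1 - s / 2) * (5 / 3 * ?g) \<le> (1 - s / 2) * w" "(1 - s / 2) * w \<le> (1 - s / 2) * (5 / 2 * ?g)"
      using s w by (intro mult_left_mono; simp)+
    then have W2: "(?g + s) / 3 \<le> ?W * 5 ^ N" "?W * 5 ^ N \<le> 5 / 2 * (?g + s)"
      using g assms W by auto
    have gs: "0 \<le> ?g + s" "s > 0 \<longrightarrow> 0 < ?g + s" using g assms by auto
    then have "0 \<le> ?W * 5 ^ N" using W2 by linarith
    moreover have "s > 0 \<longrightarrow> 0 < ?W * 5 ^ N"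
    proof
      assume "s > 0"
      then have "0 < (?g + s) / 3" using g assms by auto
      then show "0 < ?W * 5 ^ N" using W2(1) by linarith
    qed
    ultimately have W0: "0 \<le> ?W" "s > 0 \<longrightarrow> 0 < ?W"
      using zero_less_power[of "5::real" N, OF zero_less_numeral] by (auto simp: zero_le_mult_iff zero_less_mult_iff)
    have "?c * ?W \<le> (5 * 5 ^ N) * ?W" using circumference_bounds(1)[OF assms] W0 by (intro mult_right_mono) auto
    moreover have "(4 / 5 * 5 ^ N) * ?W \<le> ?c * ?W" using circumference_bounds(2)[OF assms, of N] Suc W0 by (intro mult_right_mono) auto
    ultimately show ?thesis using W2 W0 gs by (simp add: algebra_simps)
  qed
  then show "?c * ?W \<le> 13 * (?g + s)" "?g + s \<le> 4 * (?c * ?W)" "0 \<le> ?W" "s > 0 \<Longrightarrow> 0 < ?W" by auto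
qed

lemma ray_pos_mono:
  assumes "0 \<le> s" "s \<le> 2" "i \<le> j" shows "ray_pos N i s \<le> ray_pos N j s"
  using assms(3)
proof (induction j rule: int_ge_induct)
  case (step j)
  then show ?case using cell_width_bounds(3)[OF assms(1,2), of N j] by (simp add: cell_width_def)
qed simp

lemma ray_pos_motion: "\<bar>ray_pos N i s - ray_pos N i s'\<bar> \<le> \<bar>s - s'\<bar> / 5 ^ N"
proof -
  have "(1 - s / 2) * a + s / 2 * q - ((1 - s' / 2) * a + s' / 2 * q) = - (s - s') / 2 * (a - q)" for a q
    by (simp add: field_simps)
  then have "ray_pos N i s - ray_pos N i s' = - (s - s') / 2 * (ray_start N i - i / 5 ^ N)"
    unfolding ray_pos_def by blast
  then have "\<bar>ray_pos N i s - ray_pos N i s'\<bar> = \<bar>s - s'\<bar> / 2 * \<bar>ray_start N i - i / 5 ^ N\<bar>"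
    by (simp only: abs_mult abs_divide abs_minus_cancel abs_numeral)
  also have "\<dots> \<le> \<bar>s - s'\<bar> / 2 * (2 / 5 ^ N)" by (intro mult_left_mono ray_start_close) auto
  finally show ?thesis by simp
qed

lemma ray_pos_close:
  assumes "0 \<le> s" "s \<le> 2" shows "\<bar>ray_pos N i s - i / 5 ^ N\<bar> \<le> 2 / 5 ^ N"
proof -
  have "ray_pos N i 2 = i / 5 ^ N" by (simp add: ray_pos_def)
  moreover have "\<bar>s - 2\<bar> / 5 ^ N \<le> 2 / 5 ^ N" using assms by (intro divide_right_mono) auto
  ultimately show ?thesis using ray_pos_motion[of N i s 2] by simp
qed

lemma ray_pos_parent:
  assumes "0 \<le> s" "s \<le> 2"
  shows "real_of_int (i div 5) / 5 ^ N \<le> ray_pos (Suc N) i s" "ray_pos (Suc N) (i + 1) s \<le> real_of_int (i div 5 + 1) / 5 ^ N"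
proof -
  have p: "(1 - s / 2) * a + s / 2 * a = a" for a :: real by (simp add: field_simps)
  have s: "0 \<le> 1 - s / 2" "0 \<le> s / 2" using assms by auto
  have e: "real_of_int (5 * z) / 5 ^ Suc N = real_of_int z / 5 ^ N" for z by simp
  have "5 * (i div 5) \<le> i" "i + 1 \<le> 5 * (i div 5 + 1)" by presburger+
  then have "real_of_int (5 * (i div 5)) / 5 ^ Suc N \<le> real_of_int i / 5 ^ Suc N" "real_of_int (i + 1) / 5 ^ Suc N \<le> real_of_int (5 * (i div 5 + 1)) / 5 ^ Suc N"
    by (intro divide_right_mono; simp only: of_int_le_iff; simp)+
  then have b: "real_of_int (i div 5) / 5 ^ N \<le> real_of_int i / 5 ^ Suc N" "real_of_int (i + 1) / 5 ^ Suc N \<le> real_of_int (i div 5 + 1) / 5 ^ N"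
    unfolding e by auto
  have "(1 - s / 2) * (real_of_int (i div 5) / 5 ^ N) + s / 2 * (real_of_int (i div 5) / 5 ^ N) \<le> ray_pos (Suc N) i s"
    unfolding ray_pos_def using s b ray_start_parent[where i=i and N=N] by (intro add_mono mult_left_mono) auto
  then show "real_of_int (i div 5) / 5 ^ N \<le> ray_pos (Suc N) i s" unfolding p .
  have "ray_pos (Suc N) (i + 1) s \<le> (1 - s / 2) * (real_of_int (i div 5 + 1) / 5 ^ N) + s / 2 * (real_of_int (i div 5 + 1) / 5 ^ N)"
    unfolding ray_pos_def using s b ray_start_parent[where i=i and N=N] by (intro add_mono mult_left_mono) auto
  then show "ray_pos (Suc N) (i + 1) s \<le> real_of_int (i div 5 + 1) / 5 ^ N" unfolding p .
qed

lemma cell_ex: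
  assumes "0 \<le> s" "s \<le> 2"
  shows "\<exists>i. ray_pos N i s \<le> x \<and> x < ray_pos N (i + 1) s"
proof -
  define S where "S = {i. ray_pos N i s \<le> x}"
  have close: "\<bar>ray_pos N i s * 5 ^ N - i\<bar> \<le> 2" for i
  proof -
    have "ray_pos N i s * 5 ^ N - i = (ray_pos N i s - i / 5 ^ N) * 5 ^ N" by (simp add: field_simps)
    then have "\<bar>ray_pos N i s * 5 ^ N - i\<bar> = \<bar>ray_pos N i s - i / 5 ^ N\<bar> * 5 ^ N" by (simp add: abs_mult)
    also have "\<dots> \<le> 2 / 5 ^ N * 5 ^ N" by (intro mult_right_mono ray_pos_close assms) auto
    finally show ?thesis by simp
  qed
  have mem: "i \<in> S \<longleftrightarrow> ray_pos N i s * 5 ^ N \<le> x * 5 ^ N" for i by (simp add: S_def)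
  have "\<lfloor>x * 5 ^ N\<rfloor> - 2 \<in> S" using close[of "\<lfloor>x * 5 ^ N\<rfloor> - 2"] unfolding mem by linarith
  moreover have bd: "i \<le> \<lfloor>x * 5 ^ N\<rfloor> + 2" if "i \<in> S" for i using that close[of i] unfolding mem by linarith
  ultimately have f: "finite (S \<inter> {\<lfloor>x * 5 ^ N\<rfloor> - 2..})" "S \<inter> {\<lfloor>x * 5 ^ N\<rfloor> - 2..} \<noteq> {}"
    by (auto intro: finite_subset[of _ "{\<lfloor>x * 5 ^ N\<rfloor> - 2..\<lfloor>x * 5 ^ N\<rfloor> + 2}"])
  let ?i = "Max (S \<inter> {\<lfloor>x * 5 ^ N\<rfloor> - 2..})"
  have "?i \<in> S \<inter> {\<lfloor>x * 5 ^ N\<rfloor> - 2..}" using f by (rule Max_in)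
  moreover have "?i + 1 \<notin> S"
  proof
    assume "?i + 1 \<in> S"
    then have "?i + 1 \<in> S \<inter> {\<lfloor>x * 5 ^ N\<rfloor> - 2..}" using \<open>?i \<in> S \<inter> _\<close> by auto
    then have "?i + 1 \<le> ?i" using f by (intro Max_ge)
    then show False by simp
  qed
  moreover have "i \<in> S \<longleftrightarrow> ray_pos N i s \<le> x" for i by (simp add: S_def)
  ultimately show ?thesis by (intro exI[of _ ?i]) auto
qed

section \<open>Lipschitz bounds along circles and along lines of constant angle\<close>

definition cell_pos :: "nat \<Rightarrow> int \<Rightarrow> real \<Rightarrow> real \<Rightarrow> real" where
  "cell_pos N i f s = (1 - f) * ray_pos N i s + f * ray_pos N (i + 1) s"

lemma cell_pos_eq: "cell_pos N i f s = ray_pos N i s + f * cell_width N i s"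
  by (simp add: cell_pos_def cell_width_def algebra_simps)

lemma cell_pos_motion:
  assumes "0 \<le> f" "f \<le> 1"
  shows "\<bar>cell_pos N i f s - cell_pos N i f s'\<bar> \<le> \<bar>s - s'\<bar> / 5 ^ N"
proof -
  let ?d = "\<lambda>i. ray_pos N i s - ray_pos N i s'"
  have "cell_pos N i f s - cell_pos N i f s' = (1 - f) * ?d i + f * ?d (i + 1)"
    by (simp add: cell_pos_def algebra_simps)
  also have "\<bar>\<dots>\<bar> \<le> (1 - f) * \<bar>?d i\<bar> + f * \<bar>?d (i + 1)\<bar>"
    using assms abs_triangle_ineq[of "(1 - f) * ?d i" "f * ?d (i + 1)"] by (simp add: abs_mult)
  also have "\<dots> \<le> (1 - f) * (\<bar>s - s'\<bar> / 5 ^ N) + f * (\<bar>s - s'\<bar> / 5 ^ N)"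
    using assms by (intro add_mono mult_left_mono ray_pos_motion) auto
  finally show ?thesis by (simp add: field_simps)
qed

lemma sum_cell_width: "(\<Sum>k=1..n. cell_width N (i + int k) s) = ray_pos N (i + int n + 1) s - ray_pos N (i + 1) s"
  by (induction n) (simp_all add: cell_width_def algebra_simps)

lemma cell_point_le_ordered:
  assumes "0 \<le> s" "s \<le> 2" "0 \<le> f" "f \<le> 1" "0 \<le> f'" "f' \<le> 1" "i < j"
  shows "branch_dist (cell_point N i f s) (cell_point N j f' s)
    \<le> 4 * circumference (2 * real N + s) * (cell_pos N j f' s - cell_pos N i f s)"
proof -
  let ?P = "\<lambda>i f. cell_point N i f s" and ?g = "circumference (2 * real N + s)"
  let ?l = "\<lambda>i. real_of_int (cell_gap N i) + s"
  obtain n where n: "j = i + int n + 1" using \<open>i < j\<close> zless_iff_Suc_zadd[of i j] by auto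
  have len: "?l k \<le> 4 * (?g * cell_width N k s)" for k using cell_width_bounds(2) assms by blast
  have "branch_dist (?P i f) (?P j f') \<le> branch_dist (?P i f) (?P (i + int n) 1) + (branch_dist (?P (i + int n) 1) (?P j 0) + branch_dist (?P j 0) (?P j f'))"
    using branch_dist_triangle[of "?P i f" "?P j f'" "?P (i + int n) 1"] branch_dist_triangle[of "?P (i + int n) 1" "?P j f'" "?P j 0"] by simp
  also have "\<dots> \<le> ((1 - f) * ?l i + (\<Sum>k=1..n. ?l (i + int k))) + (0 + f' * ?l j)"
    using cell_point_chain[OF assms(1-4), of N i n] cell_point_join[OF assms(1,2), of N "i + int n"]
      cell_point_same_level[of 0 s f' N j] assms unfolding n by simp
  also have "\<dots> \<le> ((1 - f) * (4 * (?g * cell_width N i s)) + (\<Sum>k=1..n. 4 * (?g * cell_width N (i + int k) s))) + (0 + f' * (4 * (?g * cell_width N j s)))"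
    using assms len by (intro add_mono mult_left_mono sum_mono) auto
  also have "\<dots> = 4 * ?g * ((1 - f) * cell_width N i s + (\<Sum>k=1..n. cell_width N (i + int k) s) + f' * cell_width N j s)"
    by (simp add: sum_distrib_left algebra_simps)
  also have "(1 - f) * cell_width N i s + (\<Sum>k=1..n. cell_width N (i + int k) s) + f' * cell_width N j s = cell_pos N j f' s - cell_pos N i f s"
    unfolding sum_cell_width cell_pos_eq by (simp add: n cell_width_def algebra_simps)
  finally show ?thesis .
qed

lemma cell_point_le:
  assumes "0 \<le> s" "s \<le> 2" "0 \<le> f" "f \<le> 1" "0 \<le> f'" "f' \<le> 1"
  shows "branch_dist (cell_point N i f s) (cell_point N j f' s)
    \<le> 4 * circumference (2 * real N + s) * \<bar>cell_pos N i f s - cell_pos N j f' s\<bar>"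
proof -
  let ?g = "circumference (2 * real N + s)"
  have g: "0 \<le> ?g" using assms by (intro circumference_nonneg) auto
  have mono: "4 * ?g * x \<le> 4 * ?g * \<bar>y\<bar>" if "x = y \<or> x = - y" for x y
    using that g by (intro mult_left_mono) auto
  consider "i = j" | "i < j" | "j < i" by linarith
  then show ?thesis
  proof cases
    case 1
    have "\<bar>f - f'\<bar> * (real_of_int (cell_gap N j) + s) \<le> \<bar>f - f'\<bar> * (4 * (?g * cell_width N j s))"
      using cell_width_bounds(2)[OF assms(1,2)] by (intro mult_left_mono) auto
    also have "\<dots> = 4 * ?g * \<bar>(f - f') * cell_width N j s\<bar>"
      using cell_width_bounds(3)[OF assms(1,2)] by (simp add: abs_mult)
    also have "(f - f') * cell_width N j s = cell_pos N j f s - cell_pos N j f' s"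
      by (simp add: cell_pos_eq algebra_simps)
    finally show ?thesis using cell_point_same_level[of f s f' N j] assms 1 by simp
  next
    case 2
    then have "branch_dist (cell_point N i f s) (cell_point N j f' s) \<le> 4 * ?g * (cell_pos N j f' s - cell_pos N i f s)"
      using assms by (intro cell_point_le_ordered)
    also have "\<dots> \<le> 4 * ?g * \<bar>cell_pos N i f s - cell_pos N j f' s\<bar>" by (rule mono) simp
    finally show ?thesis .
  next
    case 3
    then have "branch_dist (cell_point N j f' s) (cell_point N i f s) \<le> 4 * ?g * (cell_pos N i f s - cell_pos N j f' s)"
      using assms by (intro cell_point_le_ordered)
    also have "\<dots> \<le> 4 * ?g * \<bar>cell_pos N i f s - cell_pos N j f' s\<bar>" by (rule mono) simp
    finally show ?thesis by (subst branch_dist_commute)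
  qed
qed

lemma mod_5_times: "0 \<le> d \<Longrightarrow> d < 5 \<Longrightarrow> 0 < n \<Longrightarrow> (5 * i + d) mod (5 * n) = 5 * (i mod n) + (d :: int)"
proof -
  assume "0 \<le> d" "d < 5" "0 < n"
  have "(5 * i + d) mod (5 * n) = ((5 * i + d) div 5) mod n * 5 + (5 * i + d) mod 5"
    using zmod_zmult2_eq[of n "5 * i + d" 5] \<open>0 < n\<close> by simp
  then show ?thesis using \<open>0 \<le> d\<close> \<open>d < 5\<close> by simp
qed

text \<open>The finer word keeps \<open>m\<close> letters of the coarser one, and at birth no depth
  in the finer cell exceeds \<open>m\<close>; equal depths therefore mean the same point.\<close>

lemma cell_point_subcell:
  assumes "k div 5 = i" "0 \<le> f" "f \<le> 1" "0 \<le> f'" "f' \<le> 1" "cell_depth N i f 2 = cell_depth (Suc N) k f' 0"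
  shows "branch_dist (cell_point N i f 2) (cell_point (Suc N) k f' 0) = 0"
proof -
  let ?n = "4 * 5 ^ N :: int"
  have "k = 5 * i + k mod 5" using assms(1) by auto
  then have "k mod (5 * ?n) = 5 * (i mod ?n) + k mod 5" using mod_5_times[of "k mod 5" ?n i] by simp
  then have d: "k mod (4 * 5 ^ Suc N) div 5 = i mod ?n" by simp
  have par: "even (k mod (4 * 5 ^ Suc N)) \<longleftrightarrow> even k" by (rule even_mod_circ)
  obtain m where m: "m \<le> length (cell_word N i)"
    "cell_word (Suc N) k = take m (cell_word N i) @ [(Suc N, 2 * odd_end (k mod (4 * 5 ^ Suc N))), (Suc N, 2 * odd_end (k mod (4 * 5 ^ Suc N)) + 1)]"
    using ray_word_descend[of N "k mod (4 * 5 ^ Suc N)"] unfolding d cell_word_def by blast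
  then have l: "length (cell_word (Suc N) k) = m + 2" by simp
  have "cell_depth (Suc N) k f' 0 \<le> m"
    using cell_depth_bounds(3)[of f' 0 "Suc N" k] real_length_cell_word[of "Suc N" k] assms l by simp
  then show ?thesis using branch_dist_eq_abs[of m "cell_point N i f 2" "cell_point (Suc N) k f' 0"] m assms(6)
    by (simp add: cell_point_def)
qed

text \<open>Height \<open>2 * N + 2\<close> is both phase 2 of level \<open>N\<close> and phase 0 of
  the next level. The finer cells \<open>5 * i\<close>, \<open>5 * i + 2\<close> and
  \<open>5 * (i + 1) - 1\<close>, of lengths 1, gap and 1, cover the coarse cell; the other two are
  degenerate.\<close>

lemma cell_point_next_level:
  assumes "0 \<le> f" "f \<le> 1"
  obtains k f' where "0 \<le> f'" "f' \<le> 1" "cell_pos N i f 2 = cell_pos (Suc N) k f' 0"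
    "branch_dist (cell_point N i f 2) (cell_point (Suc N) k f' 0) = 0"
proof -
  let ?g = "real_of_int (cell_gap N i)"
  let ?l = "?g + 2"
  have g: "?g = 0 \<or> ?g = 1" using cell_gap_01[of N i] by auto
  have pos: "cell_pos N i f 2 = (i + f) / 5 ^ N" by (simp add: cell_pos_def ray_pos_def field_simps)
  have pos': "cell_pos (Suc N) k f' 0 = (1 - f') * ray_start (Suc N) k + f' * ray_start (Suc N) (k + 1)" for k f'
    by (simp add: cell_pos_def ray_pos_def)
  have gi: "real_of_int (ray_val N i) + ray_val N (i + 1) = 2 * real N - ?g"
    by (simp add: cell_gap_def)
  have e5: "even_end (5 * i) = (if even i then 5 * i else 5 * i + 1)"
    "even_end (5 * i + 2) = (if even i then 5 * i + 2 else 5 * (i + 1) - 2)"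
    "even_end (5 * (i + 1) - 1) = (if even i then 5 * (i + 1) - 1 else 5 * (i + 1))"
    "even_end i = (if even i then i else i + 1)"
    by (auto simp: even_end_def)
  consider "f * ?l \<le> 1" | "1 \<le> f * ?l" "f * ?l \<le> ?l - 1" | "?l - 1 \<le> f * ?l" by linarith
  then show ?thesis
  proof cases
    case 1
    show ?thesis
    proof (rule that[of "f * ?l" "5 * i"])
      show "0 \<le> f * ?l" "f * ?l \<le> 1" using 1 assms g by auto
      show "cell_pos N i f 2 = cell_pos (Suc N) (5 * i) (f * ?l) 0"
        unfolding pos pos' ray_start_Suc using g by (auto simp: field_simps)
      show "branch_dist (cell_point N i f 2) (cell_point (Suc N) (5 * i) (f * ?l) 0) = 0"
      proof -
        have "even (5 * i) = even i" by simp
        then have "cell_depth N i f 2 = cell_depth (Suc N) (5 * i) (f * ?l) 0"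
          using g gi by (cases "even i") (simp_all only: cell_depth_def e5 if_True if_False ray_val_Suc cell_gap_Suc, auto simp: algebra_simps)
        then show ?thesis using 1 assms g by (intro cell_point_subcell) auto
      qed
    qed
  next
    case 2
    \<comment> \<open>For gap 0 the middle cell is a single point; for gap 1 it is the middle third
      of a cell of length 3.\<close>
    let ?f = "if ?g = 0 then 0 else 3 * f - 1"
    have gap2: "cell_gap (Suc N) (5 * i + 2) = cell_gap N i" by (rule cell_gap_Suc)
    show ?thesis
    proof (rule that[of ?f "5 * i + 2"])
      show "0 \<le> ?f" "?f \<le> 1" using 2 assms g by auto
      show "cell_pos N i f 2 = cell_pos (Suc N) (5 * i + 2) ?f 0"
        unfolding pos pos' shift5 ray_start_Suc using g 2 by (auto simp: field_simps)
      show "branch_dist (cell_point N i f 2) (cell_point (Suc N) (5 * i + 2) ?f 0) = 0"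
      proof -
        have "even (5 * i + 2) = even i" by simp
        then have "cell_depth N i f 2 = cell_depth (Suc N) (5 * i + 2) ?f 0"
          using g gi 2 by (cases "even i") (simp_all only: cell_depth_def e5 if_True if_False ray_val_Suc gap2, auto simp: algebra_simps)
        then show ?thesis using 2 assms g by (intro cell_point_subcell) auto
      qed
    qed
  next
    case 3
    let ?f = "f * ?l - (?l - 1)"
    have le: "f * ?l \<le> ?l" using assms g by auto
    have d5: "(5 * (i + 1) - 1) div 5 = i" by presburger
    have od: "odd i \<Longrightarrow> even (5 * (i + 1) - 1) = False" "even i \<Longrightarrow> even (5 * (i + 1) - 1)" by auto
    show ?thesis
    proof (rule that[of ?f "5 * (i + 1) - 1"])
      show "0 \<le> ?f" "?f \<le> 1" using 3 le by auto
      show "cell_pos N i f 2 = cell_pos (Suc N) (5 * (i + 1) - 1) ?f 0"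
        unfolding pos pos' shift5 ray_start_Suc using g 3 by (auto simp: field_simps)
      have "cell_depth N i f 2 = cell_depth (Suc N) (5 * (i + 1) - 1) ?f 0"
        using g gi by (cases "even i") (simp_all only: cell_depth_def e5 if_True if_False od ray_val_Suc cell_gap_Suc, auto simp: algebra_simps)
      then show "branch_dist (cell_point N i f 2) (cell_point (Suc N) (5 * (i + 1) - 1) ?f 0) = 0"
        using 3 le assms by (intro cell_point_subcell d5) auto
    qed
  qed
qed

lemma cell_pos_ex:
  assumes "0 \<le> s" "s \<le> 2"
  obtains i f where "0 \<le> f" "f < 1" "cell_pos N i f s = x" "ray_pos N i s \<le> x" "x < ray_pos N (i + 1) s"
proof -
  obtain i where i: "ray_pos N i s \<le> x" "x < ray_pos N (i + 1) s" using cell_ex[OF assms] by blast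
  then have W: "0 < cell_width N i s" by (simp add: cell_width_def)
  show ?thesis
    by (rule that[of "(x - ray_pos N i s) / cell_width N i s" i]) (use i W in \<open>auto simp: cell_pos_eq field_simps cell_width_def\<close>)
qed

text \<open>The rays move, so a constant angle is not a constant fraction. Keeping the fraction
  costs \<open>\<bar>s - s'\<bar>\<close>; correcting the angle, which is off by at most
  \<open>\<bar>s - s'\<bar> / 5 ^ N\<close>, costs at most 20 times as much.\<close>

lemma cell_point_vertical_same:
  assumes "0 \<le> s" "s \<le> 2" "0 \<le> s'" "s' \<le> 2" "0 \<le> f" "f \<le> 1" "0 \<le> f'" "f' \<le> 1"
    and "cell_pos N i f s = cell_pos N j f' s'"
  shows "branch_dist (cell_point N i f s) (cell_point N j f' s') \<le> 41 * \<bar>s - s'\<bar>"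
proof -
  let ?g = "circumference (2 * real N + s')"
  have g: "0 \<le> ?g" using assms by (intro circumference_nonneg) auto
  have "4 * ?g * \<bar>cell_pos N i f s' - cell_pos N j f' s'\<bar> \<le> 4 * (5 * 5 ^ N) * (\<bar>s - s'\<bar> / 5 ^ N)"
    using g cell_pos_motion[of f N i s' s] circumference_bounds(1)[of s' N] assms
    by (intro mult_mono) (auto simp: abs_minus_commute)
  then have "branch_dist (cell_point N i f s') (cell_point N j f' s') \<le> 20 * \<bar>s - s'\<bar>"
    using cell_point_le[of s' f f' N i j] assms by simp
  moreover have "branch_dist (cell_point N i f s) (cell_point N i f s') \<le> \<bar>s - s'\<bar>"
    using assms by (intro cell_point_same_fraction)
  ultimately show ?thesis
    using branch_dist_triangle[of "cell_point N i f s" "cell_point N j f' s'" "cell_point N i f s'"] abs_ge_zero[of "s - s'"]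
    by (simp add: algebra_simps del: abs_ge_zero)
qed

lemma cell_point_vertical:
  assumes "0 \<le> s" "s \<le> 2" "0 \<le> s'" "s' \<le> 2" "0 \<le> f" "f \<le> 1" "0 \<le> f'" "f' \<le> 1"
    and "cell_pos N i f s = cell_pos (N + K) j f' s'"
    and "K = 0 \<Longrightarrow> s \<le> s'"
  shows "branch_dist (cell_point N i f s) (cell_point (N + K) j f' s') \<le> 41 * (2 * real K + s' - s)"
  using assms
proof (induction K arbitrary: j f' s')
  case 0
  then show ?case using cell_point_vertical_same[of s s' f f' N i j] by simp
next
  case (Suc K)
  obtain a u where a: "0 \<le> u" "u < 1" "cell_pos (N + K) a u 2 = cell_pos N i f s"
    by (rule cell_pos_ex[of 2 "N + K" "cell_pos N i f s"]) auto
  obtain b v where b: "0 \<le> v" "v \<le> 1" "cell_pos (N + K) a u 2 = cell_pos (Suc (N + K)) b v 0"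
    "branch_dist (cell_point (N + K) a u 2) (cell_point (Suc (N + K)) b v 0) = 0"
    using cell_point_next_level[of u "N + K" a] a by (metis less_imp_le)
  have "branch_dist (cell_point N i f s) (cell_point (N + K) a u 2) \<le> 41 * (2 * real K + 2 - s)"
    using a Suc.prems by (intro Suc.IH) auto
  moreover have "branch_dist (cell_point (Suc (N + K)) b v 0) (cell_point (Suc (N + K)) j f' s') \<le> 41 * \<bar>0 - s'\<bar>"
    using a b Suc.prems by (intro cell_point_vertical_same) auto
  ultimately show ?case
    using b(4) branch_dist_triangle[of "cell_point N i f s" "cell_point (N + Suc K) j f' s'" "cell_point (N + K) a u 2"]
      branch_dist_triangle[of "cell_point (N + K) a u 2" "cell_point (N + Suc K) j f' s'" "cell_point (Suc (N + K)) b v 0"] Suc.prems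
    by simp
qed

section \<open>The tree coordinate as a function of angle and height\<close>

definition level :: "real \<Rightarrow> nat" where "level h = nat \<lfloor>h / 2\<rfloor>"
definition phase :: "real \<Rightarrow> real" where "phase h = h - 2 * real (level h)"

text \<open>The interval is half open, so degenerate cells are never selected and the index is
  unique.\<close>

definition cell_index :: "real \<Rightarrow> real \<Rightarrow> int" where
  "cell_index x h = (THE i. ray_pos (level h) i (phase h) \<le> x \<and> x < ray_pos (level h) (i + 1) (phase h))"

definition cell_fraction :: "real \<Rightarrow> real \<Rightarrow> real" where
  "cell_fraction x h = (x - ray_pos (level h) (cell_index x h) (phase h)) / cell_width (level h) (cell_index x h) (phase h)"

definition branch_point :: "real \<Rightarrow> real \<Rightarrow> (nat \<times> int) list \<times> real" where
  "branch_point x h = cell_point (level h) (cell_index x h) (cell_fraction x h) (phase h)"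

lemma phase_bounds: "0 \<le> h \<Longrightarrow> 0 \<le> phase h" "0 \<le> h \<Longrightarrow> phase h \<le> 2" "2 * real (level h) + phase h = h"
  unfolding phase_def level_def by (simp_all; linarith)+

lemma cell_index_unique:
  assumes "0 \<le> h" "ray_pos (level h) i (phase h) \<le> x" "x < ray_pos (level h) (i + 1) (phase h)"
  shows "cell_index x h = i"
  unfolding cell_index_def
proof (rule the_equality)
  fix j assume j: "ray_pos (level h) j (phase h) \<le> x \<and> x < ray_pos (level h) (j + 1) (phase h)"
  have m: "a \<le> b \<Longrightarrow> ray_pos (level h) a (phase h) \<le> ray_pos (level h) b (phase h)" for a b
    using phase_bounds assms(1) by (intro ray_pos_mono) auto
  show "j = i" using m[of "i + 1" j] m[of "j + 1" i] j assms by linarith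
qed (use assms in auto)

lemma cell_index:
  assumes "0 \<le> h"
  shows "ray_pos (level h) (cell_index x h) (phase h) \<le> x" "x < ray_pos (level h) (cell_index x h + 1) (phase h)"
    "0 \<le> cell_fraction x h" "cell_fraction x h < 1" "cell_pos (level h) (cell_index x h) (cell_fraction x h) (phase h) = x"
proof -
  obtain i where "ray_pos (level h) i (phase h) \<le> x" "x < ray_pos (level h) (i + 1) (phase h)"
    using cell_ex[of "phase h"] phase_bounds assms by blast
  then show i: "ray_pos (level h) (cell_index x h) (phase h) \<le> x" "x < ray_pos (level h) (cell_index x h + 1) (phase h)"
    using cell_index_unique[OF assms] by metis+
  then have W: "0 < cell_width (level h) (cell_index x h) (phase h)" by (simp add: cell_width_def)
  show "0 \<le> cell_fraction x h" "cell_fraction x h < 1" "cell_pos (level h) (cell_index x h) (cell_fraction x h) (phase h) = x"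
    using i W by (auto simp: cell_fraction_def cell_pos_eq field_simps cell_width_def)
qed

lemma cell_index_shift:
  assumes "0 \<le> h"
  shows "cell_index (x + of_int t) h = cell_index x h + 5 ^ level h * t"
proof (rule cell_index_unique[OF assms])
  have "cell_index x h + 5 ^ level h * t + 1 = (cell_index x h + 1) + 5 ^ level h * t" by simp
  then have "ray_pos (level h) (cell_index x h + 5 ^ level h * t + 1) (phase h) = ray_pos (level h) (cell_index x h + 1) (phase h) + t"
    by (simp only: ray_pos_shift)
  then show "x + of_int t < ray_pos (level h) (cell_index x h + 5 ^ level h * t + 1) (phase h)"
    using cell_index(2)[OF assms, of x] by simp
qed (simp add: ray_pos_shift cell_index(1)[OF assms])

lemma cell_fraction_shift:
  assumes "0 \<le> h"
  shows "cell_fraction (x + of_int t) h = cell_fraction x h"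
proof -
  have "cell_width N (i + 5 ^ N * t) s = cell_width N i s" for N i s
  proof -
    have "i + 5 ^ N * t + 1 = (i + 1) + 5 ^ N * t" by simp
    then show ?thesis unfolding cell_width_def by (simp only: ray_pos_shift add_diff_cancel_right)
  qed
  then show ?thesis by (simp add: cell_fraction_def cell_index_shift[OF assms] ray_pos_shift)
qed

lemma branch_point_horizontal:
  assumes "0 \<le> h"
  shows "branch_dist (branch_point x h) (branch_point x' h) \<le> 4 * circumference h * \<bar>x - x'\<bar>"
  using cell_point_le[of "phase h" "cell_fraction x h" "cell_fraction x' h" "level h" "cell_index x h" "cell_index x' h"]
    cell_index[OF assms, of x] cell_index[OF assms, of x'] phase_bounds[of h] assms
  by (simp add: branch_point_def)

lemma level_mono: "h \<le> h' \<Longrightarrow> level h \<le> level h'"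
  unfolding level_def by (intro nat_mono floor_mono) simp

lemma branch_point_vertical_ordered:
  assumes "0 \<le> h" "h \<le> h'"
  shows "branch_dist (branch_point x h) (branch_point x h') \<le> 41 * (h' - h)"
proof -
  have h': "0 \<le> h'" using assms by simp
  define K where "K = level h' - level h"
  have K: "level h' = level h + K" using level_mono[OF assms(2)] by (simp add: K_def)
  have "branch_dist (branch_point x h) (branch_point x h') \<le> 41 * (2 * real K + phase h' - phase h)"
    unfolding branch_point_def K
    using cell_index[OF assms(1), of x] cell_index[OF h', of x] phase_bounds(1,2)[OF assms(1)] phase_bounds(1,2)[OF h'] assms phase_bounds(3)[of h] phase_bounds(3)[of h']
    unfolding K by (intro cell_point_vertical) (auto simp: less_imp_le)
  also have "2 * real K + phase h' - phase h = h' - h" using phase_bounds(3)[of h] phase_bounds(3)[of h'] K by simp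
  finally show ?thesis .
qed

lemma branch_point_vertical:
  assumes "0 \<le> h" "0 \<le> h'"
  shows "branch_dist (branch_point x h) (branch_point x h') \<le> 41 * \<bar>h - h'\<bar>"
  using branch_point_vertical_ordered[of h h' x] branch_point_vertical_ordered[of h' h x] assms
  by (cases "h \<le> h'") (auto simp: branch_dist_commute)

section \<open>The tree coordinate is Lipschitz for the polar distance\<close>

lemma ln2_half: "1 / 2 \<le> ln (2::real)"
proof -
  have "exp (1/2 :: real) \<le> 2"
  proof -
    have "exp (1/2 :: real) ^ 2 = exp 1" by (simp add: exp_of_nat_mult[symmetric])
    also have "\<dots> \<le> 2 ^ 2" using exp_le by simp
    finally show ?thesis by (rule power2_le_imp_le) simp
  qed
  then show ?thesis by (subst ln_ge_iff; simp)
qed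

lemma ln5_bounds: "1 \<le> ln (5::real)" "ln (5::real) \<le> 2"
proof -
  show "1 \<le> ln (5::real)" using exp_le by (simp add: ln_ge_iff)
  have "(5::real) \<le> exp 1 ^ 2"
  proof -
    have "5 / 2 \<le> exp (1::real)" using exp_lower_Taylor_quadratic[of "1::real"] by simp
    then have "(5/2) ^ 2 \<le> exp (1::real) ^ 2" by (intro power_mono) auto
    then show ?thesis by (simp add: power2_eq_square)
  qed
  then have "5 \<le> exp (2::real)" by (simp add: exp_of_nat_mult[symmetric])
  then have "ln 5 \<le> ln (exp (2::real))" by (subst ln_le_cancel_iff) auto
  then show "ln (5::real) \<le> 2" by simp
qed

text \<open>Up to a bounded factor this is the hyperbolic distance of two points of heights \<open>h\<close> and \<open>h'\<close> whose angles
  differ by \<open>\<Delta>\<close>.\<close>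

definition polar_dist :: "real \<Rightarrow> real \<Rightarrow> real \<Rightarrow> real" where
  "polar_dist \<Delta> h h' = \<bar>h - h'\<bar> + ln (1 + circumference (min h h') * \<Delta>)"

text \<open>If the arc at height \<open>h\<close> is short, it is crossed there. Otherwise the path
  imitates a hyperbolic geodesic: inwards to the height \<open>h0\<close> at which circumference
  times angle is 1, across at bounded cost, and out again.\<close>

lemma branch_point_upper_ordered:
  assumes "0 \<le> h" "h \<le> h'"
  shows "branch_dist (branch_point x h) (branch_point x' h') \<le> 172 * polar_dist \<bar>x - x'\<bar> h h'"
proof -
  let ?P = branch_point and ?g = "circumference h" and ?D = "\<bar>x - x'\<bar>"
  let ?L = "ln (1 + ?g * ?D)"
  have g: "0 \<le> ?g" using assms by (intro circumference_nonneg)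
  have gD: "0 \<le> ?g * ?D" using g by simp
  have L0: "0 \<le> ?L" using gD by simp
  have "branch_dist (?P x h) (?P x' h') \<le> 172 * ?L + 41 * (h' - h)"
  proof (cases "?g * ?D \<le> 1")
    case True
    have "?g * ?D / 2 \<le> ?L"
    proof -
have "?g * ?D / (1 + ?g * ?D) \<le> ?L" using ln_add_one_self_le_self2[of "- (?g * ?D) / (1 + ?g * ?D)"] gD
        by (simp add: field_simps ln_div)
      moreover have "?g * ?D / 2 \<le> ?g * ?D / (1 + ?g * ?D)" using gD True by (intro divide_left_mono) auto
      ultimately show ?thesis by linarith
    qed
    then have "branch_dist (?P x h) (?P x' h) \<le> 8 * ?L" using branch_point_horizontal[OF assms(1), of x x'] by simp
    moreover have "branch_dist (?P x' h) (?P x' h') \<le> 41 * (h' - h)" by (rule branch_point_vertical_ordered[OF assms])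
    ultimately show ?thesis using branch_dist_triangle[of "?P x h" "?P x' h'" "?P x' h"] L0 by linarith
  next
    case False
    then have D: "0 < ?D" using g by (cases "?D = 0") auto
    define h0 where "h0 = 2 * log 5 (1 + 1 / ?D)"
    have h0: "0 \<le> h0"
    proof -
      have "1 \<le> 1 + 1 / ?D" using D by simp
      then have "0 \<le> log 5 (1 + 1 / ?D)" by (subst zero_le_log_cancel_iff; linarith)
      then show ?thesis by (simp add: h0_def)
    qed
    have "5 powr log 5 (1 + 1 / ?D) = 1 + 1 / ?D"
      using D by (intro powr_log_cancel add_pos_pos divide_pos_pos) simp_all
    then have c0: "circumference h0 = 1 / ?D" by (simp only: h0_def circumference_def) simp
    have "1 / ?D < ?g" using False D by (simp add: field_simps)
    then have "circumference h0 < circumference h" using c0 by simp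
    then have h0h: "h0 \<le> h" using circumference_mono[of h h0] by linarith
    have "5 powr (h / 2) = 1 + ?g" by (simp add: circumference_def)
    have p: "0 < 1 + ?g" "0 < 1 + 1 / ?D" "0 < 1 + ?g * ?D"
      using g gD D by (linarith, intro add_pos_pos divide_pos_pos, simp_all, linarith)
    have "h / 2 = log 5 (1 + ?g)" using \<open>5 powr (h / 2) = 1 + ?g\<close> log_powr_cancel[of 5 "h / 2"] by simp
    then have "(h - h0) / 2 = log 5 (1 + ?g) - log 5 (1 + 1 / ?D)" by (simp add: h0_def)
    also have "\<dots> = log 5 ((1 + ?g) / (1 + 1 / ?D))" by (rule log_divide_pos[OF p(1,2), symmetric])
    also have "\<dots> \<le> log 5 (1 + ?g * ?D)"
    proof (subst log_le_cancel_iff)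
      show "(1 + ?g) / (1 + 1 / ?D) \<le> 1 + ?g * ?D"
      proof -
        have "(1 + a) / (1 + 1 / d) \<le> 1 + a * d" if "0 < d" "0 \<le> a" for a d :: real
        proof -
          have "(1 + a) / (1 + 1 / d) = (1 + a) * d / (d + 1)" using that by (simp add: field_simps)
          also have "\<dots> \<le> 1 + a * d"
            using that by (subst pos_divide_le_eq) (simp_all add: algebra_simps)
          finally show ?thesis .
        qed
        then show ?thesis using g D by blast
      qed
      show "0 < (1 + ?g) / (1 + 1 / ?D)" using p by (intro divide_pos_pos)
    qed (use p in simp_all)
    also have "\<dots> = ?L / ln 5" by (simp add: log_def)
    also have "\<dots> \<le> ?L" using ln5_bounds L0 by (simp add: divide_le_eq mult_le_cancel_left1)
    finally have hh: "h - h0 \<le> 2 * ?L" by simp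
    have "ln 2 \<le> ?L" using False by simp
    then have L1: "1 \<le> 2 * ?L" using ln2_half by linarith
    have "branch_dist (?P x h) (?P x h0) \<le> 41 * (h - h0)"
      using branch_point_vertical_ordered[OF h0 h0h, of x] by (simp add: branch_dist_commute)
    moreover have "branch_dist (?P x h0) (?P x' h0) \<le> 4"
      using branch_point_horizontal[OF h0, of x x'] c0 D by simp
    moreover have "branch_dist (?P x' h0) (?P x' h') \<le> 41 * (h' - h0)"
      using h0 h0h assms by (intro branch_point_vertical_ordered) auto
    ultimately have "branch_dist (?P x h) (?P x' h') \<le> 41 * (h - h0) + 4 + 41 * (h' - h0)"
      using branch_dist_triangle[of "?P x h" "?P x' h'" "?P x h0"] branch_dist_triangle[of "?P x h0" "?P x' h'" "?P x' h0"] by linarith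
    \<comment> \<open>The descent to \<open>h0\<close> is paid twice, \<open>82 * 2\<close>, and the
      crossing cost 4 is at most \<open>8 * ?L\<close>; together this is 172.\<close>
    then show ?thesis using hh L1 by argo
  qed
  moreover have "polar_dist ?D h h' = (h' - h) + ?L" using assms by (simp add: polar_dist_def min_def)
  ultimately show ?thesis using assms by simp
qed

lemma polar_dist_commute: "polar_dist D h h' = polar_dist D h' h"
  by (simp add: polar_dist_def abs_minus_commute min.commute)

lemma branch_point_upper:
  assumes "0 \<le> h" "0 \<le> h'"
  shows "branch_dist (branch_point x h) (branch_point x' h') \<le> 172 * polar_dist \<bar>x - x'\<bar> h h'"
  using branch_point_upper_ordered[of h h' x x'] branch_point_upper_ordered[of h' h x' x] assms
  by (cases "h \<le> h'") (auto simp: branch_dist_commute polar_dist_commute[of _ h'] abs_minus_commute)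

section \<open>The lower bound\<close>

text \<open>A quarter turn exchanges the two colours, so \<open>branch_point (x + 1) h\<close> is the image of the point
  \<open>(x, h)\<close> in the second tree.\<close>

definition pair_dist :: "real \<Rightarrow> real \<Rightarrow> real \<Rightarrow> real \<Rightarrow> real" where
  "pair_dist x h x' h' = branch_dist (branch_point x h) (branch_point x' h')
     + branch_dist (branch_point (x + 1) h) (branch_point (x' + 1) h')"

text \<open>The image in the tree where the ray \<open>c\<close> is a vertex and separates its two
  sides.\<close>

definition ray_colour_point :: "int \<Rightarrow> real \<Rightarrow> real \<Rightarrow> (nat \<times> int) list \<times> real" where
  "ray_colour_point c x h = (if even c then branch_point x h else branch_point (x + 1) h)"

lemma branch_point_shift1:
  assumes "0 \<le> h"
  shows "branch_point (x + 1) h = cell_point (level h) (cell_index x h + 5 ^ level h) (cell_fraction x h) (phase h)"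
  using cell_index_shift[OF assms, of x 1] cell_fraction_shift[OF assms, of x 1]
  by (simp add: branch_point_def)

text \<open>The shift by the odd number \<open>5 ^ N\<close> makes the coordinate start at the other
  end of the cell.\<close>

lemma cell_depth_sum:
  "cell_depth N i f s + cell_depth N (i + 5 ^ N) f s = 2 * real N + s"
proof -
  have g: "cell_gap N (i + 5 ^ N) = cell_gap N i" "ray_val N (i + 5 ^ N) = ray_val N i"
    "ray_val N (i + 5 ^ N + 1) = ray_val N (i + 1)"
    using cell_gap_shift[of N i 1] ray_val_shift[of N i 1] ray_val_shift[of N "i + 1" 1] by (simp_all add: algebra_simps)
  have "real_of_int (ray_val N i) + ray_val N (i + 1) = 2 * real N - cell_gap N i" by (simp add: cell_gap_def)
  then show ?thesis using g by (auto simp: cell_depth_def even_end_def algebra_simps)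
qed

lemma branch_point_depth_sum:
  assumes "0 \<le> h"
  shows "snd (branch_point x h) + snd (branch_point (x + 1) h) = h"
  using cell_depth_sum phase_bounds(3)[of h]
  by (simp add: branch_point_shift1[OF assms]) (simp add: branch_point_def cell_point_def)

lemma ray_colour_depth_sum:
  "0 \<le> h \<Longrightarrow> snd (ray_colour_point c x h) + snd (ray_colour_point (c + 1) x h) = h"
  using branch_point_depth_sum[of h x] by (auto simp: ray_colour_point_def)

lemma pair_dist_ge_colour: "branch_dist (ray_colour_point c x h) (ray_colour_point c x' h') \<le> pair_dist x h x' h'"
  by (simp add: pair_dist_def ray_colour_point_def branch_dist_nonneg)

lemma pair_dist_ge_colours:
  "branch_dist (ray_colour_point c x h) (ray_colour_point c x' h')
    + branch_dist (ray_colour_point (c + 1) x h) (ray_colour_point (c + 1) x' h') \<le> pair_dist x h x' h'"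
  by (auto simp: pair_dist_def ray_colour_point_def)

lemma pair_dist_commute: "pair_dist x h x' h' = pair_dist x' h' x h"
  by (simp add: pair_dist_def branch_dist_commute)

lemma pair_dist_triangle: "pair_dist x h z k \<le> pair_dist x h y l + pair_dist y l z k"
  unfolding pair_dist_def
  using branch_dist_triangle[of "branch_point x h" "branch_point z k" "branch_point y l"]
    branch_dist_triangle[of "branch_point (x+1) h" "branch_point (z+1) k" "branch_point (y+1) l"] by linarith

lemma pair_dist_ge_height:
  assumes "0 \<le> h" "0 \<le> h'" shows "\<bar>h - h'\<bar> \<le> pair_dist x h x' h'"
  using branch_point_depth_sum[OF assms(1), of x] branch_point_depth_sum[OF assms(2), of x']
    branch_dist_ge[of "branch_point x h" "branch_point x' h'"] branch_dist_ge[of "branch_point (x+1) h" "branch_point (x'+1) h'"]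
  unfolding pair_dist_def by linarith

lemma pair_dist_vertical:
  assumes "0 \<le> h" "0 \<le> h'" shows "pair_dist x h x h' \<le> 82 * \<bar>h - h'\<bar>"
  using branch_point_vertical[OF assms, of x] branch_point_vertical[OF assms, of "x + 1"] by (simp add: pair_dist_def)

lemma lcp_ray_colour_le:
  assumes "0 \<le> h" "cell_index x h < c" "c \<le> cell_index x' h" "cell_index x' h - cell_index x h \<le> 2 * 5 ^ level h"
  shows "length (longest_common_prefix (fst (ray_colour_point c x h)) (fst (ray_colour_point c x' h))) \<le> nat (ray_val (level h) c)"
proof (cases "even c")
  case True
  then show ?thesis using lcp_cell_word_le[of "cell_index x h" c "cell_index x' h" "level h"] assms
    by (simp add: ray_colour_point_def branch_point_def cell_point_def)
next
  case False
  then show ?thesis using lcp_cell_word_le[of "cell_index x h + 5 ^ level h" "c + 5 ^ level h" "cell_index x' h + 5 ^ level h" "level h"] assms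
      ray_val_shift[of "level h" c 1]
    by (simp add: ray_colour_point_def branch_point_shift1[OF assms(1)] cell_point_def)
qed

lemma depth_right_ray:
  fixes x h :: real
  assumes "0 \<le> h"
  defines "i \<equiv> cell_index x h"
  shows "snd (ray_colour_point (i + 1) x h)
    = ray_val (level h) (i + 1) + (1 - cell_fraction x h) * (real_of_int (cell_gap (level h) i) + phase h)"
proof -
  have "i + 5 ^ level h + 1 = i + 1 + 5 ^ level h * 1" "i + 5 ^ level h = i + 5 ^ level h * 1" by simp_all
  then have v: "ray_val (level h) (i + 5 ^ level h + 1) = ray_val (level h) (i + 1)"
    "ray_val (level h) (i + 5 ^ level h) = ray_val (level h) i"
    "cell_gap (level h) (i + 5 ^ level h) = cell_gap (level h) i"
    by (simp_all only: ray_val_shift cell_gap_shift)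
  have "snd (branch_point x h) = cell_depth (level h) i (cell_fraction x h) (phase h)"
    "snd (branch_point (x + 1) h) = cell_depth (level h) (i + 5 ^ level h) (cell_fraction x h) (phase h)"
    by (simp_all only: branch_point_shift1[OF assms(1)]) (simp_all add: branch_point_def cell_point_def i_def)
  then show ?thesis unfolding ray_colour_point_def
    by (cases "even i") (simp_all add: v cell_depth_def even_end_def)
qed

lemma depth_left_ray:
  fixes x h :: real
  assumes "0 \<le> h"
  defines "i \<equiv> cell_index x h"
  shows "snd (ray_colour_point i x h)
    = ray_val (level h) i + cell_fraction x h * (real_of_int (cell_gap (level h) i) + phase h)"
proof -
  have "i + 5 ^ level h + 1 = i + 1 + 5 ^ level h * 1" "i + 5 ^ level h = i + 5 ^ level h * 1" by simp_all
  then have v: "ray_val (level h) (i + 5 ^ level h + 1) = ray_val (level h) (i + 1)"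
    "ray_val (level h) (i + 5 ^ level h) = ray_val (level h) i"
    "cell_gap (level h) (i + 5 ^ level h) = cell_gap (level h) i"
    by (simp_all only: ray_val_shift cell_gap_shift)
  have "snd (branch_point x h) = cell_depth (level h) i (cell_fraction x h) (phase h)"
    "snd (branch_point (x + 1) h) = cell_depth (level h) (i + 5 ^ level h) (cell_fraction x h) (phase h)"
    by (simp_all only: branch_point_shift1[OF assms(1)]) (simp_all add: branch_point_def cell_point_def i_def)
  then show ?thesis unfolding ray_colour_point_def
    by (cases "even i") (simp_all add: v cell_depth_def even_end_def)
qed

text \<open>Every ray between the points separates their images in the tree of its colour.
  Consecutive rays have different colours, so both trees are used at once. With few cells in
  between, the cell lengths are recovered one by one; with many, two consecutive rays of a coarse
  level suffice, since their values are small while both points are high.\<close>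

lemma same_level_lower:
  assumes "0 \<le> h" "x \<le> x'" "x' \<le> x + 2"
  shows "ln (1 + circumference h * (x' - x)) \<le> 78 * pair_dist x h x' h"
proof -
  define N where "N = level h"
  define s where "s = phase h"
  define i where "i = cell_index x h"
  define j where "j = cell_index x' h"
  define f where "f = cell_fraction x h"
  define f' where "f' = cell_fraction x' h"
  note defs = N_def s_def i_def j_def f_def f'_def
  define g where "g = circumference h"
  define E where "E = pair_dist x h x' h"
  define l where "l = (\<lambda>k. real_of_int (cell_gap N k) + s)"
  have s: "0 \<le> s" "s \<le> 2" "2 * real N + s = h" using phase_bounds[of h] assms(1) by (simp_all add: s_def N_def)
  have ci: "ray_pos N i s \<le> x" "x < ray_pos N (i + 1) s" "0 \<le> f" "f < 1" "cell_pos N i f s = x"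
    using cell_index[OF assms(1), of x] by (simp_all add: defs)
  have cj: "ray_pos N j s \<le> x'" "x' < ray_pos N (j + 1) s" "0 \<le> f'" "f' < 1" "cell_pos N j f' s = x'"
    using cell_index[OF assms(1), of x'] by (simp_all add: defs)
  have g0: "0 \<le> g" unfolding g_def using assms(1) by (rule circumference_nonneg)
  have E0: "0 \<le> E" by (simp add: E_def pair_dist_def branch_dist_nonneg)
  have l0: "0 \<le> l k" and l3: "l k \<le> 3" for k using cell_gap_01[of N k] s by (auto simp: l_def)
  have gW: "g * cell_width N k s \<le> 13 * l k" for k
    using cell_width_bounds(1)[OF s(1,2), of N k] s(3) by (simp add: g_def l_def)
  have ln_le: "ln (1 + g * (x' - x)) \<le> g * (x' - x)" using g0 assms(2) by (intro ln_add_one_self_le_self) simp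
  have mono: "a \<le> b \<Longrightarrow> ray_pos N a s \<le> ray_pos N b s" for a b using s by (intro ray_pos_mono)
  have ij: "i \<le> j"
  proof (rule ccontr)
    assume "\<not> i \<le> j"
    then have "ray_pos N (j + 1) s \<le> ray_pos N i s" by (intro mono) simp
    then show False using ci(1) cj(2) assms(2) by linarith
  qed
  have ji: "j - i \<le> 2 * 5 ^ N"
  proof (rule ccontr)
    assume "\<not> j - i \<le> 2 * 5 ^ N"
    then have "ray_pos N ((i + 1) + 5 ^ N * 2) s \<le> ray_pos N j s" by (intro mono) simp
    then show False using ci(2) cj(1) assms(3) unfolding ray_pos_shift by simp
  qed
  have lcp: "length (longest_common_prefix (fst (ray_colour_point c x h)) (fst (ray_colour_point c x' h))) \<le> nat (ray_val N c)"
    if "i < c" "c \<le> j" for c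
    using lcp_ray_colour_le[OF assms(1), of x c x'] that ji by (simp add: defs)
  \<comment> \<open>Adding the estimates for the rays \<open>c\<close> and \<open>c + 1\<close> in
    the two trees, the depths of each point sum to \<open>h\<close>; what remains is twice the
    length of the cell \<open>c\<close>.\<close>
  have sum2: "2 * (h - real_of_int (ray_val N c) - real_of_int (ray_val N (c + 1))) \<le> E"
    if "i < c" "c < j" for c
  proof -
    note b1 = branch_dist_ge_lcp(3)[OF lcp[of c]]
    note b2 = branch_dist_ge_lcp(3)[OF lcp[of "c + 1"]]
    show ?thesis using b1 b2 that ray_colour_depth_sum[OF assms(1), of c x] ray_colour_depth_sum[OF assms(1), of c x']
        pair_dist_ge_colours[of c x h x' h] ray_val_nonneg[of N c] ray_val_nonneg[of N "c+1"] unfolding E_def by simp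
  qed
  consider "i = j" | "i < j" "j - i \<le> 9" | "10 \<le> j - i" using ij by linarith
  then have "ln (1 + g * (x' - x)) \<le> 78 * E"
  proof cases
    case 1
    have "x' - x = (f' - f) * cell_width N i s"
      using ci(5) cj(5) 1 by (auto simp: cell_pos_eq algebra_simps)
    then have "g * (x' - x) = (f' - f) * (g * cell_width N i s)" by simp
    also have "\<dots> \<le> \<bar>f' - f\<bar> * (13 * l i)"
      by (rule mult_mono) (use gW[of i] g0 cell_width_bounds(3)[OF s(1,2), of N i] in auto)
    also have "\<dots> = 13 * branch_dist (branch_point x h) (branch_point x' h)"
      using cell_point_same_level[of f s f' N i] ci cj s 1 by (simp add: branch_point_def defs[symmetric] l_def abs_minus_commute)
    also have "\<dots> \<le> 13 * E" by (simp add: E_def pair_dist_def branch_dist_nonneg)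
    finally show ?thesis using ln_le E0 by linarith
  next
    case 2
    have t: "(1 - f) * l i \<le> E"
      using branch_dist_ge_lcp(1)[OF lcp[of "i + 1"]] 2 depth_right_ray[OF assms(1), of x] ray_val_nonneg[of N "i + 1"]
        pair_dist_ge_colour[of "i + 1" x h x' h] by (simp add: E_def l_def defs)
    have t': "f' * l j \<le> E"
      using branch_dist_ge_lcp(2)[OF lcp[of "j"]] 2 depth_left_ray[OF assms(1), of x'] ray_val_nonneg[of N "j"]
        pair_dist_ge_colour[of "j" x h x' h] by (simp add: E_def l_def defs)
    obtain n where n: "j = i + int n + 1" "n \<le> 8" using 2 zless_iff_Suc_zadd[of i j] by auto
    have full: "l (i + int k) \<le> E / 2" if "k \<in> {1..n}" for k
    proof -
      have "l (i + int k) = h - real_of_int (ray_val N (i + int k)) - real_of_int (ray_val N (i + int k + 1))"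
        using s(3) by (simp add: l_def cell_gap_def)
      then show ?thesis using sum2[of "i + int k"] that n by simp
    qed
    have "x' - x = (1 - f) * cell_width N i s + (\<Sum>k=1..n. cell_width N (i + int k) s) + f' * cell_width N j s"
      using ci(5) cj(5) unfolding sum_cell_width cell_pos_eq by (simp add: n cell_width_def algebra_simps)
    then have "g * (x' - x) = g * ((1 - f) * cell_width N i s + (\<Sum>k=1..n. cell_width N (i + int k) s) + f' * cell_width N j s)"
      by simp
    also have "\<dots> = (1 - f) * (g * cell_width N i s) + (\<Sum>k=1..n. g * cell_width N (i + int k) s) + f' * (g * cell_width N j s)"
      by (simp add: sum_distrib_left algebra_simps)
    also have "\<dots> \<le> (1 - f) * (13 * l i) + (\<Sum>k=1..n. 13 * l (i + int k)) + f' * (13 * l j)"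
      using gW ci cj by (intro add_mono mult_left_mono sum_mono) auto
    also have "\<dots> = 13 * ((1 - f) * l i + (\<Sum>k=1..n. l (i + int k)) + f' * l j)"
      by (simp add: sum_distrib_left algebra_simps)
    also have "\<dots> \<le> 13 * (E + (\<Sum>k=1..n. E / 2) + E)"
      using t t' full by (intro mult_left_mono add_mono sum_mono) auto
    also have "\<dots> \<le> 13 * (E + 4 * E + E)"
      using n(2) E0 mult_right_mono[of "real n" 8 E] by (simp add: mult.commute)
    \<comment> \<open>Two partial cells contribute \<open>E\<close> each and at most eight full
      cells \<open>E / 2\<close> each, so the factor is \<open>13 * 6\<close>.\<close>
    also have "\<dots> = 78 * E" by simp
    finally show ?thesis using ln_le by linarith
  next
    case 3
    \<comment> \<open>An arc of \<open>2 * 5 ^ K\<close> cells contains two consecutive rays of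
      level \<open>N - K\<close>; the largest such \<open>K\<close> is used. Ten cells guarantee
      \<open>1 <= K\<close>, which lets multiples of \<open>K\<close> absorb additive
      constants.\<close>
    define S where "S = {K. 2 * 5 ^ K \<le> nat (j - i)}"
    have S: "K < 2 * 5 ^ K" for K :: nat by (induction K) auto
    then have "S \<subseteq> {..nat (j - i)}" unfolding S_def using order.strict_trans2 less_imp_le by blast
    then have fS: "finite S" using finite_subset by blast
    have 1: "1 \<in> S" using 3 by (simp add: S_def nat_le_iff le_nat_iff)
    define K where "K = Max S"
    have "K \<in> S" unfolding K_def using fS 1 by (intro Max_in) auto
    have K1: "1 \<le> K" unfolding K_def using fS 1 by (rule Max_ge)
    have "Suc K \<notin> S"
    proof
      assume "Suc K \<in> S"
      then have "Suc K \<le> K" unfolding K_def using fS by (intro Max_ge)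
      then show False by simp
    qed
    then have Kup: "j - i < 2 * 5 ^ Suc K" using 3 by (auto simp: S_def not_le nat_less_iff)
    have Klo: "2 * 5 ^ K \<le> j - i" using \<open>K \<in> S\<close> 3 by (auto simp: S_def le_nat_iff)
    have "(2::int) * 5 ^ K \<le> 2 * 5 ^ N" using Klo ji by linarith
    then have KN: "K \<le> N" by simp
    define c where "c = i div 5 ^ K + 1"
    have c1: "i < 5 ^ K * c"
    proof -
      have "i = 5 ^ K * (i div 5 ^ K) + i mod 5 ^ K" by simp
      moreover have "i mod 5 ^ K < 5 ^ K" by simp
      ultimately show ?thesis unfolding c_def distrib_left by linarith
    qed
    have c2: "5 ^ K * (c + 1) \<le> j"
    proof -
      have "5 ^ K * (i div 5 ^ K) \<le> i" by (metis minus_mod_eq_mult_div pos_mod_sign zero_less_power zero_less_numeral diff_le_eq le_add_same_cancel1)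
      then show ?thesis using Klo unfolding c_def distrib_left by linarith
    qed
    have "0 < (5::int) ^ K" by simp
    then have c3: "5 ^ K * c < 5 ^ K * (c + 1)" by simp
    have cc1: "real_of_int (ray_val N (5 ^ K * c)) = ray_val (N - K) c" "real_of_int (ray_val N (5 ^ K * (c + 1))) = ray_val (N - K) (c + 1)"
      using ray_val_refine[of "N - K" K c] ray_val_refine[of "N - K" K "c + 1"] KN by simp_all
    have E4: "4 * real K \<le> E"
    proof -
      have od: "odd ((5::int) ^ K)" by simp
      let ?a = "5 ^ K * c" and ?b = "5 ^ K * (c + 1)"
      have par: "even ?b \<longleftrightarrow> even (?a + 1)" using od by (simp add: even_mult_iff)
      then have cp: "ray_colour_point ?b y h = ray_colour_point (?a + 1) y h" for y
        unfolding ray_colour_point_def by (simp only: par)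
      have "branch_dist (ray_colour_point ?a x h) (ray_colour_point ?a x' h) \<ge> snd (ray_colour_point ?a x h) + snd (ray_colour_point ?a x' h) - 2 * real (nat (ray_val N ?a))"
        using branch_dist_ge_lcp(3)[OF lcp[of ?a]] c1 c2 c3 by simp
      moreover have "branch_dist (ray_colour_point (?a + 1) x h) (ray_colour_point (?a + 1) x' h) \<ge> snd (ray_colour_point (?a + 1) x h) + snd (ray_colour_point (?a + 1) x' h) - 2 * real (nat (ray_val N ?b))"
        using branch_dist_ge_lcp(3)[OF lcp[of ?b]] c1 c2 c3 unfolding cp by simp
      moreover have "real_of_int (ray_val N ?a) + ray_val N ?b \<le> 2 * real (N - K)"
        using ray_val_sum[of "N - K" c] unfolding cc1 by linarith
      ultimately have "2 * h - 4 * real (N - K) \<le> E"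
        using ray_colour_depth_sum[OF assms(1), of ?a x] ray_colour_depth_sum[OF assms(1), of ?a x']
          pair_dist_ge_colours[of ?a x h x' h] ray_val_nonneg[of N ?a] ray_val_nonneg[of N ?b] unfolding E_def by simp
      then show ?thesis using s KN by (simp add: of_nat_diff)
    qed
    obtain n where n: "j = i + int n" using ij zle_iff_zadd[of i j] by auto
    have "x' - x \<le> ray_pos N (j + 1) s - ray_pos N i s" using ci(1) cj(2) by linarith
    also have "\<dots> = cell_width N i s + (\<Sum>k=1..n. cell_width N (i + int k) s)"
      unfolding sum_cell_width by (simp add: n cell_width_def)
    finally have "g * (x' - x) \<le> g * cell_width N i s + (\<Sum>k=1..n. g * cell_width N (i + int k) s)"
      using g0 mult_left_mono by (fastforce simp: sum_distrib_left distrib_left)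
    \<comment> \<open>Each cell has length at most 3, and \<open>39 = 13 * 3\<close>.\<close>
    also have "\<dots> \<le> 39 + (\<Sum>k=1..n. 39)" using gW l3 by (intro add_mono sum_mono) (smt (verit))+
    also have "\<dots> = 39 * (real n + 1)" by simp
    also have "\<dots> \<le> 39 * (10 * 5 ^ K)"
    proof -
      have "int n + 1 \<le> 10 * 5 ^ K" using Kup n by simp
      then have "real_of_int (int n + 1) \<le> real_of_int (10 * 5 ^ K)" by (simp only: of_int_le_iff)
      then show ?thesis by simp
    qed
    finally have "1 + g * (x' - x) \<le> 1 + 390 * 5 ^ K" by linarith
    also have "\<dots> \<le> 625 * (5::real) ^ K" using one_le_power[of "5::real" K] by linarith
    also have "\<dots> = 5 ^ (K + 4)" by (simp add: power_add)
    finally have "ln (1 + g * (x' - x)) \<le> ln (5 ^ (K + 4))" using g0 assms(2) by (subst ln_le_cancel_iff) (auto intro!: add_pos_nonneg)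
    also have "\<dots> = real (K + 4) * ln 5" by (rule ln_realpow)
    also have "\<dots> \<le> real (K + 4) * 2" using ln5_bounds by (intro mult_left_mono) auto
    also have "\<dots> \<le> 10 * real K" using K1 by simp
    finally show ?thesis using E4 E0 by linarith
  qed
  then show ?thesis by (simp add: g_def E_def)
qed

text \<open>The higher point is moved down to height \<open>h\<close>, at a cost of at most 82 times
  the height difference, which the distance itself bounds. The constant is
  \<open>1 + 78 * (1 + 82)\<close>.\<close>

lemma pair_dist_lower_ordered:
  assumes "0 \<le> h" "h \<le> h'" "\<bar>x - x'\<bar> \<le> 2"
  shows "polar_dist \<bar>x - x'\<bar> h h' \<le> 6475 * pair_dist x h x' h'"
proof -
  have h': "0 \<le> h'" using assms by simp
  have 1: "h' - h \<le> pair_dist x h x' h'" using pair_dist_ge_height[OF assms(1) h', of x x'] by simp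
  have "ln (1 + circumference h * \<bar>x - x'\<bar>) \<le> 78 * pair_dist x h x' h"
    using same_level_lower[OF assms(1), of x x'] same_level_lower[OF assms(1), of x' x] assms(3)
    by (cases "x \<le> x'") (auto simp: pair_dist_commute[of x'])
  moreover have "pair_dist x h x' h \<le> pair_dist x h x' h' + 82 * (h' - h)"
    using pair_dist_triangle[of x h x' h x' h'] pair_dist_vertical[OF h' assms(1), of x'] assms(2) by simp
  ultimately show ?thesis using 1 assms(2) by (simp add: polar_dist_def min_def)
qed

lemma pair_dist_lower:
  assumes "0 \<le> h" "0 \<le> h'" "\<bar>x - x'\<bar> \<le> 2"
  shows "polar_dist \<bar>x - x'\<bar> h h' \<le> 6475 * pair_dist x h x' h'"
  using pair_dist_lower_ordered[of h h' x x'] pair_dist_lower_ordered[of h' h x' x] assms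
  by (cases "h \<le> h'") (auto simp: pair_dist_commute[of x'] polar_dist_commute[of _ h'] abs_minus_commute)

lemma pair_dist_upper:
  assumes "0 \<le> h" "0 \<le> h'"
  shows "pair_dist x h x' h' \<le> 344 * polar_dist \<bar>x - x'\<bar> h h'"
  using branch_point_upper[OF assms, of x x'] branch_point_upper[OF assms, of "x + 1" "x' + 1"]
  by (simp add: pair_dist_def)

section \<open>Diaries\<close>

text \<open>The edges below a vertex of the dual tree are infinitely many. The label at depth \<open>k\<close> therefore records
  only the base \<open>Q\<close> digit number \<open>k - j\<close> of the \<open>j\<close>-th code, for every \<open>j \<le> k\<close>: two words whose diaries agree for
  \<open>e\<close> letters after their first difference have there codes that are congruent modulo \<open>Q ^ e\<close>.\<close>

definition code_digit :: "int \<Rightarrow> nat \<Rightarrow> nat \<times> int \<Rightarrow> int \<times> int" where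
  "code_digit Q t c = (int (fst c) div Q ^ t mod Q, snd c div Q ^ t mod Q)"

text \<open>Padding with \<open>(0, 0)\<close> makes the diary of a finite word a label sequence for
  an infinite ray.\<close>

definition nth_code :: "(nat \<times> int) list \<Rightarrow> nat \<Rightarrow> nat \<times> int" where
  "nth_code l j = (if j < length l then l ! j else (0, 0))"

definition diary :: "int \<Rightarrow> (nat \<times> int) list \<Rightarrow> nat \<Rightarrow> (int \<times> int) list" where
  "diary Q l k = map (\<lambda>j. code_digit Q (k - j) (nth_code l j)) [0..<Suc k]"

definition diary_letters :: "int \<Rightarrow> nat \<Rightarrow> (int \<times> int) list set" where
  "diary_letters Q k = {xs. set xs \<subseteq> {0..<Q} \<times> {0..<Q} \<and> length xs = Suc k}"

lemma diary_in_letters: "0 < Q \<Longrightarrow> diary Q l k \<in> diary_letters Q k"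
  by (auto simp: diary_letters_def diary_def code_digit_def simp del: upt_Suc)

lemma finite_diary_letters: "finite (diary_letters Q k)"
  unfolding diary_letters_def by (intro finite_lists_length_eq) auto

lemma card_diary_letters: "0 \<le> Q \<Longrightarrow> card (diary_letters Q k) = nat (Q * Q) ^ Suc k"
  unfolding diary_letters_def by (subst card_lists_length_eq) (auto simp: card_cartesian_product nat_mult_distrib)

lemma diary_cong:
  assumes "take K l = take K l'" "K \<le> length l" "K \<le> length l'" "k < K"
  shows "diary Q l k = diary Q l' k"
proof -
  have "nth_code l j = nth_code l' j" if "j \<le> k" for j
    using assms that by (simp add: nth_code_def) (metis nth_take order.strict_trans1)
  then show ?thesis unfolding diary_def by (intro map_cong refl) auto
qed

lemma cong_of_digits:
  fixes a b Q :: int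
  assumes "0 < Q" "\<And>t. t < e \<Longrightarrow> a div Q ^ t mod Q = b div Q ^ t mod Q"
  shows "a mod Q ^ e = b mod Q ^ e"
  using assms(2)
proof (induction e)
  case (Suc e)
  have *: "c mod Q ^ Suc e = Q ^ e * (c div Q ^ e mod Q) + c mod Q ^ e" for c
    using zmod_zmult2_eq[of Q c "Q ^ e"] assms(1) by (simp add: mult.commute)
  show ?case unfolding * using Suc.IH Suc.prems by simp
qed simp

lemma diary_congruent:
  assumes "0 < Q" "\<And>k. k < K \<Longrightarrow> diary Q l k = diary Q l' k" "j < K" "j < length l" "j < length l'"
  shows "int (fst (l ! j)) mod Q ^ (K - j) = int (fst (l' ! j)) mod Q ^ (K - j)"
    "snd (l ! j) mod Q ^ (K - j) = snd (l' ! j) mod Q ^ (K - j)"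
proof -
  have "code_digit Q t (l ! j) = code_digit Q t (l' ! j)" if "t < K - j" for t
  proof -
    have "diary Q l (j + t) ! j = diary Q l' (j + t) ! j" using assms(2)[of "j + t"] that by simp
    then show ?thesis using assms(4,5) by (simp add: diary_def nth_code_def del: upt_Suc)
  qed
  then have d: "int (fst (l ! j)) div Q ^ t mod Q = int (fst (l' ! j)) div Q ^ t mod Q"
    "snd (l ! j) div Q ^ t mod Q = snd (l' ! j) div Q ^ t mod Q" if "t < K - j" for t
    using that by (auto simp: code_digit_def)
  show "int (fst (l ! j)) mod Q ^ (K - j) = int (fst (l' ! j)) mod Q ^ (K - j)"
    "snd (l ! j) mod Q ^ (K - j) = snd (l' ! j) mod Q ^ (K - j)"
    using assms(1) d by (intro cong_of_digits; simp)+
qed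

lemma abs_diff_ge_of_cong:
  fixes a b q :: int
  assumes "a mod q = b mod q" "a \<noteq> b"
  shows "q \<le> \<bar>a - b\<bar>"
proof -
  have "q dvd a - b" using assms(1) by (simp add: mod_eq_dvd_iff)
  then show ?thesis using assms(2) dvd_imp_le_int[of "a - b" q] by auto
qed

text \<open>At the end of level \<open>M\<close> the rays have reached their places
  \<open>i / 5 ^ M\<close> and later cells stay between them; during level \<open>M\<close> they
  still move, hence \<open>0 < K\<close>.\<close>

lemma ray_pos_ancestor:
  assumes "0 \<le> s" "s \<le> 2" "0 < K"
  shows "real_of_int (i div 5 ^ K) / 5 ^ M \<le> ray_pos (M + K) i s"
    "ray_pos (M + K) (i + 1) s \<le> real_of_int (i div 5 ^ K + 1) / 5 ^ M"
proof -
  obtain K' where K: "K = Suc K'" using assms(3) gr0_implies_Suc by blast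
  have q: "5 ^ K' * (i div 5 ^ K) \<le> i div 5" "i div 5 + 1 \<le> 5 ^ K' * (i div 5 ^ K + 1)"
  proof -
    let ?j = "i div 5"
    have e: "i div 5 ^ K = ?j div 5 ^ K'" by (simp add: K zdiv_zmult2_eq)
    have "?j = 5 ^ K' * (?j div 5 ^ K') + ?j mod 5 ^ K'" by simp
    moreover have "0 \<le> ?j mod 5 ^ K'" "?j mod 5 ^ K' < 5 ^ K'" by simp_all
    ultimately show "5 ^ K' * (i div 5 ^ K) \<le> i div 5" "i div 5 + 1 \<le> 5 ^ K' * (i div 5 ^ K + 1)"
      unfolding e distrib_left by linarith+
  qed
  have e: "real_of_int (5 ^ K' * z) / 5 ^ (M + K') = real_of_int z / 5 ^ M" for z by (simp add: power_add)
  have "real_of_int (5 ^ K' * (i div 5 ^ K)) / 5 ^ (M + K') \<le> real_of_int (i div 5) / 5 ^ (M + K')"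
    "real_of_int (i div 5 + 1) / 5 ^ (M + K') \<le> real_of_int (5 ^ K' * (i div 5 ^ K + 1)) / 5 ^ (M + K')"
    using q by (intro divide_right_mono; simp only: of_int_le_iff; simp)+
  then show "real_of_int (i div 5 ^ K) / 5 ^ M \<le> ray_pos (M + K) i s"
    "ray_pos (M + K) (i + 1) s \<le> real_of_int (i div 5 ^ K + 1) / 5 ^ M"
    using ray_pos_parent[OF assms(1,2), where i=i and N="M + K'"] unfolding e by (simp_all add: K)
qed

text \<open>Siblings in the tree can have birth levels as different as one likes, but then they are not close
  to each other: the letters of a level \<open>M\<close> word that can still be replaced later were themselves
  created at level \<open>M\<close>.\<close>

lemma ray_words_split_apart:
  assumes "i div 5 ^ K = p" "i' div 5 ^ K' = p'" "\<bar>p - p'\<bar> \<le> 1"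
    and "take j (ray_word (M + K) (odd_end i)) = take j (ray_word (M + K') (odd_end i'))"
    and "j < length (ray_word (M + K) (odd_end i))" "j < length (ray_word (M + K') (odd_end i'))"
    and "fst (ray_word (M + K) (odd_end i) ! j) < M" "M < fst (ray_word (M + K') (odd_end i') ! j)"
  shows False
proof -
  let ?l = "ray_word (M + K) (odd_end i)" and ?l' = "ray_word (M + K') (odd_end i')"
  let ?w = "ray_word M (odd_end p)" and ?w' = "ray_word M (odd_end p')"
  obtain m where m: "m \<le> length ?w" "take m ?l = take m ?w" "\<And>j. m \<le> j \<Longrightarrow> j < length ?l \<Longrightarrow> M < fst (?l ! j)"
    using ray_word_ancestor[of M i K] unfolding assms(1) by blast
  obtain m' where m': "nat (ray_val M (even_end p')) + 1 \<le> m'" "m' \<le> length ?w'" "take m' ?l' = take m' ?w'"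
    using ray_word_ancestor[of M i' K'] unfolding assms(2) by blast
  \<comment> \<open>Letter \<open>j\<close> is older than \<open>M\<close>, so it was inherited
    unchanged from the level \<open>M\<close> word.\<close>
  have jm: "j < m" using m(3)[of j] assms(5,7) by force
  then have wj: "?w ! j = ?l ! j" using m(2) by (metis nth_take)
  have mj: "m' \<le> j"
  proof (rule ccontr)
    assume "\<not> m' \<le> j"
    then have "?l' ! j = ?w' ! j" "j < length ?w'" using m'(2,3) by (metis not_le nth_take, linarith)
    then have "fst (?l' ! j) \<le> M" using ray_word_level[of "?w' ! j" M "odd_end p'"] by simp
    then show False using assms(8) by simp
  qed
  show False
  proof (cases "odd_end p = odd_end p'")
    case True
    then have "fst (?w ! j) = M"
      using ray_word_top_level[of M p' j] m'(1) mj jm m(1) by simp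
    then show False using wj assms(7) by simp
  next
    case False
    \<comment> \<open>Adjacent cells with different odd ends share their even end. This ray
      separates them, yet the words agree one letter beyond its vertex.\<close>
    define c where "c = even_end p'"
    have c: "even c" "(odd_end p < c \<and> c < odd_end p') \<or> (odd_end p' < c \<and> c < odd_end p)"
    proof -
      consider "p = p'" | "p = p' + 1" | "p' = p + 1" using assms(3) by linarith
      then show "even c" "(odd_end p < c \<and> c < odd_end p') \<or> (odd_end p' < c \<and> c < odd_end p)"
        using False by (cases; auto simp: c_def odd_end_def even_end_def split: if_splits)+
    qed
    let ?v = "nat (ray_val M c)"
    have v: "Suc ?v \<le> m'" using m'(1) by (simp add: c_def)
    have "take (Suc ?v) ?w = take (Suc ?v) (take m ?w)" using v mj jm by simp
    also have "\<dots> = take (Suc ?v) (take j ?l)" using v mj jm by (simp flip: m(2))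
    also have "\<dots> = take (Suc ?v) (take m' ?l')" using v mj by (simp add: assms(4))
    also have "\<dots> = take (Suc ?v) ?w'" using v by (simp add: m'(3))
    finally have "Suc ?v \<le> length (longest_common_prefix ?w ?w')"
      using v m'(2) m(1) mj jm by (simp add: le_length_lcp_iff)
    moreover have "length (longest_common_prefix ?w ?w') \<le> ?v"
      using c lcp_ray_word_le[of c "odd_end p" "odd_end p'" M] lcp_ray_word_le[of c "odd_end p'" "odd_end p" M]
      by (auto simp: lcp_commute)
    ultimately show False by simp
  qed
qed

section \<open>Reduction to one turn, and what a letter reveals about the angle\<close>

lemma branch_point_reduce:
  assumes "0 \<le> h"
  obtains i t where "0 \<le> i" "i < 4 * 5 ^ level h" "fst (branch_point x h) = ray_word (level h) (odd_end i)"
    "ray_pos (level h) i (phase h) \<le> x - 4 * of_int t" "x - 4 * of_int t \<le> ray_pos (level h) (i + 1) (phase h)"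
    "0 \<le> x - 4 * of_int t" "x - 4 * of_int t \<le> 4" "0 \<le> i"
proof -
  let ?n = "4 * 5 ^ level h :: int"
  let ?i = "cell_index x h mod ?n" and ?t = "cell_index x h div ?n"
  have i: "cell_index x h = ?i + 5 ^ level h * (4 * ?t)" by (metis add.commute mult.assoc mult.commute mult_div_mod_eq)
  have r: "0 \<le> ?i" "?i < ?n" by simp_all
  have p: "ray_pos (level h) k (phase h) = ray_pos (level h) (k + 5 ^ level h * (4 * ?t)) (phase h) - 4 * of_int ?t" for k
    unfolding ray_pos_shift by simp
  have b: "ray_pos (level h) ?i (phase h) \<le> x - 4 * of_int ?t" "x - 4 * of_int ?t \<le> ray_pos (level h) (?i + 1) (phase h)"
  proof -
    have i1: "cell_index x h + 1 = (?i + 1) + 5 ^ level h * (4 * ?t)" using i by linarith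
    have "ray_pos (level h) ?i (phase h) = ray_pos (level h) (cell_index x h) (phase h) - 4 * of_int ?t"
      using p[of ?i] by (simp only: i[symmetric])
    moreover have "ray_pos (level h) (?i + 1) (phase h) = ray_pos (level h) (cell_index x h + 1) (phase h) - 4 * of_int ?t"
      using p[of "?i + 1"] by (simp only: i1[symmetric])
    ultimately show "ray_pos (level h) ?i (phase h) \<le> x - 4 * of_int ?t" "x - 4 * of_int ?t \<le> ray_pos (level h) (?i + 1) (phase h)"
      using cell_index(1,2)[OF assms, of x] by linarith+
  qed
  have z: "ray_pos (level h) (5 ^ level h * k) (phase h) = k" for k :: int
  proof -
    have "ray_start N 0 = 0" for N using ray_start_Suc(1)[of _ 0] by (cases N) simp_all
    then show ?thesis using ray_pos_shift[of "level h" 0 k "phase h"] by (simp add: ray_pos_def)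
  qed
  have "ray_pos (level h) (5 ^ level h * 0) (phase h) \<le> ray_pos (level h) ?i (phase h)"
    using r phase_bounds assms by (intro ray_pos_mono) auto
  moreover have "?i + 1 \<le> 5 ^ level h * 4" using r(2) by linarith
  then have "ray_pos (level h) (?i + 1) (phase h) \<le> ray_pos (level h) (5 ^ level h * 4) (phase h)"
    using phase_bounds assms by (intro ray_pos_mono) auto
  ultimately have "0 \<le> x - 4 * of_int ?t" "x - 4 * of_int ?t \<le> 4" using b unfolding z by linarith+
  then show ?thesis using that[of ?i ?t] r b by (simp add: branch_point_def cell_point_def cell_word_def)
qed

lemma branch_point_code_near:
  assumes "0 \<le> i" "ray_pos N i s \<le> y" "y \<le> ray_pos N (i + 1) s" "0 \<le> s" "s \<le> 2" "c \<in> set (ray_word N (odd_end i))"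
  shows "\<bar>y - real_of_int (snd c div 2) / 5 ^ fst c\<bar> \<le> 6 / 5 ^ fst c"
proof -
  have n: "fst c \<le> N" using ray_word_level[OF assms(6)] .
  have "(1::real) / 5 ^ N \<le> 1 / 5 ^ fst c" using n by (intro divide_left_mono power_increasing) auto
  moreover have "\<bar>real_of_int (odd_end i) / 5 ^ N - real_of_int (snd c div 2) / 5 ^ fst c\<bar> \<le> 5 / 4 * (1 / 5 ^ fst c - 1 / 5 ^ N)"
    by (rule ray_word_near[OF assms(6)])
  moreover have "\<bar>y - real_of_int (odd_end i) / 5 ^ N\<bar> \<le> 3 / 5 ^ N"
  proof -
    have "\<bar>ray_pos N i s - i / 5 ^ N\<bar> \<le> 2 / 5 ^ N" "\<bar>ray_pos N (i + 1) s - real_of_int (i + 1) / 5 ^ N\<bar> \<le> 2 / 5 ^ N"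
      using ray_pos_close[OF assms(4,5)] by blast+
    moreover have "real_of_int (i + 1) / 5 ^ N = i / 5 ^ N + 1 / 5 ^ N" by (simp add: add_divide_distrib)
    moreover have "real_of_int (odd_end i) / 5 ^ N = i / 5 ^ N \<or> real_of_int (odd_end i) / 5 ^ N = real_of_int (i + 1) / 5 ^ N"
      by (simp add: odd_end_def)
    moreover have "(0::real) < 1 / 5 ^ N" "(2::real) / 5 ^ N = 2 * (1 / 5 ^ N)" "(3::real) / 5 ^ N = 3 * (1 / 5 ^ N)" by simp_all
    ultimately show ?thesis using assms(2,3) unfolding abs_le_iff by (elim conjE disjE; intro conjI; linarith)
  qed
  moreover have "(6::real) / 5 ^ fst c = 6 * (1 / 5 ^ fst c)" "(3::real) / 5 ^ N = 3 * (1 / 5 ^ N)" "(0::real) < 1 / 5 ^ N" by simp_all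
  moreover have "\<bar>A - P\<bar> \<le> 6 * u" if "v \<le> u" "\<bar>B - P\<bar> \<le> 5 / 4 * (u - v)" "\<bar>A - B\<bar> \<le> 3 * v" "0 < v" for A B P u v :: real
    using that unfolding right_diff_distrib by linarith
  ultimately show ?thesis by metis
qed

text \<open>The ray at angle two has value 0, so already the first letter was created on the side of
  it where the point lies. Points with equal first letters are thus in the same half turn.\<close>

lemma first_code_half:
  assumes "0 \<le> i" "i < 4 * 5 ^ N" "ray_pos N i s \<le> y" "y \<le> ray_pos N (i + 1) s" "0 \<le> s" "s \<le> 2"
  defines "q \<equiv> snd (hd (ray_word N (odd_end i))) div 2"
  shows "(q < 2 \<longrightarrow> y \<le> 2) \<and> (2 \<le> q \<longrightarrow> 2 \<le> y)"
proof -
  let ?l = "ray_word N (odd_end i)" and ?c = "2 * 5 ^ N :: int"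
  have ne: "?l \<noteq> []" "fst (hd ?l) = 0" using ray_word_hd by blast+
  have v0: "ray_val N ?c = 0" using ray_val_shift[of N 0 2] ray_val_refine[of 0 N 0] by (simp add: mult.commute)
  have mem: "hd ?l \<in> set (drop (nat (ray_val N ?c)) ?l)" using ne v0 by simp
  have cp: "code_pos N (hd ?l) = q * 5 ^ N" using ne by (simp add: code_pos_def q_def)
  note side = ray_word_side[OF _ mem]
  have par: "odd (?c + odd_end i)" by simp
  have z: "ray_pos N ?c s = 2"
  proof -
    have "ray_start N 0 = 0" for N using ray_start_Suc(1)[of _ 0] by (cases N) simp_all
    then show ?thesis using ray_pos_shift[of N 0 2 s] by (simp add: ray_pos_def mult.commute)
  qed
  show ?thesis
  proof (intro conjI impI)
    assume "q < 2"
    then have "q \<le> 1" by simp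
    then have "q * 5 ^ N \<le> 1 * 5 ^ N" by (intro mult_right_mono) auto
    then have "code_pos N (hd ?l) < ?c" using cp by simp
    then have "odd_end i \<le> ?c" using side[OF par] by force
    then have "i + 1 \<le> ?c" by (cases "odd i") (auto simp: odd_end_def dest: order_le_imp_less_or_eq)
    then have "ray_pos N (i + 1) s \<le> ray_pos N ?c s" using assms by (intro ray_pos_mono)
    then show "y \<le> 2" using z assms by linarith
  next
    assume "2 \<le> q"
    then have "2 * 5 ^ N \<le> q * 5 ^ N" by (intro mult_right_mono) auto
    then have "?c \<le> code_pos N (hd ?l)" using cp by simp
    then have "?c \<le> odd_end i" using side[OF par] by force
    then have "?c \<le> i" by (cases "odd i") (auto simp: odd_end_def dest: order_le_imp_less_or_eq)
    then have "ray_pos N ?c s \<le> ray_pos N i s" using assms by (intro ray_pos_mono)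
    then show "2 \<le> y" using z assms by linarith
  qed
qed

lemma polar_dist_ge:
  assumes "0 \<le> h" "0 \<le> h'" "0 \<le> d"
  shows "\<bar>h - h'\<bar> \<le> polar_dist d h h'" "ln (1 + circumference (min h h') * d) \<le> polar_dist d h h'"
  using assms circumference_nonneg[of "min h h'"] by (auto simp: polar_dist_def)

text \<open>Traced back to level \<open>M\<close>, just after the older letter was born, the two
  cells are neither equal nor adjacent, so the angles differ by at least \<open>1 / 5 ^ M\<close>.
  If both points are high, this angle is long; otherwise their heights differ much.\<close>

lemma polar_dist_distant_levels:
  assumes "0 \<le> h" "0 \<le> h'" "0 \<le> i" "0 \<le> i'"
    and y: "ray_pos (level h) i (phase h) \<le> y" "y \<le> ray_pos (level h) (i + 1) (phase h)"
    and y': "ray_pos (level h') i' (phase h') \<le> y'" "y' \<le> ray_pos (level h') (i' + 1) (phase h')"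
  defines "l \<equiv> ray_word (level h) (odd_end i)" and "l' \<equiv> ray_word (level h') (odd_end i')"
  assumes tk: "take j l = take j l'" and jl: "j < length l" "j < length l'" and gap: "fst (l ! j) + 4 \<le> fst (l' ! j)"
  shows "real (fst (l' ! j) - fst (l ! j)) / 2 - 4 \<le> polar_dist \<bar>y - y'\<bar> h h'"
proof -
  define n n' N N' where "n = fst (l ! j)" "n' = fst (l' ! j)" "N = level h" "N' = level h'"
  note nd = this
  have lv: "n \<le> N" "n' \<le> N'" using ray_word_level[OF nth_mem[OF jl(1)[unfolded l_def]]] ray_word_level[OF nth_mem[OF jl(2)[unfolded l'_def]]]
    by (simp_all add: nd l_def l'_def)
  have hN: "2 * real N \<le> h" "h \<le> 2 * real N + 2" "2 * real N' \<le> h'"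
    using phase_bounds[of h] phase_bounds[of h'] assms(1,2) by (auto simp: nd)
  have nn: "n + 4 \<le> n'" using gap by (simp add: nd)
  have diff: "real (n' - n) = real n' - real n" using nn by (simp add: of_nat_diff)
  note pg = polar_dist_ge[OF assms(1,2), of "\<bar>y - y'\<bar>"]
  show ?thesis
  proof (cases "N \<le> n + 1")
    case True
    then have "real N \<le> real n + 1" by linarith
    moreover have "real n' \<le> real N'" "real n + 4 \<le> real n'" using lv nn by linarith+
    ultimately have "real (n' - n) / 2 - 4 \<le> h' - h" using hN unfolding diff diff_divide_distrib by linarith
    then show ?thesis using pg(1) unfolding nd by linarith
  next
    case False
    define M where "M = n + 1"
    define K K' where "K = N - M" "K' = N' - M"
    have K: "N = M + K" "N' = M + K'" "0 < K" "0 < K'" using False lv nn by (auto simp: K_K'_def M_def)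
    let ?p = "i div 5 ^ K" and ?p' = "i' div 5 ^ K'"
    have "\<not> \<bar>?p - ?p'\<bar> \<le> 1"
    proof
      assume "\<bar>?p - ?p'\<bar> \<le> 1"
      then show False
        using ray_words_split_apart[of i K ?p i' K' ?p' j M] tk jl nn
        unfolding l_def l'_def nd[symmetric] K(1,2)[symmetric] M_def[symmetric]
        by (auto simp: nd(1,2)[unfolded l_def l'_def nd(3,4)[symmetric]] M_def)
    qed
    then have pp: "2 \<le> \<bar>?p - ?p'\<bar>" by simp
    have b: "real_of_int ?p / 5 ^ M \<le> y" "y \<le> real_of_int (?p + 1) / 5 ^ M"
      "real_of_int ?p' / 5 ^ M \<le> y'" "y' \<le> real_of_int (?p' + 1) / 5 ^ M"
      using ray_pos_ancestor[of "phase h" K, where i=i and M=M] ray_pos_ancestor[of "phase h'" K', where i=i' and M=M] y y' K phase_bounds(1,2) assms(1,2)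
      unfolding nd[symmetric] by (metis order_trans)+
    have D: "1 / 5 ^ M \<le> \<bar>y - y'\<bar>"
    proof (cases "?p < ?p'")
      case True
      then have "real_of_int (?p + 1) / 5 ^ M + 1 / 5 ^ M \<le> real_of_int ?p' / 5 ^ M"
        using pp by (simp add: add_divide_distrib[symmetric] divide_right_mono)
      then show ?thesis using b by linarith
    next
      case False
      then have "real_of_int (?p' + 1) / 5 ^ M + 1 / 5 ^ M \<le> real_of_int ?p / 5 ^ M"
        using pp by (simp add: add_divide_distrib[symmetric] divide_right_mono)
      then show ?thesis using b by linarith
    qed
    show ?thesis
    \<comment> \<open>The threshold is midway between the birth heights \<open>2 * n\<close> and
      \<open>2 * n'\<close>. Above it the arc has length about \<open>5 powr ((n' - n) / 2)\<close>;
      below it the second point is at least \<open>n' - n\<close> higher.\<close>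
    proof (cases "real n + real n' \<le> h")
      case True
      have h'n: "real n + real n' \<le> h'" using hN lv nn by linarith
      let ?m = "real n' - real n"
      have "circumference (real n + real n') \<le> circumference (min h h')"
        using True h'n by (intro circumference_mono) simp
      moreover have "circumference (real n + real n') = 5 ^ n * 5 powr (?m / 2) - 1"
        using circumference_level[of n ?m] by (simp add: algebra_simps)
      ultimately have g: "5 ^ n * 5 powr (?m / 2) - 1 \<le> circumference (min h h')" by simp
      have one: "1 \<le> 5 ^ n * 5 powr (?m / 2)"
      proof -
        have "1 \<le> (5::real) powr (?m / 2)" using nn by (intro ge_one_powr_ge_zero) auto
        moreover have "1 \<le> (5::real) ^ n" by simp
        ultimately show ?thesis using mult_mono[of 1 "5 ^ n" 1 "5 powr (?m / 2)"] by simp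
      qed
      have "(5 ^ n * 5 powr (?m / 2) - 1) * (1 / 5 ^ M) \<le> circumference (min h h') * \<bar>y - y'\<bar>"
        using g D one by (intro mult_mono) auto
      moreover have "(5 ^ n * 5 powr (?m / 2) - 1) * (1 / 5 ^ M) = 5 powr (?m / 2) / 5 - 1 / 5 ^ M"
        by (simp add: M_def field_simps)
      moreover have "1 / 5 ^ M \<le> (1::real)" by simp
      ultimately have "5 powr (?m / 2) / 5 \<le> 1 + circumference (min h h') * \<bar>y - y'\<bar>" by linarith
      then have "ln (5 powr (?m / 2) / 5) \<le> ln (1 + circumference (min h h') * \<bar>y - y'\<bar>)"
        by (intro ln_mono) auto
      moreover have "ln (5 powr (?m / 2) / 5) = ?m / 2 * ln 5 - ln 5" by (simp add: ln_div ln_powr)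
      moreover have "?m / 2 * 1 \<le> ?m / 2 * ln 5" using ln5_bounds nn by (intro mult_left_mono) auto
      ultimately have "?m / 2 * 1 - 2 \<le> polar_dist \<bar>y - y'\<bar> h h'" using pg(2) ln5_bounds by linarith
      then show ?thesis using diff by (simp add: nd)
    next
      case False
      moreover have "real n' \<le> real N'" "real n \<le> real n'" using lv nn by linarith+
      ultimately have "real (n' - n) / 2 - 4 \<le> h' - h" using hN unfolding diff diff_divide_distrib by linarith
      then show ?thesis using pg(1) unfolding nd by linarith
    qed
  qed
qed

lemma nth_lcp_neq:
  assumes "j = length (longest_common_prefix xs ys)" "j < length xs" "j < length ys"
  shows "xs ! j \<noteq> ys ! j" "take j xs = take j ys"
proof -
  show t: "take j xs = take j ys" using assms(1) le_length_lcp_iff[of j xs ys] by simp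
  show "xs ! j \<noteq> ys ! j"
  proof
    assume "xs ! j = ys ! j"
    then have "take (Suc j) xs = take (Suc j) ys" using t assms(2,3) by (simp add: take_Suc_conv_app_nth)
    then show False using assms le_length_lcp_iff[of "Suc j" xs ys] by simp
  qed
qed

text \<open>At the first difference of the words the codes agree modulo \<open>Q ^ e\<close>, where
  \<open>e\<close> is the number of further common letters. Either the birth levels differ by
  \<open>Q ^ e\<close>, or the indices at one level do; in the second case the angle is of order
  \<open>Q ^ e / 5 ^ n\<close> and its logarithm is linear in \<open>e\<close>.\<close>

lemma diary_separation:
  fixes C :: real
  assumes "0 \<le> C"
  shows "\<exists>Q>0. \<forall>x x' h h' K. 0 \<le> h \<longrightarrow> 0 \<le> h' \<longrightarrow> \<bar>x - x'\<bar> \<le> 2 \<longrightarrow>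
    K \<le> length (fst (branch_point x h)) \<longrightarrow> K \<le> length (fst (branch_point x' h')) \<longrightarrow>
    (\<forall>k<K. diary Q (fst (branch_point x h)) k = diary Q (fst (branch_point x' h')) k) \<longrightarrow>
    C * (real K - length (longest_common_prefix (fst (branch_point x h)) (fst (branch_point x' h')))) \<le> polar_dist \<bar>x - x'\<bar> h h'"
proof -
  \<comment> \<open>\<open>exp (C + 2)\<close> serves the case of equal birth levels,
    \<open>2 * C + 8\<close> that of different ones, and 50 absorbs additive errors.\<close>
  define Q where "Q = \<lceil>exp (C + 2)\<rceil> + 2 * \<lceil>C\<rceil> + 50"
  have "0 \<le> \<lceil>exp (C + 2)\<rceil>" "0 \<le> \<lceil>C\<rceil>" using assms by (simp_all add: le_ceiling_iff order_less_trans[OF _ exp_gt_zero])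
  then have Q: "50 \<le> Q" "2 * C + 8 \<le> real_of_int Q" "exp (C + 2) \<le> real_of_int Q"
    unfolding Q_def using le_of_int_ceiling[of C] le_of_int_ceiling[of "exp (C + 2)"] by linarith+
  have Qpow: "real_of_int (int e) * real_of_int Q \<le> real_of_int (Q ^ e)" "Q \<le> Q ^ e" if "1 \<le> e" for e
  proof -
    show "Q \<le> Q ^ e" using that Q(1) by (simp add: self_le_power)
    from that have "int e * Q \<le> Q ^ e"
    proof (induction e rule: dec_induct)
      case (step e)
      have "int (Suc e) * Q \<le> 2 * (int e * Q)" using step(1) Q(1) by (simp add: distrib_right)
      also have "\<dots> \<le> 2 * Q ^ e" using step by simp
      also have "\<dots> \<le> Q * Q ^ e" using Q(1) by (intro mult_right_mono) auto
      finally show ?case by simp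
    qed simp
    then show "real_of_int (int e) * real_of_int Q \<le> real_of_int (Q ^ e)" by (metis of_int_le_iff of_int_mult)
  qed
  have lnQ: "C + 2 \<le> ln (real_of_int Q)" using Q by (subst ln_ge_iff) auto
  show ?thesis
  proof (intro exI[of _ Q] conjI allI impI)
    show "0 < Q" using Q by simp
    fix x x' h h' :: real and K :: nat
    assume h: "0 \<le> h" "0 \<le> h'" and x: "\<bar>x - x'\<bar> \<le> 2"
    define l l' where "l = fst (branch_point x h)" "l' = fst (branch_point x' h')"
    note ld = this
    define j where "j = length (longest_common_prefix l l')"
    assume K: "K \<le> length (fst (branch_point x h))" "K \<le> length (fst (branch_point x' h'))"
      and dia: "\<forall>k<K. diary Q (fst (branch_point x h)) k = diary Q (fst (branch_point x' h')) k"
    note K = K[folded ld] and dia = dia[folded ld]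
    have pg: "\<bar>h - h'\<bar> \<le> polar_dist \<bar>x - x'\<bar> h h'"
      "ln (1 + circumference (min h h') * \<bar>x - x'\<bar>) \<le> polar_dist \<bar>x - x'\<bar> h h'"
      using polar_dist_ge[OF h, of "\<bar>x - x'\<bar>"] by auto
    have "C * (real K - real j) \<le> polar_dist \<bar>x - x'\<bar> h h'"
    proof (cases "j < K")
      case False
      then have "C * (real K - real j) \<le> 0" using assms by (intro mult_nonneg_nonpos) auto
      then show ?thesis using pg(1) by linarith
    next
      case True
      define e where "e = K - j"
      have e: "1 \<le> e" "real K - real j = real e" using True by (auto simp: e_def of_nat_diff)
      have jl: "j < length l" "j < length l'" using True K by auto
      note neq = nth_lcp_neq[OF j_def jl]
      obtain i t where i: "0 \<le> i" "i < 4 * 5 ^ level h" "l = ray_word (level h) (odd_end i)"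
        "ray_pos (level h) i (phase h) \<le> x - 4 * of_int t" "x - 4 * of_int t \<le> ray_pos (level h) (i + 1) (phase h)"
        "0 \<le> x - 4 * of_int t" "x - 4 * of_int t \<le> 4"
        using branch_point_reduce[OF h(1), of x] unfolding ld by metis
      obtain i' t' where i': "0 \<le> i'" "i' < 4 * 5 ^ level h'" "l' = ray_word (level h') (odd_end i')"
        "ray_pos (level h') i' (phase h') \<le> x' - 4 * of_int t'" "x' - 4 * of_int t' \<le> ray_pos (level h') (i' + 1) (phase h')"
        "0 \<le> x' - 4 * of_int t'" "x' - 4 * of_int t' \<le> 4"
        using branch_point_reduce[OF h(2), of x'] unfolding ld by metis
      define y y' where "y = x - 4 * of_int t" "y' = x' - 4 * of_int t'"
      note yd = this
      note ph = phase_bounds(1,2)[OF h(1)] phase_bounds(1,2)[OF h(2)]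
      define c c' where "c = l ! j" "c' = l' ! j"
      note cd = this
      have mem: "c \<in> set l" "c' \<in> set l'" using jl by (auto simp: cd)
      have lev: "fst c \<le> level h" "fst c' \<le> level h'" using mem ray_word_level unfolding i(3) i'(3) by blast+
      have near: "\<bar>y - real_of_int (snd c div 2) / 5 ^ fst c\<bar> \<le> 6 / 5 ^ fst c" "\<bar>y' - real_of_int (snd c' div 2) / 5 ^ fst c'\<bar> \<le> 6 / 5 ^ fst c'"
        using branch_point_code_near[OF i(1,4,5) ph(1,2), of c] branch_point_code_near[OF i'(1,4,5) ph(3,4), of c'] mem i(3) i'(3)
        by (simp_all add: yd)
      have cong: "int (fst c) mod Q ^ e = int (fst c') mod Q ^ e" "snd c mod Q ^ e = snd c' mod Q ^ e"
        using diary_congruent[of Q K l l' j] Q(1) dia True jl by (simp_all add: cd e_def)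
      have hd: "j \<noteq> 0" if "fst c \<noteq> 0 \<or> fst c' \<noteq> 0"
        using that ray_word_hd[of "level h" "odd_end i"] ray_word_hd[of "level h'" "odd_end i'"] i(3) i'(3)
        by (cases "j = 0") (auto simp: cd hd_conv_nth)
      \<comment> \<open>Equal first letters give \<open>\<bar>y - y'\<bar> \<le> 2\<close>. This
        difference and \<open>x - x'\<close> agree modulo 4 and both lie in \<open>[-2, 2]\<close>,
        so they are equal up to sign.\<close>
      have same: "\<bar>y - y'\<bar> = \<bar>x - x'\<bar>" if "j \<noteq> 0"
      proof -
        have "hd l = hd l'" using that neq(2) jl by (metis hd_take neq0_conv)
        then have "\<bar>y - y'\<bar> \<le> 2"
          using first_code_half[OF i(1,2,4,5) ph(1,2)] first_code_half[OF i'(1,2,4,5) ph(3,4)] i(3,6,7) i'(3,6,7)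
          unfolding yd abs_le_iff by (smt (verit))
        moreover have "y - y' = (x - x') - 4 * of_int (t - t')" by (simp add: yd)
        moreover have "r = 0 \<or> real_of_int r \<ge> 1 \<or> real_of_int r \<le> -1" for r :: int
          by linarith
        then have "real_of_int (t - t') = 0 \<or> real_of_int (t - t') \<ge> 1 \<or> real_of_int (t - t') \<le> -1"
          by (metis of_int_0)
        ultimately show ?thesis using x by (smt (verit))
      qed
      have Qe: "real e * real_of_int Q \<le> real_of_int (Q ^ e)" "Q \<le> Q ^ e" using Qpow[OF e(1)] by auto
      have levels: "C * real e \<le> real (b - a) / 2 - 4" if "int a mod Q ^ e = int b mod Q ^ e" "a < b" for a b :: nat
      proof -
        have "Q ^ e \<le> int b - int a" using abs_diff_ge_of_cong[OF that(1)] that(2) by simp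
        then have "real_of_int (Q ^ e) \<le> real b - real a" by linarith
        moreover have "real e * (2 * C + 8) \<le> real e * real_of_int Q" using Q by (intro mult_left_mono) auto
        moreover have "8 \<le> real e * 8" using e(1) by simp
        ultimately show ?thesis using Qe(1) that(2) by (simp add: of_nat_diff algebra_simps)
      qed
      have far: "a + 4 \<le> b" if "int a mod Q ^ e = int b mod Q ^ e" "a < b" for a b :: nat
        using abs_diff_ge_of_cong[OF that(1)] that(2) Q(1) Qe(2) by simp
      consider "fst c < fst c'" | "fst c' < fst c" | "fst c = fst c'" by linarith
      then have "C * real e \<le> polar_dist \<bar>x - x'\<bar> h h'"
      proof cases
        case 1
        have "real (fst c' - fst c) / 2 - 4 \<le> polar_dist \<bar>y - y'\<bar> h h'"
          using polar_dist_distant_levels[OF h i(1) i'(1) i(4,5) i'(4,5), of j] i(3) i'(3) neq jl far[OF cong(1) 1]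
          by (simp add: cd yd)
        moreover have "j \<noteq> 0" using 1 by (intro hd) auto
        ultimately show ?thesis using levels[OF cong(1) 1] same by simp
      next
        case 2
        have "real (fst c - fst c') / 2 - 4 \<le> polar_dist \<bar>y' - y\<bar> h' h"
          using polar_dist_distant_levels[OF h(2,1) i'(1) i(1) i'(4,5) i(4,5), of j] i(3) i'(3) neq jl far[OF cong(1)[symmetric] 2]
          by (simp add: cd yd)
        moreover have "j \<noteq> 0" using 2 by (intro hd) auto
        ultimately show ?thesis using levels[OF cong(1)[symmetric] 2] same
          by (simp add: polar_dist_commute[of _ h'] abs_minus_commute[of y'])
      next
        case 3
        define n where "n = fst c"
        have "snd c \<noteq> snd c'" using neq(1) 3 by (auto simp: cd prod_eq_iff)
        then have "Q ^ e \<le> \<bar>snd c - snd c'\<bar>" using abs_diff_ge_of_cong[OF cong(2)] by simp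
        moreover have "\<bar>a - b\<bar> \<le> 2 * \<bar>a div 2 - b div 2\<bar> + 1" for a b :: int
        proof -
          have "\<bar>a - b\<bar> \<le> 2 * \<bar>k - l\<bar> + 1"
            if "a = 2 * k + r" "0 \<le> r" "r \<le> 1" "b = 2 * l + q" "0 \<le> q" "q \<le> 1" for k l r q
            using that by (cases "l \<le> k") (simp_all add: abs_if)
          from this[of "a div 2" "a mod 2" "b div 2" "b mod 2"] show ?thesis by simp
        qed
        ultimately have d2: "Q ^ e - 1 \<le> 2 * \<bar>snd c div 2 - snd c' div 2\<bar>"
          by (metis diff_le_eq order_trans)
        have nr: "\<bar>y * 5 ^ n - real_of_int (snd c div 2)\<bar> \<le> 6" "\<bar>y' * 5 ^ n - real_of_int (snd c' div 2)\<bar> \<le> 6"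
        proof -
          have "\<bar>a * 5 ^ n - b\<bar> \<le> 6" if "\<bar>a - b / 5 ^ n\<bar> \<le> 6 / 5 ^ n" for a b :: real
          proof -
            have "\<bar>a * 5 ^ n - b\<bar> = \<bar>(a - b / 5 ^ n) * 5 ^ n\<bar>" by (simp add: left_diff_distrib)
            also have "\<dots> = \<bar>a - b / 5 ^ n\<bar> * 5 ^ n" by (simp add: abs_mult)
            also have "\<dots> \<le> 6 / 5 ^ n * 5 ^ n" using that by (intro mult_right_mono) auto
            finally show ?thesis by simp
          qed
          then show "\<bar>y * 5 ^ n - real_of_int (snd c div 2)\<bar> \<le> 6" "\<bar>y' * 5 ^ n - real_of_int (snd c' div 2)\<bar> \<le> 6"
            using near 3 by (auto simp: n_def)
        qed
        have "real_of_int (Q ^ e - 1) \<le> real_of_int (2 * \<bar>snd c div 2 - snd c' div 2\<bar>)"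
          using d2 by (simp only: of_int_le_iff)
        then have "real_of_int (Q ^ e) - 1 \<le> 2 * \<bar>real_of_int (snd c div 2) - real_of_int (snd c' div 2)\<bar>"
          by simp
        \<comment> \<open>Each angle is off by at most 6 from its ray, and
          \<open>25 = 1 + 2 * 12\<close>.\<close>
        moreover have "A - 25 \<le> 2 * \<bar>u - v\<bar>" if "A - 1 \<le> 2 * \<bar>p - q\<bar>" "\<bar>u - p\<bar> \<le> 6" "\<bar>v - q\<bar> \<le> 6"
          for A u v p q :: real
        proof -
          have "\<bar>p - q\<bar> \<le> \<bar>u - v\<bar> + 12" using that(2,3) by linarith
          moreover have "A - 25 \<le> 2 * b" if "A - 1 \<le> 2 * a" "a \<le> b + 12" for a b :: real using that by linarith
          ultimately show ?thesis using that(1) by blast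
        qed
        ultimately have d3: "real_of_int (Q ^ e) - 25 \<le> 2 * \<bar>y * 5 ^ n - y' * 5 ^ n\<bar>" using nr by blast
        have "50 \<le> real_of_int (Q ^ e)" using Qe(2) Q(1) by linarith
        then have d4: "real_of_int (Q ^ e) \<le> 4 * \<bar>y * 5 ^ n - y' * 5 ^ n\<bar>" using d3 by linarith
        show ?thesis
        proof (cases "n = 0")
          \<comment> \<open>Impossible: two angles within one turn differ by at most 4. This case
            also covers \<open>j = 0\<close>, where the reduced and the true angles need not be
            comparable.\<close>
          case True
          then have "50 \<le> 4 * \<bar>y - y'\<bar>" using d4 \<open>50 \<le> real_of_int (Q ^ e)\<close> by simp
          moreover have "\<bar>y - y'\<bar> \<le> 4" using i(6,7) i'(6,7) unfolding yd[symmetric] by linarith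
          ultimately show ?thesis by simp
        next
          case False
          then have sm: "\<bar>y - y'\<bar> = \<bar>x - x'\<bar>" using hd same by (auto simp: n_def)
          have "\<bar>y * 5 ^ n - y' * 5 ^ n\<bar> = \<bar>x - x'\<bar> * 5 ^ n"
            unfolding sm[symmetric] by (simp add: abs_mult flip: left_diff_distrib)
          then have d5: "real_of_int (Q ^ e) \<le> 4 * (\<bar>x - x'\<bar> * 5 ^ n)" using d4 by simp
          have "2 * real n \<le> min h h'" using lev 3 phase_bounds(3)[of h] phase_bounds(3)[of h'] ph by (simp add: n_def)
          then have "circumference (2 * real n + 0) \<le> circumference (min h h')" by (intro circumference_mono) simp
          moreover have "4 / 5 * 5 ^ n \<le> circumference (2 * real n + 0)" using False by (intro circumference_bounds) auto
          ultimately have "4 / 5 * 5 ^ n * \<bar>x - x'\<bar> \<le> circumference (min h h') * \<bar>x - x'\<bar>" by (intro mult_right_mono) auto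
          then have "real_of_int (Q ^ e) / 5 \<le> 1 + circumference (min h h') * \<bar>x - x'\<bar>" using d5 by (simp add: mult_ac)
          then have "ln (real_of_int (Q ^ e) / 5) \<le> ln (1 + circumference (min h h') * \<bar>x - x'\<bar>)"
            using \<open>50 \<le> real_of_int (Q ^ e)\<close> by (intro ln_mono) auto
          moreover have "ln (real_of_int (Q ^ e) / 5) = real e * ln (real_of_int Q) - ln 5"
            using Q(1) by (simp add: ln_div ln_realpow)
          moreover have "real e * (C + 2) \<le> real e * ln (real_of_int Q)" using lnQ by (intro mult_left_mono) auto
          moreover have "real e * (C + 2) = C * real e + 2 * real e" by (simp add: algebra_simps)
          moreover have "2 \<le> 2 * real e" using e(1) by simp
          ultimately show ?thesis using pg(2) ln5_bounds by linarith
        qed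
      qed
      then show ?thesis unfolding e(2) .
    qed
    then show "C * (real K - real (length (longest_common_prefix (fst (branch_point x h)) (fst (branch_point x' h')))))
       \<le> polar_dist \<bar>x - x'\<bar> h h'" unfolding j_def ld .
  qed
qed

section \<open>Exponentially branching trees\<close>

lemma simple_graph_edge:
  assumes "simple_graph V E" "{u, v} \<in> E"
  shows "u \<in> V" "v \<in> V" "u \<noteq> v"
proof -
  have "{u, v} \<subseteq> V" "card {u, v} = 2" using assms unfolding simple_graph_def by blast+
  then show "u \<in> V" "v \<in> V" "u \<noteq> v" by (auto simp: card_insert_if split: if_splits)
qed

lemma edge_walk_Cons: "edge_walk V E (x # xs) \<longleftrightarrow> x \<in> V \<and> (xs = [] \<or> {x, hd xs} \<in> E \<and> edge_walk V E xs)"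
  by (cases xs) (auto simp: edge_walk_def)

lemma edge_walk_append:
  assumes "edge_walk V E xs" "edge_walk V E ys" "{last xs, hd ys} \<in> E"
  shows "edge_walk V E (xs @ ys)"
  using assms by (auto simp: edge_walk_def successively_append_iff)

lemma edge_walk_rev: "edge_walk V E xs \<Longrightarrow> edge_walk V E (rev xs)"
  by (simp add: edge_walk_def insert_commute)

lemma edge_walk_distinct:
  assumes "edge_walk V E xs"
  shows "\<exists>ys. edge_walk V E ys \<and> hd ys = hd xs \<and> last ys = last xs \<and> set ys \<subseteq> set xs \<and> distinct ys"
  using assms
proof (induction xs)
  case Nil
  then show ?case by (simp add: edge_walk_def)
next
  case (Cons x xs)
  show ?case
  proof (cases "xs = []")
    case True
    with Cons.prems show ?thesis by (intro exI[of _ "[x]"]) auto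
  next
    case False
    then have e: "x \<in> V" "{x, hd xs} \<in> E" "edge_walk V E xs" using Cons.prems by (auto simp: edge_walk_Cons)
    then obtain ys where ys: "edge_walk V E ys" "hd ys = hd xs" "last ys = last xs" "set ys \<subseteq> set xs" "distinct ys"
      using Cons.IH by blast
    have ne: "ys \<noteq> []" using ys(1) by (simp add: edge_walk_def)
    show ?thesis
    proof (cases "x \<in> set ys")
      case True
      then obtain as bs where s: "ys = as @ x # bs" by (meson split_list)
      then have "edge_walk V E (x # bs)" using ys(1) by (auto simp: edge_walk_def successively_append_iff)
      then show ?thesis using s ys False by (intro exI[of _ "x # bs"]) auto
    next
      case F: False
      then show ?thesis using ys e ne False by (intro exI[of _ "x # ys"]) (auto simp: edge_walk_Cons)
    qed
  qed
qed

text \<open>Removing repetitions from the walk and closing it through \<open>v\<close> gives a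
  simple cycle.\<close>

lemma tree_no_detour:
  assumes "simplicial_tree V E" "{u, v} \<in> E" "{u', v} \<in> E" "u \<noteq> u'"
    and "edge_walk V E xs" "hd xs = u" "last xs = u'" "v \<notin> set xs"
  shows False
proof -
  obtain ys where ys: "edge_walk V E ys" "hd ys = u" "last ys = u'" "set ys \<subseteq> set xs" "distinct ys"
    using edge_walk_distinct[OF assms(5)] assms(6,7) by blast
  have g: "simple_graph V E" using assms(1) by (simp add: simplicial_tree_def)
  have v: "edge_walk V E [v]" using simple_graph_edge[OF g assms(2)] by (simp add: edge_walk_def)
  have ne: "ys \<noteq> []" using ys(1) by (simp add: edge_walk_def)
  have "edge_walk V E (ys @ [v])" using ys assms(3) v by (intro edge_walk_append) auto
  moreover have "distinct (ys @ [v])" using ys assms(8) by auto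
  moreover have "3 \<le> length (ys @ [v])"
  proof -
    have "length ys \<noteq> 1" using ys(2,3) assms(4) by (auto simp: length_Suc_conv)
    then show ?thesis using ne by (cases ys) (auto simp: Suc_le_eq)
  qed
  moreover have "{last (ys @ [v]), hd (ys @ [v])} \<in> E" using ys(2) ne assms(2) by (simp add: insert_commute)
  ultimately have "simple_cycle V E (ys @ [v])" by (simp add: simple_cycle_def)
  then show False using assms(1) by (auto simp: simplicial_tree_def)
qed

definition tree_depth :: "'v set \<Rightarrow> 'v set set \<Rightarrow> 'v \<Rightarrow> 'v \<Rightarrow> nat" where
  "tree_depth V E t v = (LEAST n. \<exists>xs. edge_walk V E xs \<and> hd xs = t \<and> last xs = v \<and> length xs = Suc n)"

locale rooted_tree =
  fixes V :: "'v set" and E :: "'v set set" and t0 :: 'v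
  assumes tree: "simplicial_tree V E" and root: "t0 \<in> V"
begin

abbreviation "depth \<equiv> tree_depth V E t0"

lemma graph: "simple_graph V E" and connected: "connected_graph V E"
  using tree by (simp_all add: simplicial_tree_def)

lemma depth_le:
  assumes "edge_walk V E xs" "hd xs = t0" "last xs = v" "length xs = Suc n"
  shows "depth v \<le> n"
  unfolding tree_depth_def using assms by (intro Least_le) blast

lemma depth_walk:
  assumes "v \<in> V"
  obtains xs where "edge_walk V E xs" "hd xs = t0" "last xs = v" "length xs = Suc (depth v)"
proof -
  obtain xs where "edge_walk V E xs" "hd xs = t0" "last xs = v"
    using connected root assms unfolding connected_graph_def by blast
  moreover from this have "length xs = Suc (length xs - 1)" by (cases xs) (auto simp: edge_walk_def)
  ultimately have "\<exists>n. \<exists>xs. edge_walk V E xs \<and> hd xs = t0 \<and> last xs = v \<and> length xs = Suc n" by blast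
  from LeastI_ex[OF this] show ?thesis using that unfolding tree_depth_def by blast
qed

lemma depth_root [simp]: "depth t0 = 0"
  using depth_le[of "[t0]" t0 0] root by (simp add: edge_walk_def)

lemma depth_0_iff: "v \<in> V \<Longrightarrow> depth v = 0 \<longleftrightarrow> v = t0"
  by (metis depth_root depth_walk last_ConsL length_0_conv length_Suc_conv list.sel(1))

lemma depth_edge: "{u, v} \<in> E \<Longrightarrow> depth v \<le> Suc (depth u)"
proof -
  assume e: "{u, v} \<in> E"
  note uv = simple_graph_edge[OF graph e]
  obtain xs where xs: "edge_walk V E xs" "hd xs = t0" "last xs = u" "length xs = Suc (depth u)"
    using depth_walk[OF uv(1)] by blast
  have "edge_walk V E (xs @ [v])" using xs e uv by (intro edge_walk_append) (auto simp: edge_walk_def)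
  moreover have "xs \<noteq> []" using xs by auto
  ultimately show ?thesis using depth_le[of "xs @ [v]" v "Suc (depth u)"] xs by simp
qed

lemma parent_ex:
  assumes "v \<in> V" "v \<noteq> t0"
  obtains u where "{u, v} \<in> E" "depth v = Suc (depth u)"
proof -
  obtain xs where xs: "edge_walk V E xs" "hd xs = t0" "last xs = v" "length xs = Suc (depth v)"
    using depth_walk[OF assms(1)] by blast
  have "depth v \<noteq> 0" using assms depth_0_iff by blast
  then obtain ys u where ys: "xs = ys @ [u, v]"
  proof -
    have "xs \<noteq> []" "butlast xs \<noteq> []" using xs \<open>depth v \<noteq> 0\<close> by (auto simp flip: length_0_conv)
    then have "xs = butlast (butlast xs) @ [last (butlast xs), v]"
      using xs(3) append_butlast_last_id[of xs] append_butlast_last_id[of "butlast xs"] by (metis append.assoc append_Cons append_Nil)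
    then show ?thesis using that by blast
  qed
  have w: "edge_walk V E (ys @ [u])" and e: "{u, v} \<in> E"
    using xs(1) unfolding ys by (auto simp: edge_walk_def successively_append_iff)
  have "hd (ys @ [u]) = t0" using xs(2) ys by (cases ys) auto
  then have "depth u \<le> depth v - 1" using depth_le[of "ys @ [u]" u "depth v - 1"] w xs(4) ys by simp
  then have "depth v = Suc (depth u)" using depth_edge[OF e] \<open>depth v \<noteq> 0\<close> by linarith
  then show ?thesis using that e by blast
qed

lemma descending_walk:
  assumes "u \<in> V"
  shows "\<exists>xs. edge_walk V E xs \<and> hd xs = u \<and> last xs = t0 \<and> (\<forall>w\<in>set xs. w = u \<or> depth w < depth u)"
  using assms
proof (induction "depth u" arbitrary: u rule: less_induct)
  case less
  show ?case
  proof (cases "u = t0")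
    case True
    then show ?thesis using less.prems by (intro exI[of _ "[u]"]) (simp add: edge_walk_def)
  next
    case False
    obtain v where v: "{v, u} \<in> E" "depth u = Suc (depth v)" using parent_ex[OF less.prems False] by blast
    obtain xs where xs: "edge_walk V E xs" "hd xs = v" "last xs = t0" "\<forall>w\<in>set xs. w = v \<or> depth w < depth v"
      using less.hyps[of v] v simple_graph_edge[OF graph v(1)] by auto
    have "xs \<noteq> []" using xs by (auto simp: edge_walk_def)
    then show ?thesis using xs v less.prems
      by (intro exI[of _ "u # xs"]) (auto simp: edge_walk_Cons insert_commute)
  qed
qed

text \<open>The descending walks of two such neighbours to the root avoid \<open>v\<close>; joined
  at the root they form a detour around \<open>v\<close>.\<close>

lemma lower_neighbour_unique:
  assumes "{u, v} \<in> E" "{u', v} \<in> E" "depth u \<le> depth v" "depth u' \<le> depth v"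
  shows "u = u'"
proof (rule ccontr)
  assume ne: "u \<noteq> u'"
  note g = simple_graph_edge[OF graph assms(1)] simple_graph_edge[OF graph assms(2)]
  obtain xs where xs: "edge_walk V E xs" "hd xs = u" "last xs = t0" "\<forall>w\<in>set xs. w = u \<or> depth w < depth u"
    using descending_walk[OF g(1)] by blast
  obtain ys where ys: "edge_walk V E ys" "hd ys = u'" "last ys = t0" "\<forall>w\<in>set ys. w = u' \<or> depth w < depth u'"
    using descending_walk[OF g(4)] by blast
  have nes: "xs \<noteq> []" "ys \<noteq> []" using xs ys by (auto simp: edge_walk_def)
  obtain zs where zs: "ys = zs @ [t0]" using ys(3) nes(2) by (metis append_butlast_last_id)
  have w: "edge_walk V E (xs @ rev zs) \<and> last (xs @ rev zs) = u'"
  proof (cases "zs = []")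
    case True
    then show ?thesis using xs ys zs by auto
  next
    case False
    then have "edge_walk V E zs" "{last zs, t0} \<in> E" "hd zs = u'"
      using ys(1,2) unfolding zs by (auto simp: edge_walk_def successively_append_iff)
    then show ?thesis using xs False edge_walk_rev[of V E zs]
      by (auto intro!: edge_walk_append simp: hd_rev insert_commute last_rev)
  qed
  have "v \<notin> set (xs @ rev zs)" using xs(4) ys(4) zs assms g by fastforce
  moreover have "hd (xs @ rev zs) = u" using xs nes by simp
  ultimately show False using tree_no_detour[OF tree assms(1,2) ne] w by blast
qed

definition parent :: "'v \<Rightarrow> 'v" where
  "parent v = (SOME u. {u, v} \<in> E \<and> depth v = Suc (depth u))"

lemma parent: "v \<in> V \<Longrightarrow> v \<noteq> t0 \<Longrightarrow> {parent v, v} \<in> E \<and> depth v = Suc (depth (parent v))"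
  unfolding parent_def by (rule someI_ex) (metis parent_ex)

lemma edge_cases:
  assumes "{u, v} \<in> E"
  shows "(u = parent v \<and> depth v = Suc (depth u)) \<or> (v = parent u \<and> depth u = Suc (depth v))"
proof -
  have *: "u = parent v \<and> depth v = Suc (depth u)" if e: "{u, v} \<in> E" and d: "depth u \<le> depth v" for u v
  proof -
    note g = simple_graph_edge[OF graph e]
    have "v \<noteq> t0" using d g depth_0_iff[of u] by auto
    note p = parent[OF g(2) this]
    then have "u = parent v" using lower_neighbour_unique[OF e, of "parent v"] d by simp
    then show ?thesis using p by simp
  qed
  show ?thesis using *[of u v] *[of v u] assms by (cases "depth u \<le> depth v") (auto simp: insert_commute)
qed

definition children :: "'v \<Rightarrow> 'v set" where
  "children v = {u. {u, v} \<in> E \<and> depth u = Suc (depth v)}"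

lemma childrenD: "u \<in> children v \<Longrightarrow> u \<in> V \<and> parent u = v \<and> depth u = Suc (depth v) \<and> {v, u} \<in> E"
proof -
  assume u: "u \<in> children v"
  then have e: "{u, v} \<in> E" "depth u = Suc (depth v)" by (auto simp: children_def)
  then show ?thesis using edge_cases[OF e(1)] simple_graph_edge[OF graph e(1)] by (auto simp: insert_commute)
qed

lemma neighbours_children: "neighbours E v \<subseteq> insert (parent v) (children v)"
  using edge_cases by (fastforce simp: neighbours_def children_def)

lemma neighbours_root: "neighbours E t0 \<subseteq> children t0"
  using edge_cases by (fastforce simp: neighbours_def children_def)

definition descends :: "'v \<Rightarrow> 'v \<Rightarrow> bool" where
  "descends a v \<longleftrightarrow> depth a \<le> depth v \<and> (parent ^^ (depth v - depth a)) v = a"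

lemma descends_self [simp]: "descends a a" by (simp add: descends_def)

lemma descends_child:
  assumes "u = parent v" "depth v = Suc (depth u)" "v \<noteq> a"
  shows "descends a v \<longleftrightarrow> descends a u"
proof (cases "depth a \<le> depth u")
  case True
  then have "depth v - depth a = Suc (depth u - depth a)" using assms by simp
  then show ?thesis using True assms by (simp add: descends_def funpow_swap1)
next
  case False
  then show ?thesis using assms by (auto simp: descends_def le_Suc_eq)
qed

end

section \<open>Lipschitz test functions and explicit paths on the realization\<close>

definition affine_extension :: "('v \<Rightarrow> real) \<Rightarrow> ('v \<Rightarrow> real) \<Rightarrow> real" where
  "affine_extension f p = (\<Sum>v | p v \<noteq> 0. p v * f v)"

lemma affine_extension_simplex:
  assumes "p \<in> closed_simplex s" "finite s"
  shows "affine_extension f p = (\<Sum>v\<in>s. p v * f v)"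
  unfolding affine_extension_def using assms
  by (intro sum.mono_neutral_left) (auto simp: closed_simplex_def)

lemma simplex_dist_simplex:
  assumes "p \<in> closed_simplex s" "q \<in> closed_simplex s" "finite s"
  shows "simplex_dist p q = (\<Sum>v\<in>s. \<bar>p v - q v\<bar>) / 2"
proof -
  have "(\<Sum>v | p v \<noteq> 0 \<or> q v \<noteq> 0. \<bar>p v - q v\<bar>) = (\<Sum>v\<in>s. \<bar>p v - q v\<bar>)"
    using assms by (intro sum.mono_neutral_left) (auto simp: closed_simplex_def)
  then show ?thesis by (simp add: simplex_dist_def)
qed

lemma simplex_dist_nonneg: "0 \<le> simplex_dist p q"
  by (simp add: simplex_dist_def sum_nonneg)

lemma affine_extension_lipschitz:
  assumes "simple_graph V E" "s \<in> graph_simplices V E" "p \<in> closed_simplex s" "q \<in> closed_simplex s"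
    and "\<And>u v. {u, v} \<in> E \<Longrightarrow> \<bar>f u - f v\<bar> \<le> 1"
  shows "\<bar>affine_extension f p - affine_extension f q\<bar> \<le> simplex_dist p q"
proof (cases "s \<in> E")
  case True
  then have "card s = 2" using assms(1) by (simp add: simple_graph_def)
  then obtain u v where s: "s = {u, v}" "u \<noteq> v" by (auto simp: card_2_iff)
  have p: "p u + p v = 1" "q u + q v = 1" using assms(3,4) s by (auto simp: closed_simplex_def)
  have "affine_extension f p - affine_extension f q = (p u - q u) * (f u - f v)"
  proof -
    have pv: "p v = 1 - p u" "q v = 1 - q u" using p by simp_all
    have "affine_extension f p = p u * f u + p v * f v" "affine_extension f q = q u * f u + q v * f v"
      using affine_extension_simplex[OF assms(3)] affine_extension_simplex[OF assms(4)] s by simp_all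
    then show ?thesis unfolding pv by (simp add: algebra_simps)
  qed
  moreover have "simplex_dist p q = \<bar>p u - q u\<bar>"
  proof -
    have "p v - q v = - (p u - q u)" using p by simp
    then show ?thesis using simplex_dist_simplex[OF assms(3,4)] s by simp
  qed
  moreover have "\<bar>p u - q u\<bar> * \<bar>f u - f v\<bar> \<le> \<bar>p u - q u\<bar> * 1"
    using assms(5)[of u v] True s by (intro mult_left_mono) auto
  ultimately show ?thesis by (simp add: abs_mult)
next
  case False
  then obtain v where s: "s = {v}" using assms(2) by (auto simp: graph_simplices_def)
  then have "affine_extension f p = f v" "affine_extension f q = f v"
    using affine_extension_simplex[OF assms(3)] affine_extension_simplex[OF assms(4)] assms(3,4) by (auto simp: closed_simplex_def)
  then show ?thesis by (simp add: simplex_dist_nonneg)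
qed

lemma path_length_Cons: "path_length (x # y # xs) = simplex_dist x y + path_length (y # xs)"
  by (simp add: path_length_def)

lemma path_length_single [simp]: "path_length [x] = 0"
  by (simp add: path_length_def)

lemma path_length_nonneg: "0 \<le> path_length xs"
  unfolding path_length_def by (intro sum_list_nonneg) (auto simp: simplex_dist_nonneg)

lemma path_length_append:
  "path_length (xs @ [y] @ ys) = path_length (xs @ [y]) + path_length (y # ys)"
proof (induction xs)
  case (Cons x xs)
  then show ?case by (cases xs) (simp_all add: path_length_Cons)
qed simp

lemma affine_extension_path:
  assumes "simple_graph V E" "\<And>u v. {u, v} \<in> E \<Longrightarrow> \<bar>f u - f v\<bar> \<le> 1" "simplicial_path V E p q xs"
  shows "\<bar>affine_extension f p - affine_extension f q\<bar> \<le> path_length xs"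
  using assms(3)
proof (induction xs arbitrary: p)
  case Nil
  then show ?case by (simp add: simplicial_path_def)
next
  case (Cons x xs)
  show ?case
  proof (cases xs)
    case Nil
    then show ?thesis using Cons.prems by (auto simp: simplicial_path_def)
  next
    case (Cons y ys)
    then have "simplicial_path V E y q xs" "p = x" "\<exists>s\<in>graph_simplices V E. x \<in> closed_simplex s \<and> y \<in> closed_simplex s"
      using Cons.prems by (auto simp: simplicial_path_def)
    then show ?thesis
      using Cons.IH[of y] affine_extension_lipschitz[OF assms(1) _ _ _ assms(2), of _ x y] Cons
      by (fastforce simp: path_length_Cons)
  qed
qed

text \<open>Distances are bounded below by the increments of a test function that is 1-Lipschitz on
  edges. The given path makes sure that the infimum is over a nonempty set.\<close>

lemma simplicial_dist_ge:
  assumes "simple_graph V E" "\<And>u v. {u, v} \<in> E \<Longrightarrow> \<bar>f u - f v\<bar> \<le> 1" "simplicial_path V E p q xs"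
  shows "\<bar>affine_extension f p - affine_extension f q\<bar> \<le> simplicial_dist V E p q"
  unfolding simplicial_dist_def using assms affine_extension_path[OF assms(1,2)]
  by (intro cInf_greatest) auto

lemma simplicial_dist_le:
  assumes "simplicial_path V E p q xs"
  shows "simplicial_dist V E p q \<le> path_length xs"
  unfolding simplicial_dist_def using assms path_length_nonneg
  by (intro cInf_lower bdd_belowI[of _ 0]) auto

text \<open>A witnessing path instead of the infimum: bounds add under concatenation without
  approximation arguments.\<close>

definition path_within :: "'v set \<Rightarrow> 'v set set \<Rightarrow> real \<Rightarrow> ('v \<Rightarrow> real) \<Rightarrow> ('v \<Rightarrow> real) \<Rightarrow> bool" where
  "path_within V E L p q \<longleftrightarrow> (\<exists>xs. simplicial_path V E p q xs \<and> path_length xs \<le> L)"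

lemma path_within_trans:
  assumes "path_within V E L p q" "path_within V E M q r"
  shows "path_within V E (L + M) p r"
proof -
  obtain xs where xs: "simplicial_path V E p q xs" "path_length xs \<le> L" using assms by (auto simp: path_within_def)
  obtain ys where ys: "simplicial_path V E q r ys" "path_length ys \<le> M" using assms by (auto simp: path_within_def)
  obtain xs' where x: "xs = xs' @ [q]" using xs by (metis simplicial_path_def append_butlast_last_id)
  obtain ys' where y: "ys = q # ys'" using ys by (cases ys) (auto simp: simplicial_path_def)
  have "simplicial_path V E p r (xs' @ [q] @ ys')"
    using xs(1) ys(1) unfolding x y by (auto simp: simplicial_path_def successively_append_iff hd_append split: if_splits)
  moreover have "path_length (xs' @ [q] @ ys') \<le> L + M"
    using path_length_append[of xs' q ys'] xs(2) ys(2) x y by simp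
  ultimately show ?thesis unfolding path_within_def by blast
qed

lemma path_within_simplex:
  assumes "s \<in> graph_simplices V E" "p \<in> closed_simplex s" "q \<in> closed_simplex s" "simplex_dist p q \<le> L"
  shows "path_within V E L p q"
  unfolding path_within_def using assms
  by (intro exI[of _ "[p, q]"]) (auto simp: simplicial_path_def realization_def path_length_Cons)

lemma path_within_commute:
  assumes "path_within V E L p q" shows "path_within V E L q p"
proof -
  have sym: "simplex_dist x y = simplex_dist y x" for x y :: "'v \<Rightarrow> real"
    by (simp add: simplex_dist_def abs_minus_commute disj_commute)
  have "path_length (rev xs) = path_length xs" for xs :: "('v \<Rightarrow> real) list"
  proof (induction xs)
    case (Cons x xs)
    show ?case
    proof (cases xs)
      case (Cons y ys)
      have "path_length (rev (x # xs)) = path_length (rev ys @ [y]) + path_length [y, x]"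
        using path_length_append[of "rev ys" y "[x]"] Cons by simp
      also have "path_length (rev ys @ [y]) = path_length xs" using Cons.IH Cons by simp
      finally show ?thesis using Cons by (simp add: path_length_Cons sym)
    qed simp
  qed simp
  moreover have "simplicial_path V E q p (rev xs)" if "simplicial_path V E p q xs" for xs
    using that by (auto simp: simplicial_path_def hd_rev last_rev conj_commute)
  ultimately show ?thesis using assms unfolding path_within_def by metis
qed

lemma path_within_dist:
  assumes "path_within V E L p q" shows "simplicial_dist V E p q \<le> L"
  using assms simplicial_dist_le unfolding path_within_def by (meson order_trans)

definition segment_point :: "'v \<Rightarrow> 'v \<Rightarrow> real \<Rightarrow> 'v \<Rightarrow> real" where
  "segment_point u v f = (\<lambda>w. (1 - f) * indicator {u} w + f * indicator {v} w)"

lemma segment_point_ends: "segment_point u v 0 = vertex_point u" "segment_point u v 1 = vertex_point v"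
  by (auto simp: segment_point_def vertex_point_def)

lemma segment_point_in_simplex:
  assumes "u \<noteq> v" "0 \<le> f" "f \<le> 1"
  shows "segment_point u v f \<in> closed_simplex {u, v}"
  using assms by (auto simp: closed_simplex_def segment_point_def)

lemma simplex_dist_segment:
  assumes "u \<noteq> v" "0 \<le> f" "f \<le> 1" "0 \<le> g" "g \<le> 1"
  shows "simplex_dist (segment_point u v f) (segment_point u v g) = \<bar>f - g\<bar>"
proof -
  have "simplex_dist (segment_point u v f) (segment_point u v g) = (\<Sum>w\<in>{u, v}. \<bar>segment_point u v f w - segment_point u v g w\<bar>) / 2"
    using assms by (intro simplex_dist_simplex segment_point_in_simplex) auto
  also have "\<dots> = \<bar>f - g\<bar>" using assms(1) by (simp add: segment_point_def abs_minus_commute)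
  finally show ?thesis .
qed

lemma affine_extension_segment:
  assumes "u \<noteq> v" "0 \<le> f" "f \<le> 1"
  shows "affine_extension \<phi> (segment_point u v f) = (1 - f) * \<phi> u + f * \<phi> v"
  using affine_extension_simplex[OF segment_point_in_simplex[OF assms]] assms(1) by (simp add: segment_point_def)

lemma affine_extension_vertex: "affine_extension \<phi> (vertex_point v) = \<phi> v"
proof -
  have "{w. vertex_point v w \<noteq> 0} = {v}" by (auto simp: vertex_point_def indicator_def)
  then show ?thesis by (simp add: affine_extension_def vertex_point_def)
qed

section \<open>Points on rays that descend in the tree\<close>

definition ray_point :: "(nat \<Rightarrow> 'v) \<Rightarrow> real \<Rightarrow> 'v \<Rightarrow> real" where
  "ray_point \<xi> \<rho> = segment_point (\<xi> (nat \<lfloor>\<rho>\<rfloor>)) (\<xi> (Suc (nat \<lfloor>\<rho>\<rfloor>))) (\<rho> - real (nat \<lfloor>\<rho>\<rfloor>))"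

lemma ray_point_of_nat: "ray_point \<xi> (real m) = vertex_point (\<xi> m)"
  by (simp add: ray_point_def segment_point_ends)

lemma ray_point_segment:
  assumes "real m \<le> \<rho>" "\<rho> \<le> real m + 1"
  shows "ray_point \<xi> \<rho> = segment_point (\<xi> m) (\<xi> (Suc m)) (\<rho> - real m)"
proof (cases "\<rho> = real (Suc m)")
  case True
  then show ?thesis using ray_point_of_nat[of \<xi> "Suc m"] by (simp add: segment_point_ends)
next
  case False
  then have "nat \<lfloor>\<rho>\<rfloor> = m" using assms by linarith
  then show ?thesis by (simp add: ray_point_def)
qed

lemma ray_point_cong:
  assumes "\<And>m. m \<le> K \<Longrightarrow> \<xi> m = \<eta> m" "0 \<le> \<rho>" "\<rho> \<le> real K"
  shows "ray_point \<xi> \<rho> = ray_point \<eta> \<rho>"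
proof (cases "\<rho> = real K")
  case True
  then show ?thesis using assms(1)[of K] by (simp add: ray_point_of_nat)
next
  case False
  then have "nat \<lfloor>\<rho>\<rfloor> < K" using assms by linarith
  then show ?thesis using assms(1)[of "nat \<lfloor>\<rho>\<rfloor>"] assms(1)[of "Suc (nat \<lfloor>\<rho>\<rfloor>)"] by (simp add: ray_point_def)
qed

context rooted_tree
begin

definition downward_ray :: "(nat \<Rightarrow> 'v) \<Rightarrow> bool" where
  "downward_ray \<xi> \<longleftrightarrow> \<xi> 0 \<in> V \<and> (\<forall>m. \<xi> (Suc m) \<in> children (\<xi> m))"

lemma downward_rayD:
  assumes "downward_ray \<xi>"
  shows "\<xi> m \<in> V" "depth (\<xi> m) = depth (\<xi> 0) + m" "parent (\<xi> (Suc m)) = \<xi> m" "{\<xi> m, \<xi> (Suc m)} \<in> E" "\<xi> m \<noteq> \<xi> (Suc m)"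
proof -
  have c: "\<xi> (Suc m) \<in> V \<and> parent (\<xi> (Suc m)) = \<xi> m \<and> depth (\<xi> (Suc m)) = Suc (depth (\<xi> m)) \<and> {\<xi> m, \<xi> (Suc m)} \<in> E" for m
    using assms childrenD unfolding downward_ray_def by blast
  show "\<xi> m \<in> V" using assms c by (cases m) (auto simp: downward_ray_def)
  show "depth (\<xi> m) = depth (\<xi> 0) + m" using c by (induction m) auto
  show "parent (\<xi> (Suc m)) = \<xi> m" "{\<xi> m, \<xi> (Suc m)} \<in> E" using c by auto
  show "\<xi> m \<noteq> \<xi> (Suc m)" using c[of m] by (metis n_not_Suc_n)
qed

lemma parent_power_ray: "downward_ray \<xi> \<Longrightarrow> (parent ^^ k) (\<xi> (m + k)) = \<xi> m"
  by (induction k) (simp_all add: funpow_swap1 downward_rayD(3) del: funpow.simps(2), simp add: funpow_Suc_right downward_rayD(3) del: funpow.simps(2))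

lemma ray_point_in_realization:
  assumes "downward_ray \<xi>" "0 \<le> \<rho>"
  shows "ray_point \<xi> \<rho> \<in> realization V E"
proof -
  have "ray_point \<xi> \<rho> \<in> closed_simplex {\<xi> (nat \<lfloor>\<rho>\<rfloor>), \<xi> (Suc (nat \<lfloor>\<rho>\<rfloor>))}"
    unfolding ray_point_def using assms downward_rayD by (intro segment_point_in_simplex) (auto, linarith+)
  moreover have "{\<xi> (nat \<lfloor>\<rho>\<rfloor>), \<xi> (Suc (nat \<lfloor>\<rho>\<rfloor>))} \<in> graph_simplices V E"
    using downward_rayD[OF assms(1)] by (auto simp: graph_simplices_def)
  ultimately show ?thesis unfolding realization_def by blast
qed

lemma path_within_segment:
  assumes "downward_ray \<xi>" "real m \<le> \<rho>" "\<rho> \<le> \<rho>'" "\<rho>' \<le> real m + 1"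
  shows "path_within V E (\<rho>' - \<rho>) (ray_point \<xi> \<rho>) (ray_point \<xi> \<rho>')"
proof -
  note r = downward_rayD[OF assms(1), of m]
  have "{\<xi> m, \<xi> (Suc m)} \<in> graph_simplices V E" using r by (simp add: graph_simplices_def)
  moreover have "ray_point \<xi> \<rho> = segment_point (\<xi> m) (\<xi> (Suc m)) (\<rho> - real m)" "ray_point \<xi> \<rho>' = segment_point (\<xi> m) (\<xi> (Suc m)) (\<rho>' - real m)"
    using assms by (auto intro!: ray_point_segment)
  ultimately show ?thesis using assms r(5)
    by (intro path_within_simplex[of "{\<xi> m, \<xi> (Suc m)}"]) (auto intro!: segment_point_in_simplex simp: simplex_dist_segment)
qed

lemma path_within_ray:
  assumes "downward_ray \<xi>" "0 \<le> \<rho>" "\<rho> \<le> \<rho>'"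
  shows "path_within V E (\<rho>' - \<rho>) (ray_point \<xi> \<rho>) (ray_point \<xi> \<rho>')"
proof -
  have *: "path_within V E (\<rho>' - \<rho>) (ray_point \<xi> \<rho>) (ray_point \<xi> \<rho>')"
    if "real m \<le> \<rho>" "\<rho> \<le> real m + 1" "\<rho> \<le> \<rho>'" "\<rho>' \<le> real (m + k) + 1" for m k \<rho>'
    using that
  proof (induction k arbitrary: \<rho>')
    case 0
    then show ?case using path_within_segment[OF assms(1), of m \<rho> \<rho>'] by simp
  next
    case (Suc k)
    show ?case
    proof (cases "\<rho>' \<le> real (m + k) + 1")
      case True
      then show ?thesis using Suc by blast
    next
      case False
      let ?c = "real (m + k) + 1"
      have "path_within V E (?c - \<rho>) (ray_point \<xi> \<rho>) (ray_point \<xi> ?c)" using Suc by (intro Suc.IH) auto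
      moreover have "path_within V E (\<rho>' - ?c) (ray_point \<xi> ?c) (ray_point \<xi> \<rho>')"
        using path_within_segment[OF assms(1), of "Suc (m + k)" ?c \<rho>'] Suc.prems False by simp
      ultimately show ?thesis using path_within_trans by fastforce
    qed
  qed
  show ?thesis
    using *[of "nat \<lfloor>\<rho>\<rfloor>" \<rho>' "nat \<lceil>\<rho>'\<rceil>"] assms by linarith
qed

lemma rays_upper:
  assumes "downward_ray \<xi>" "downward_ray \<eta>" "\<And>m. m \<le> K \<Longrightarrow> \<xi> m = \<eta> m" "0 \<le> \<rho>" "0 \<le> \<rho>'"
  shows "path_within V E (\<rho> + \<rho>' - 2 * min (min \<rho> \<rho>') (real K)) (ray_point \<xi> \<rho>) (ray_point \<eta> \<rho>')"
proof -
  let ?\<mu> = "min (min \<rho> \<rho>') (real K)"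
  have eq: "ray_point \<xi> ?\<mu> = ray_point \<eta> ?\<mu>" using assms by (intro ray_point_cong[where K=K]) auto
  have "path_within V E (\<rho> - ?\<mu>) (ray_point \<xi> \<rho>) (ray_point \<xi> ?\<mu>)"
    using assms by (intro path_within_commute[OF path_within_ray]) auto
  moreover have "path_within V E (\<rho>' - ?\<mu>) (ray_point \<xi> ?\<mu>) (ray_point \<eta> \<rho>')"
    unfolding eq using assms by (intro path_within_ray) auto
  moreover have "(\<rho> - ?\<mu>) + (\<rho>' - ?\<mu>) = \<rho> + \<rho>' - 2 * ?\<mu>" by simp
  ultimately show ?thesis using path_within_trans by metis
qed

lemma affine_extension_ray:
  assumes "downward_ray \<xi>" "\<And>m. k \<le> m \<Longrightarrow> \<phi> (\<xi> m) = a + b * real m" "real k \<le> \<rho>"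
  shows "affine_extension \<phi> (ray_point \<xi> \<rho>) = a + b * \<rho>"
proof -
  have \<rho>: "0 \<le> \<rho>" using assms(3) by linarith
  let ?m = "nat \<lfloor>\<rho>\<rfloor>"
  have m: "k \<le> ?m" "real ?m \<le> \<rho>" "\<rho> \<le> real ?m + 1" using assms(3) \<rho> by linarith+
  have "affine_extension \<phi> (ray_point \<xi> \<rho>) = (1 - (\<rho> - ?m)) * \<phi> (\<xi> ?m) + (\<rho> - ?m) * \<phi> (\<xi> (Suc ?m))"
    unfolding ray_point_def
  proof (rule affine_extension_segment)
    show "\<xi> ?m \<noteq> \<xi> (Suc ?m)" by (rule downward_rayD(5)[OF assms(1)])
    show "0 \<le> \<rho> - real ?m" "\<rho> - real ?m \<le> 1" using m by linarith+
  qed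
  also have "\<dots> = a + b * \<rho>" using assms(2)[of ?m] assms(2)[of "Suc ?m"] m by (simp add: algebra_simps)
  finally show ?thesis .
qed

lemma depth_lipschitz: "{u, v} \<in> E \<Longrightarrow> \<bar>real (depth u) - real (depth v)\<bar> \<le> 1"
  using edge_cases[of u v] by auto

lemma path_within_ex:
  assumes "downward_ray \<xi>" "downward_ray \<eta>" "\<xi> 0 = \<eta> 0" "0 \<le> \<rho>" "0 \<le> \<rho>'"
  obtains xs where "simplicial_path V E (ray_point \<xi> \<rho>) (ray_point \<eta> \<rho>') xs"
  using rays_upper[OF assms(1,2), of 0 \<rho> \<rho>'] assms(3-5) by (auto simp: path_within_def)

lemma rays_depth_lower:
  assumes "downward_ray \<xi>" "downward_ray \<eta>" "\<xi> 0 = \<eta> 0" "0 \<le> \<rho>" "0 \<le> \<rho>'"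
  shows "\<bar>\<rho> - \<rho>'\<bar> \<le> simplicial_dist V E (ray_point \<xi> \<rho>) (ray_point \<eta> \<rho>')"
proof -
  obtain xs where xs: "simplicial_path V E (ray_point \<xi> \<rho>) (ray_point \<eta> \<rho>') xs"
    using path_within_ex[OF assms] by blast
  have "affine_extension (\<lambda>v. real (depth v)) (ray_point \<xi> \<rho>) = real (depth (\<xi> 0)) + 1 * \<rho>"
  proof (rule affine_extension_ray[OF assms(1), where k=0])
    show "real (depth (\<xi> m)) = real (depth (\<xi> 0)) + 1 * real m" for m
      using downward_rayD(2)[OF assms(1), of m] by simp
  qed (use assms in simp)
  moreover have "affine_extension (\<lambda>v. real (depth v)) (ray_point \<eta> \<rho>') = real (depth (\<eta> 0)) + 1 * \<rho>'"
  proof (rule affine_extension_ray[OF assms(2), where k=0])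
    show "real (depth (\<eta> m)) = real (depth (\<eta> 0)) + 1 * real m" for m
      using downward_rayD(2)[OF assms(2), of m] by simp
  qed (use assms in simp)
  ultimately show ?thesis using simplicial_dist_ge[OF graph _ xs, of "\<lambda>v. real (depth v)"] depth_lipschitz assms(3) by simp
qed

text \<open>The test function is the depth below the branching vertex, with sign plus under the next
  vertex of one ray, minus under that of the other, and 0 elsewhere. If one point is not below the
  branching vertex, the depth alone suffices.\<close>

lemma rays_branch_lower:
  assumes "downward_ray \<xi>" "downward_ray \<eta>" "\<xi> 0 = \<eta> 0" "\<xi> K = \<eta> K" "\<xi> (Suc K) \<noteq> \<eta> (Suc K)" "0 \<le> \<rho>" "0 \<le> \<rho>'"
  shows "\<rho> + \<rho>' - 2 * min (min \<rho> \<rho>') (real K) \<le> simplicial_dist V E (ray_point \<xi> \<rho>) (ray_point \<eta> \<rho>')"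
proof (cases "\<rho> \<le> K \<or> \<rho>' \<le> K")
  case True
  then show ?thesis using rays_depth_lower[OF assms(1-3,6,7)] by (auto simp: min_def)
next
  case False
  obtain xs where xs: "simplicial_path V E (ray_point \<xi> \<rho>) (ray_point \<eta> \<rho>') xs"
    using path_within_ex[OF assms(1-3,6,7)] by blast
  let ?a = "\<xi> (Suc K)" and ?b = "\<eta> (Suc K)"
  define e where "e = real (depth (\<xi> K))"
  define \<phi> where "\<phi> v = (if descends ?a v then real (depth v) - e else if descends ?b v then e - real (depth v) else 0)" for v
  note dx = downward_rayD[OF assms(1)] and dy = downward_rayD[OF assms(2)]
  have dab: "real (depth ?a) = e + 1" "real (depth ?b) = e + 1" "parent ?a = \<xi> K" "parent ?b = \<xi> K"
    using dx(2)[of K] dx(2)[of "Suc K"] dy(2)[of "Suc K"] dx(3)[of K] dy(3)[of K] assms(3,4) by (auto simp: e_def)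
  have top: "\<not> descends ?a (\<xi> K)" "\<not> descends ?b (\<xi> K)"
    using dx(2)[of K] dx(2)[of "Suc K"] dy(2)[of "Suc K"] assms(3) by (auto simp: descends_def)
  have lip1: "\<bar>\<phi> u - \<phi> v\<bar> \<le> 1" if "u = parent v" "depth v = Suc (depth u)" for u v
  proof -
    consider "v = ?a" | "v = ?b" | "v \<noteq> ?a" "v \<noteq> ?b" by blast
    then show ?thesis
    proof cases
      case 1
      then show ?thesis using top dab that(1) by (simp add: \<phi>_def)
    next
      case 2
      have "\<not> descends ?a ?b" using dx(2)[of "Suc K"] dy(2)[of "Suc K"] assms(3,5) by (auto simp: descends_def)
      then show ?thesis using 2 top dab that(1) by (simp add: \<phi>_def)
    next
      case 3
      then show ?thesis using descends_child[OF that, of ?a] descends_child[OF that, of ?b] that(2) by (simp add: \<phi>_def)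
    qed
  qed
  have lip: "\<bar>\<phi> u - \<phi> v\<bar> \<le> 1" if "{u, v} \<in> E" for u v
    using edge_cases[OF that] lip1[of u v] lip1[of v u] by (auto simp: abs_minus_commute)
  have vx: "\<phi> (\<xi> m) = - real K + 1 * real m" if "K \<le> m" for m
  proof (cases "m = K")
    case True
    then show ?thesis using top by (simp add: \<phi>_def)
  next
    case False
    then have m: "m = Suc K + (m - Suc K)" using that by simp
    have "descends ?a (\<xi> m)" using parent_power_ray[OF assms(1), of "m - Suc K" "Suc K"] m dx(2)[of m] dx(2)[of "Suc K"]
      by (simp add: descends_def)
    then show ?thesis using dx(2)[of m] dx(2)[of K] by (simp add: \<phi>_def e_def)
  qed
  have vy: "\<phi> (\<eta> m) = real K + (- 1) * real m" if "K \<le> m" for m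
  proof (cases "m = K")
    case True
    then show ?thesis using top assms(4) by (simp add: \<phi>_def)
  next
    case False
    then have m: "m = Suc K + (m - Suc K)" using that by simp
    then have p: "(parent ^^ (m - Suc K)) (\<eta> m) = ?b" using parent_power_ray[OF assms(2), of "m - Suc K" "Suc K"] by simp
    then have "descends ?b (\<eta> m)" "\<not> descends ?a (\<eta> m)"
      using that False dy(2)[of m] dy(2)[of "Suc K"] dx(2)[of "Suc K"] assms(3,5)
      by (auto simp: descends_def)
    then show ?thesis using dy(2)[of m] dx(2)[of K] assms(3) by (simp add: \<phi>_def e_def)
  qed
  have "affine_extension \<phi> (ray_point \<xi> \<rho>) = - real K + 1 * \<rho>"
    using False vx by (intro affine_extension_ray[OF assms(1), where k=K]) auto
  moreover have "affine_extension \<phi> (ray_point \<eta> \<rho>') = real K + (- 1) * \<rho>'"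
    using False vy by (intro affine_extension_ray[OF assms(2), where k=K]) auto
  ultimately show ?thesis using simplicial_dist_ge[OF graph _ xs, of \<phi>] lip False by (simp add: min_def)
qed

lemma depth_le_simplicial_dist:
  assumes "v \<in> V"
  shows "real (depth v) \<le> simplicial_dist V E (vertex_point v) (vertex_point t0)"
proof -
  obtain ys where ys: "edge_walk V E ys" "hd ys = v" "last ys = t0" using descending_walk[OF assms] by blast
  have vs: "vertex_point u \<in> closed_simplex s" if "u \<in> s" "finite s" for u :: 'v and s
    using that by (auto simp: closed_simplex_def vertex_point_def indicator_def)
  have "simplicial_path V E (vertex_point (hd ys)) (vertex_point (last ys)) (map vertex_point ys)"
    using ys(1)
  proof (induction ys)
    case (Cons y ys)
    show ?case
    proof (cases ys)
      case Nil
      have "vertex_point y \<in> realization V E" using Cons.prems vs[of y "{y}"]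
        by (auto simp: realization_def graph_simplices_def edge_walk_def)
      then show ?thesis using Nil by (simp add: simplicial_path_def)
    next
      case (Cons z zs)
      then have e: "{y, z} \<in> E" "edge_walk V E ys" using Cons.prems by (auto simp: edge_walk_Cons)
      then have s: "{y, z} \<in> graph_simplices V E" by (simp add: graph_simplices_def)
      moreover have c: "vertex_point y \<in> closed_simplex {y, z}" "vertex_point z \<in> closed_simplex {y, z}" by (auto intro: vs)
      ultimately have "vertex_point y \<in> realization V E" unfolding realization_def by blast
      then show ?thesis using Cons.IH[OF e(2)] Cons s c by (auto simp: simplicial_path_def)
    qed
  qed (simp add: edge_walk_def)
  from simplicial_dist_ge[OF graph _ this, of "\<lambda>v. real (depth v)"] show ?thesis
    using depth_lipschitz ys by (simp add: affine_extension_vertex)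
qed

end

text \<open>A vertex at distance \<open>m\<close> from the base has more than \<open>exp (\<sigma> m)\<close> neighbours, so far enough out,
  and with every edge of the labelled tree stretched to \<open>\<kappa>\<close> edges, there are children enough to
  separate \<open>B ^ Suc k\<close> labels at depth \<open>k\<close>.\<close>

theorem exponentially_branching_contains_labelled_tree:
  fixes V :: "'v set" and E :: "'v set set" and Lab :: "nat \<Rightarrow> 'l set" and B :: nat
  assumes "simplicial_tree V E" "exponentially_branching V E"
    and fin: "\<And>k. finite (Lab k)" and card: "\<And>k. card (Lab k) \<le> B ^ Suc k" and "1 \<le> B"
  shows "\<exists>\<kappa>>0. \<exists>P :: (nat \<Rightarrow> 'l) \<Rightarrow> real \<Rightarrow> 'v \<Rightarrow> real. \<forall>\<omega> \<omega>' r r'.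
    (\<forall>k. \<omega> k \<in> Lab k) \<longrightarrow> (\<forall>k. \<omega>' k \<in> Lab k) \<longrightarrow> 0 \<le> r \<longrightarrow> 0 \<le> r' \<longrightarrow>
    P \<omega> r \<in> realization V E \<and>
    \<kappa> * \<bar>r - r'\<bar> \<le> simplicial_dist V E (P \<omega> r) (P \<omega>' r') \<and>
    (\<forall>K. (\<forall>k<K. \<omega> k = \<omega>' k) \<longrightarrow>
      simplicial_dist V E (P \<omega> r) (P \<omega>' r') \<le> \<kappa> * (r + r' - 2 * min (min r r') (real K)) \<and>
      (\<omega> K \<noteq> \<omega>' K \<longrightarrow>
        \<kappa> * (r + r' - 2 * min (min r r') (real K)) \<le> simplicial_dist V E (P \<omega> r) (P \<omega>' r')))"
proof -
  obtain t0 \<sigma> where t0: "t0 \<in> V" and \<sigma>: "0 < \<sigma>" and br: "\<And>t. t \<in> V \<Longrightarrow> infinite (neighbours E t) \<or>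
      exp (\<sigma> * simplicial_dist V E (vertex_point t) (vertex_point t0)) < real (card (neighbours E t))"
    using assms(2) unfolding exponentially_branching_def exponentially_branching_at_def by blast
  interpret rooted_tree V E t0 using assms(1) t0 by unfold_locales
  have kids: "infinite (children t) \<or> exp (\<sigma> * depth t) < real (card (children t)) + 1" if "t \<in> V" for t
  proof (rule ccontr)
    assume "\<not> ?thesis"
    then have c: "finite (children t)" "real (card (children t)) + 1 \<le> exp (\<sigma> * depth t)" by auto
    have "finite (neighbours E t)" using neighbours_children[of t] c(1) finite_subset by blast
    moreover have "card (neighbours E t) \<le> card (children t) + 1"
      using card_mono[OF _ neighbours_children[of t]] c(1) card_insert_le_m1[of "Suc (card (children t))" "children t" "parent t"]
      by (simp add: card_insert_if split: if_splits)
    moreover have "exp (\<sigma> * depth t) \<le> exp (\<sigma> * simplicial_dist V E (vertex_point t) (vertex_point t0))"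
      using depth_le_simplicial_dist[OF that] \<sigma> by simp
    ultimately show False using br[OF that] c(2) by linarith
  qed
  \<comment> \<open>At the root the general bound only says that the number of children is positive
    or infinite after reserving one neighbour for a parent; there it is simpler to use that all
    neighbours are children.\<close>
  have kid_ex: "children t \<noteq> {}" if "t \<in> V" for t
  proof (cases "t = t0")
    case True
    have "0 \<le> simplicial_dist V E (vertex_point t0) (vertex_point t0)"
      using depth_le_simplicial_dist[OF t0] by simp
    then have "1 \<le> exp (\<sigma> * simplicial_dist V E (vertex_point t0) (vertex_point t0))" using \<sigma> by simp
    then have "infinite (neighbours E t0) \<or> 1 < real (card (neighbours E t0))" using br[OF t0] by linarith
    then have "neighbours E t0 \<noteq> {}" by auto
    then show ?thesis using neighbours_root True by auto
  next
    case False
    then have "0 < depth t" using depth_0_iff[OF that] by simp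
    then have "1 < exp (\<sigma> * depth t)" using \<sigma> by simp
    then show ?thesis using kids[OF that] by auto
  qed
  have deep: "\<exists>t\<in>V. depth t = n" for n
  proof (induction n)
    case 0
    show ?case using t0 depth_root by (intro bexI[of _ t0])
  next
    case (Suc n)
    then obtain t where "t \<in> V" "depth t = n" by blast
    moreover obtain u where "u \<in> children t" using kid_ex[OF \<open>t \<in> V\<close>] by blast
    ultimately show ?case using childrenD[of u t] by auto
  qed
  have big: "\<exists>n. 1 \<le> n \<and> c \<le> exp (\<sigma> * real n)" for c
  proof -
    obtain n where n: "c / \<sigma> < real n" using reals_Archimedean2 by blast
    have "c \<le> \<sigma> * real (Suc n)" using n \<sigma> by (simp add: field_simps)
    also have "\<dots> \<le> exp (\<sigma> * real (Suc n))" using exp_ge_add_one_self[of "\<sigma> * real (Suc n)"] by linarith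
    finally show ?thesis by (intro exI[of _ "Suc n"]) simp
  qed
  \<comment> \<open>Every \<open>\<kappa>\<close> steps gain a factor \<open>B\<close>, as one more
    label does. Starting at depth \<open>R\<close> pays for the labels of depth 0 and for the
    neighbour lost to the parent.\<close>
  obtain \<kappa> where \<kappa>: "1 \<le> \<kappa>" "real B \<le> exp (\<sigma> * real \<kappa>)" using big by blast
  obtain R where R: "real B + 1 \<le> exp (\<sigma> * real R)" using big by blast
  define lev where "lev v = (depth v - R) div \<kappa>" for v
  have inj: "\<exists>f. inj_on f (Lab (lev v)) \<and> f ` Lab (lev v) \<subseteq> children v" if v: "v \<in> V" "R \<le> depth v" for v
  proof (cases "finite (children v)")
    case True
    have "lev v * \<kappa> + R \<le> depth v" using v(2) div_times_less_eq_dividend[of "depth v - R" \<kappa>] unfolding lev_def by linarith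
    then have "\<sigma> * real (lev v * \<kappa> + R) \<le> \<sigma> * real (depth v)" using \<sigma> by (intro mult_left_mono) (auto simp del: of_nat_add of_nat_mult)
    then have "exp (\<sigma> * real \<kappa>) ^ lev v * exp (\<sigma> * real R) \<le> exp (\<sigma> * real (depth v))"
      by (simp add: exp_of_nat_mult[symmetric] exp_add[symmetric] algebra_simps)
    moreover have "real B ^ lev v * (real B + 1) \<le> exp (\<sigma> * real \<kappa>) ^ lev v * exp (\<sigma> * real R)"
      using \<kappa>(2) R by (intro mult_mono power_mono) auto
    moreover have "1 \<le> real B ^ lev v" using assms(5) by simp
    then have "real (B ^ Suc (lev v)) + 1 \<le> real B ^ lev v * (real B + 1)" by (simp add: algebra_simps)
    moreover have "exp (\<sigma> * depth v) < real (card (children v)) + 1" using kids[OF v(1)] True by blast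
    ultimately have "real (B ^ Suc (lev v)) < real (card (children v))" by linarith
    then have "card (Lab (lev v)) \<le> card (children v)" using card[of "lev v"] by linarith
    then show ?thesis using card_le_inj[OF fin True] by blast
  next
    case False
    then obtain S where "S \<subseteq> children v" "card S = card (Lab (lev v))" "finite S"
      using infinite_arbitrarily_large by metis
    then show ?thesis using card_le_inj[OF fin, of S] by fastforce
  qed
  define sel where "sel v = (SOME f. inj_on f (Lab (lev v)) \<and> f ` Lab (lev v) \<subseteq> children v)" for v
  have sel: "inj_on (sel v) (Lab (lev v))" "sel v ` Lab (lev v) \<subseteq> children v" if "v \<in> V" "R \<le> depth v" for v
    using someI_ex[OF inj[OF that]] unfolding sel_def by blast+
  obtain t where t: "t \<in> V" "depth t = R" using deep by blast
  \<comment> \<open>The same label governs a block of \<open>\<kappa>\<close> consecutive choices;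
    different labels already separate the rays at the first of them.\<close>
  define ray :: "(nat \<Rightarrow> 'l) \<Rightarrow> nat \<Rightarrow> 'v" where "ray \<omega> = rec_nat t (\<lambda>m v. sel v (\<omega> (m div \<kappa>)))" for \<omega>
  have ray: "ray \<omega> 0 = t" "ray \<omega> (Suc m) = sel (ray \<omega> m) (\<omega> (m div \<kappa>))" for \<omega> m by (simp_all add: ray_def)
  have rayV: "ray \<omega> m \<in> V \<and> depth (ray \<omega> m) = R + m \<and> ray \<omega> (Suc m) \<in> children (ray \<omega> m)"
    if "\<forall>k. \<omega> k \<in> Lab k" for \<omega> m
  proof (induction m)
    case 0
    have "lev t = 0 div \<kappa>" using t by (simp add: lev_def)
    then show ?case using sel(2)[of t] t that ray by auto
  next
    case (Suc m)
    then have v: "ray \<omega> (Suc m) \<in> V" "depth (ray \<omega> (Suc m)) = R + Suc m" using childrenD by fastforce+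
    then have "lev (ray \<omega> (Suc m)) = Suc m div \<kappa>" by (simp add: lev_def)
    then show ?case using sel(2)[of "ray \<omega> (Suc m)"] v that ray(2)[of \<omega> "Suc m"] by auto
  qed
  have down: "downward_ray (ray \<omega>)" if "\<forall>k. \<omega> k \<in> Lab k" for \<omega>
    using rayV[OF that] by (auto simp: downward_ray_def)
  have agree: "ray \<omega> m = ray \<omega>' m" if "\<forall>k<K. \<omega> k = \<omega>' k" "m \<le> \<kappa> * K" for \<omega> \<omega>' K m
    using that(2)
  proof (induction m)
    case (Suc m)
    then have "m div \<kappa> < K" using \<kappa>(1) by (simp add: less_mult_imp_div_less mult.commute)
    then show ?case using Suc that(1) by (simp add: ray)
  qed (simp add: ray)
  have differ: "ray \<omega> (Suc (\<kappa> * K)) \<noteq> ray \<omega>' (Suc (\<kappa> * K))"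
    if "\<forall>k. \<omega> k \<in> Lab k" "\<forall>k. \<omega>' k \<in> Lab k" "\<forall>k<K. \<omega> k = \<omega>' k" "\<omega> K \<noteq> \<omega>' K" for \<omega> \<omega>' K
  proof -
    let ?v = "ray \<omega> (\<kappa> * K)"
    have v: "?v \<in> V" "depth ?v = R + \<kappa> * K" using rayV[OF that(1)] by auto
    then have l: "lev ?v = K" using \<kappa>(1) by (simp add: lev_def)
    have "sel ?v (\<omega> K) \<noteq> sel ?v (\<omega>' K)" using sel(1)[of ?v] v that l by (auto dest: inj_onD)
    then show ?thesis using agree[OF that(3), of "\<kappa> * K"] \<kappa>(1) by (simp add: ray)
  qed
  show ?thesis
  proof (intro exI[of _ "real \<kappa>"] conjI exI[of _ "\<lambda>\<omega> r. ray_point (ray \<omega>) (real \<kappa> * r)"] allI impI)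
    fix \<omega> \<omega>' :: "nat \<Rightarrow> 'l" and r r' :: real
    assume w: "\<forall>k. \<omega> k \<in> Lab k" "\<forall>k. \<omega>' k \<in> Lab k" and r: "0 \<le> r" "0 \<le> r'"
    note d = down[OF w(1)] down[OF w(2)]
    have kr: "0 \<le> real \<kappa> * r" "0 \<le> real \<kappa> * r'" using r by auto
    have z: "ray \<omega> 0 = ray \<omega>' 0" by (simp add: ray)
    show "ray_point (ray \<omega>) (real \<kappa> * r) \<in> realization V E" using ray_point_in_realization[OF d(1) kr(1)] .
    show "real \<kappa> * \<bar>r - r'\<bar> \<le> simplicial_dist V E (ray_point (ray \<omega>) (real \<kappa> * r)) (ray_point (ray \<omega>') (real \<kappa> * r'))"
      using rays_depth_lower[OF d z kr] by (simp add: abs_mult flip: right_diff_distrib)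
    fix K assume K: "\<forall>k<K. \<omega> k = \<omega>' k"
    have e: "real \<kappa> * (r + r' - 2 * min (min r r') (real K)) = real \<kappa> * r + real \<kappa> * r' - 2 * min (min (real \<kappa> * r) (real \<kappa> * r')) (real (\<kappa> * K))"
      by (simp add: min_mult_distrib_left algebra_simps)
    show "simplicial_dist V E (ray_point (ray \<omega>) (real \<kappa> * r)) (ray_point (ray \<omega>') (real \<kappa> * r'))
       \<le> real \<kappa> * (r + r' - 2 * min (min r r') (real K))"
      unfolding e using agree[OF K] by (intro path_within_dist rays_upper d kr) auto
    assume "\<omega> K \<noteq> \<omega>' K"
    then show "real \<kappa> * (r + r' - 2 * min (min r r') (real K))
       \<le> simplicial_dist V E (ray_point (ray \<omega>) (real \<kappa> * r)) (ray_point (ray \<omega>') (real \<kappa> * r'))"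
      unfolding e using agree[OF K, of "\<kappa> * K"] differ[OF w K] by (intro rays_branch_lower d z kr) auto
  qed (use \<kappa>(1) in auto)
qed

section \<open>The hyperbolic plane in polar coordinates\<close>

lemma sin_ge_third:
  fixes x :: real
  assumes "0 \<le> x" "x \<le> 2" shows "x / 3 \<le> sin x"
proof -
  have "\<bar>sin x - (\<Sum>m<3. sin_coeff m * x ^ m)\<bar> \<le> inverse (fact 3) * \<bar>x\<bar> ^ 3" by (rule Maclaurin_sin_bound)
  moreover have "(\<Sum>m<3. sin_coeff m * x ^ m) = x"
    by (simp add: eval_nat_numeral sin_coeff_def)
  ultimately have "\<bar>sin x - x\<bar> \<le> x ^ 3 / 6" using assms by (simp add: fact_numeral)
  then have "x - x ^ 3 / 6 \<le> sin x" by linarith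
  moreover have "x * (x * x) \<le> x * 4" using assms mult_mono[of x 2 x 2] by (intro mult_left_mono) auto
  then have "x ^ 3 \<le> 4 * x" by (simp add: power3_eq_cube mult.assoc)
  ultimately show ?thesis by linarith
qed

section \<open>Passage to the unit disc\<close>

definition cayley :: "complex \<Rightarrow> complex" where "cayley z = (z - \<i>) / (z + \<i>)"

lemma cayley_denominator: "0 < Im z \<Longrightarrow> z + \<i> \<noteq> 0"
  by (auto simp: complex_eq_iff)

lemma norm_cayley:
  assumes "0 < Im z"
  shows "1 - (cmod (cayley z))\<^sup>2 = 4 * Im z / (cmod (z + \<i>))\<^sup>2" "cmod (cayley z) < 1"
proof -
  have d: "0 < (cmod (z + \<i>))\<^sup>2" using cayley_denominator[OF assms] by simp
  have "(cmod (z + \<i>))\<^sup>2 - (cmod (z - \<i>))\<^sup>2 = 4 * Im z"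
    unfolding cmod_power2 by (simp add: power2_eq_square algebra_simps)
  then show 1: "1 - (cmod (cayley z))\<^sup>2 = 4 * Im z / (cmod (z + \<i>))\<^sup>2"
    using d by (simp add: cayley_def norm_divide power_divide field_simps)
  have "0 < 4 * Im z / (cmod (z + \<i>))\<^sup>2" using assms d by simp
  then have "(cmod (cayley z))\<^sup>2 < 1\<^sup>2" using 1 by simp
  then show "cmod (cayley z) < 1" by (rule power2_less_imp_less) simp
qed

lemma cayley_diff:
  assumes "0 < Im z" "0 < Im w"
  shows "cayley z - cayley w = 2 * \<i> * (z - w) / ((z + \<i>) * (w + \<i>))"
  using cayley_denominator[OF assms(1)] cayley_denominator[OF assms(2)]
  by (simp add: cayley_def divide_simps) (simp add: algebra_simps)

lemma hyperbolic_ratio: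
  assumes "0 < Im z" "0 < Im w"
  shows "(cmod (z - w))\<^sup>2 / (2 * Im z * Im w)
    = 2 * ((cmod (cayley z - cayley w))\<^sup>2 / ((1 - (cmod (cayley z))\<^sup>2) * (1 - (cmod (cayley w))\<^sup>2)))"
proof -
  have d: "cmod (z + \<i>) \<noteq> 0" "cmod (w + \<i>) \<noteq> 0" using cayley_denominator assms by auto
  have "(cmod (cayley z - cayley w))\<^sup>2 = 4 * (cmod (z - w))\<^sup>2 / ((cmod (z + \<i>))\<^sup>2 * (cmod (w + \<i>))\<^sup>2)"
    unfolding cayley_diff[OF assms] by (simp add: norm_divide norm_mult power_divide power_mult_distrib)
  then show ?thesis unfolding norm_cayley(1)[OF assms(1)] norm_cayley(1)[OF assms(2)] using d assms
    by (simp add: field_simps)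
qed

text \<open>The hyperbolic sine of half the distance.\<close>

definition half_sinh :: "complex \<Rightarrow> complex \<Rightarrow> real" where
  "half_sinh z w = cmod (z - w) / (2 * sqrt (Im z * Im w))"

lemma half_sinh_sq:
  assumes "0 < Im z" "0 < Im w"
  shows "(half_sinh z w)\<^sup>2 = (cmod (cayley z - cayley w))\<^sup>2 / ((1 - (cmod (cayley z))\<^sup>2) * (1 - (cmod (cayley w))\<^sup>2))"
    "0 \<le> half_sinh z w"
proof -
  have "(half_sinh z w)\<^sup>2 = (cmod (z - w))\<^sup>2 / (2 * Im z * Im w) / 2"
    using assms by (simp add: half_sinh_def power_divide power_mult_distrib)
  then show "(half_sinh z w)\<^sup>2 = (cmod (cayley z - cayley w))\<^sup>2 / ((1 - (cmod (cayley z))\<^sup>2) * (1 - (cmod (cayley w))\<^sup>2))"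
    unfolding hyperbolic_ratio[OF assms] by simp
  show "0 \<le> half_sinh z w" using assms by (simp add: half_sinh_def)
qed

lemma arcosh_real_nonneg: "1 \<le> x \<Longrightarrow> 0 \<le> arcosh (x :: real)"
proof -
  assume x: "1 \<le> x"
  then have "1 \<le> x\<^sup>2" by simp
  then have "0 \<le> sqrt (x\<^sup>2 - 1)" by simp
  then have "1 \<le> x + sqrt (x\<^sup>2 - 1)" using x by linarith
  then show ?thesis using x by (simp add: arcosh_real_def)
qed

lemma hyperbolic_dist_half_sinh:
  assumes "0 < Im z" "0 < Im w"
  defines "d \<equiv> hyperbolic_dist z w"
  shows "0 \<le> d" "cosh d = 1 + 2 * (half_sinh z w)\<^sup>2" "sinh (d / 2) = half_sinh z w"
proof -
  have e: "1 + (cmod (z - w))\<^sup>2 / (2 * Im z * Im w) = 1 + 2 * (half_sinh z w)\<^sup>2"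
    unfolding half_sinh_sq(1)[OF assms(1,2)] hyperbolic_ratio[OF assms(1,2)] by simp
  have ge: "1 \<le> 1 + 2 * (half_sinh z w)\<^sup>2" by simp
  show d0: "0 \<le> d" unfolding d_def hyperbolic_dist_def e by (rule arcosh_real_nonneg[OF ge])
  show c: "cosh d = 1 + 2 * (half_sinh z w)\<^sup>2"
    unfolding d_def hyperbolic_dist_def e by (rule cosh_arcosh_real[OF ge])
  have "cosh d = 1 + 2 * (sinh (d / 2))\<^sup>2"
    using cosh_add[of "d / 2" "d / 2"] cosh_square_eq[of "d / 2"] by (simp add: power2_eq_square)
  then have "(sinh (d / 2))\<^sup>2 = (half_sinh z w)\<^sup>2" using c by simp
  then show "sinh (d / 2) = half_sinh z w"
    using d0 half_sinh_sq(2)[OF assms(1,2)] by (simp add: power2_eq_iff_nonneg)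
qed

lemma exp_half_bounds:
  fixes t :: real
  assumes "0 \<le> t"
  shows "1 + sinh t \<le> exp t" "exp t \<le> 1 + 2 * sinh t"
proof -
  have "2 * sinh t = exp t - exp (- t)" by (simp add: sinh_field_def)
  moreover have "exp (- t) \<le> 1" using assms by simp
  ultimately show "exp t \<le> 1 + 2 * sinh t" by linarith
  have "1 \<le> cosh t" by (rule cosh_real_ge_1)
  moreover have "exp t = sinh t + cosh t" by (simp add: sinh_field_def cosh_field_def field_simps)
  ultimately show "1 + sinh t \<le> exp t" by linarith
qed

lemma polar_law:
  fixes R R' \<theta> \<theta>' :: real
  shows "(cmod (of_real R * exp (\<i> * of_real \<theta>) - of_real R' * exp (\<i> * of_real \<theta>')))\<^sup>2
    = (R - R')\<^sup>2 + 4 * R * R' * (sin ((\<theta> - \<theta>') / 2))\<^sup>2"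
proof -
  have "(cmod (of_real R * exp (\<i> * of_real \<theta>) - of_real R' * exp (\<i> * of_real \<theta>')))\<^sup>2
    = (R * cos \<theta> - R' * cos \<theta>')\<^sup>2 + (R * sin \<theta> - R' * sin \<theta>')\<^sup>2"
    unfolding cmod_power2 by (simp add: Re_exp Im_exp)
  also have "\<dots> = R\<^sup>2 * ((cos \<theta>)\<^sup>2 + (sin \<theta>)\<^sup>2) + R'\<^sup>2 * ((cos \<theta>')\<^sup>2 + (sin \<theta>')\<^sup>2) - 2 * R * R' * (cos \<theta> * cos \<theta>' + sin \<theta> * sin \<theta>')"
    by algebra
  also have "\<dots> = R\<^sup>2 + R'\<^sup>2 - 2 * R * R' * cos (\<theta> - \<theta>')" by (simp add: cos_diff)
  also have "cos (\<theta> - \<theta>') = 1 - 2 * (sin ((\<theta> - \<theta>') / 2))\<^sup>2"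
  proof -
    have "2 * ((\<theta> - \<theta>') / 2) = \<theta> - \<theta>'" by simp
    then show ?thesis using cos_double_sin[of "(\<theta> - \<theta>') / 2"] by (simp only:)
  qed
  finally show ?thesis by (simp add: power2_eq_square algebra_simps)
qed

text \<open>Solves \<open>5 powr (h / 2) = 1 / (1 - R)\<close>. At hyperbolic radius
  \<open>r\<close> one has \<open>R = tanh (r / 2)\<close>, so the circumference becomes
  \<open>(exp r - 1) / 2\<close>, comparable to \<open>sinh r\<close>.\<close>

definition disc_height :: "real \<Rightarrow> real" where "disc_height R = - 2 * ln (1 - R) / ln 5"

lemma disc_height:
  assumes "0 \<le> R" "R < 1"
  shows "0 \<le> disc_height R" "circumference (disc_height R) = R / (1 - R)"
proof -
  have "ln (1 - R) \<le> 0" using assms by simp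
  then show "0 \<le> disc_height R" by (simp add: disc_height_def divide_nonpos_pos)
  have "5 powr (disc_height R / 2) = exp (- ln (1 - R))" by (simp add: disc_height_def powr_def)
  also have "\<dots> = 1 / (1 - R)" using assms by (simp add: exp_minus field_simps)
  finally show "circumference (disc_height R) = R / (1 - R)" using assms by (simp add: circumference_def field_simps)
qed

text \<open>\<open>R\<close> and \<open>R'\<close> are the radii of two points of the unit disc, \<open>\<Delta>\<close> is their angular distance in quarter
  turns and \<open>\<sigma>\<close> the sine of half their angle. In the proof \<open>E\<close> measures the radial and \<open>b\<close> the
  angular part of the displacement.\<close>

lemma polar_comparison:
  fixes R R' \<Delta> S d \<sigma> :: real
  assumes "0 \<le> R" "R \<le> R'" "R' < 1" "0 \<le> \<Delta>" "0 \<le> \<sigma>" "\<Delta> \<le> 2" "\<Delta> / 4 \<le> \<sigma>" "\<sigma> \<le> \<Delta>"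
    and S: "0 \<le> S" "S\<^sup>2 = ((R - R')\<^sup>2 + 4 * R * R' * \<sigma>\<^sup>2) / ((1 - R\<^sup>2) * (1 - R'\<^sup>2))"
    and d: "0 \<le> d" "sinh (d / 2) = S" "cosh d = 1 + 2 * S\<^sup>2"
  shows "polar_dist \<Delta> (disc_height R) (disc_height R') \<le> 4 * d" "d \<le> 16 * polar_dist \<Delta> (disc_height R) (disc_height R')"
proof -
  define e e' where "e = 1 - R" "e' = 1 - R'"
  note ed = this
  define E where "E = e / e'"
  define b where "b = R / e * \<Delta>"
  have e: "0 < e'" "e' \<le> e" "e \<le> 1" using assms by (auto simp: ed)
  have E1: "1 \<le> E" using e by (simp add: E_def)
  have e0: "0 < e" using e by linarith
  have b0: "0 \<le> b" using assms e0 by (simp add: b_def)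
  have h: "disc_height R \<le> disc_height R'"
    using e by (simp add: disc_height_def ed divide_right_mono)
  have lnE: "disc_height R' - disc_height R = 2 * ln E / ln 5"
    using e e0 by (simp add: disc_height_def E_def ln_div ed[symmetric] field_simps)
  have lnE0: "0 \<le> ln E" using E1 by simp
  have "ln E / ln 5 \<le> ln E" using lnE0 ln5_bounds by (simp add: divide_le_eq mult_le_cancel_left1)
  then have hd1: "disc_height R' - disc_height R \<le> 2 * ln E" using lnE by linarith
  have "ln E \<le> 2 * ln E / ln 5" using lnE0 ln5_bounds by (simp add: le_divide_eq mult.commute[of 2] mult_left_mono)
  then have hd2: "ln E \<le> disc_height R' - disc_height R" using lnE by linarith
  have pd: "polar_dist \<Delta> (disc_height R) (disc_height R') = (disc_height R' - disc_height R) + ln (1 + b)"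
    using h disc_height(2)[of R] assms by (simp add: polar_dist_def min_def b_def ed)
  have R1: "R = 1 - e" "R' = 1 - e'" by (simp_all add: ed)
  have q: "e \<le> 1 - R\<^sup>2" "1 - R\<^sup>2 \<le> 2 * e" "e' \<le> 1 - R'\<^sup>2" "1 - R'\<^sup>2 \<le> 2 * e'"
  proof -
    have "1 - R\<^sup>2 = e * (1 + R)" "1 - R'\<^sup>2 = e' * (1 + R')" by (simp_all add: ed power2_eq_square algebra_simps)
    moreover have "e * 1 \<le> e * (1 + R)" "e * (1 + R) \<le> e * 2" "e' * 1 \<le> e' * (1 + R')" "e' * (1 + R') \<le> e' * 2"
      using assms e e0 by (auto intro!: mult_left_mono)
    ultimately show "e \<le> 1 - R\<^sup>2" "1 - R\<^sup>2 \<le> 2 * e" "e' \<le> 1 - R'\<^sup>2" "1 - R'\<^sup>2 \<le> 2 * e'" by simp_all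
  qed
  let ?n = "(R - R')\<^sup>2 + 4 * R * R' * \<sigma>\<^sup>2"
  have n0: "0 \<le> ?n" using assms by simp
  have den: "0 < e * e'" "e * e' \<le> (1 - R\<^sup>2) * (1 - R'\<^sup>2)" "(1 - R\<^sup>2) * (1 - R'\<^sup>2) \<le> 4 * (e * e')"
  proof -
    show "0 < e * e'" using e e0 by simp
    show "e * e' \<le> (1 - R\<^sup>2) * (1 - R'\<^sup>2)" using q e e0 by (intro mult_mono) auto
    have "(1 - R\<^sup>2) * (1 - R'\<^sup>2) \<le> (2 * e) * (2 * e')" using q e e0 by (intro mult_mono) auto
    then show "(1 - R\<^sup>2) * (1 - R'\<^sup>2) \<le> 4 * (e * e')" by simp
  qed
  have Su: "S\<^sup>2 \<le> ?n / (e * e')" unfolding S(2) using n0 den by (intro divide_left_mono) auto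
  have Sl: "?n / (4 * (e * e')) \<le> S\<^sup>2" unfolding S(2) using n0 den by (intro divide_left_mono) auto
  have rad: "(R - R')\<^sup>2 / (e * e') = (E - 1)\<^sup>2 / E"
    using e e0 by (simp add: R1 E_def power2_eq_square field_simps)
  have tan: "R * R' * \<Delta>\<^sup>2 / (e * e') = E * b\<^sup>2 + b * (E - 1) * \<Delta>"
    using e e0 by (simp add: b_def E_def R1(2) power2_eq_square field_simps) (simp add: ed algebra_simps)
  have D4: "\<sigma>\<^sup>2 \<le> \<Delta>\<^sup>2" "(\<Delta> / 4)\<^sup>2 \<le> \<sigma>\<^sup>2" using assms by (auto intro!: power_mono)
  show "polar_dist \<Delta> (disc_height R) (disc_height R') \<le> 4 * d"
  proof -
    have "(E - 1)\<^sup>2 / (4 * E) \<le> S\<^sup>2"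
    proof -
      have "(R - R')\<^sup>2 / (4 * (e * e')) \<le> ?n / (4 * (e * e'))" using assms den by (intro divide_right_mono) auto
      moreover have "(R - R')\<^sup>2 / (4 * (e * e')) = ((R - R')\<^sup>2 / (e * e')) / 4" by simp
      ultimately show ?thesis using Sl unfolding rad by simp
    qed
    then have "1 + 2 * ((E - 1)\<^sup>2 / (4 * E)) \<le> cosh d" using d(3) by linarith
    \<comment> \<open>The radial part of the displacement alone yields \<open>cosh (ln E)\<close>,
      so \<open>ln E\<close> is at most the distance.\<close>
    moreover have "cosh (ln E) = 1 + 2 * ((E - 1)\<^sup>2 / (4 * E))"
      using E1 by (simp add: cosh_ln_real power2_eq_square field_simps)
    ultimately have "cosh (ln E) \<le> cosh d" by simp
    then have 1: "ln E \<le> d" using lnE0 d(1) by (simp add: cosh_real_nonneg_le_iff)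
    have "(b / 4)\<^sup>2 \<le> S\<^sup>2"
    proof -
      have "b\<^sup>2 \<le> E * b\<^sup>2 + b * (E - 1) * \<Delta>"
        using E1 b0 assms(4) mult_right_mono[of 1 E "b\<^sup>2"] by (simp add: add_increasing2)
      then have "b\<^sup>2 / 16 \<le> (R * R' * \<Delta>\<^sup>2 / (e * e')) / 16" unfolding tan by simp
      also have "\<dots> = R * R' * (\<Delta> / 4)\<^sup>2 / (e * e')" by (simp add: power2_eq_square)
      also have "\<dots> \<le> R * R' * \<sigma>\<^sup>2 / (e * e')" using D4 assms den by (intro divide_right_mono mult_left_mono) auto
      also have "\<dots> = (4 * R * R' * \<sigma>\<^sup>2) / (4 * (e * e'))" by simp
      also have "\<dots> \<le> ?n / (4 * (e * e'))" using den by (intro divide_right_mono) auto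
      also have "\<dots> \<le> S\<^sup>2" by (rule Sl)
      finally show ?thesis by (simp add: power_divide)
    qed
    then have "b / 4 \<le> S" using S(1) by (rule power2_le_imp_le)
    then have x: "1 + b / 4 \<le> exp (d / 2)" using exp_half_bounds(1)[of "d / 2"] d by simp
    \<comment> \<open>Bernoulli turns the factor 4 into an exponent, which the logarithm makes a
      factor outside: \<open>ln (1 + b) \<le> 2 * d\<close>.\<close>
    have "1 + b \<le> (1 + b / 4) ^ 4" using Bernoulli_inequality[of "b / 4" 4] b0 by simp
    also have "\<dots> \<le> exp (d / 2) ^ 4" using x b0 by (intro power_mono) auto
    also have "\<dots> = exp (2 * d)" by (simp flip: exp_of_nat_mult)
    finally have "ln (1 + b) \<le> ln (exp (2 * d))" using b0 by (intro ln_mono) auto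
    then show ?thesis unfolding pd using 1 hd1 by simp
  qed
  show "d \<le> 16 * polar_dist \<Delta> (disc_height R) (disc_height R')"
  proof -
    let ?X = "(E - 1) + 2 * (E * b + b + (E - 1))"
    have "S\<^sup>2 \<le> (E - 1)\<^sup>2 / E + 4 * (R * R' * \<Delta>\<^sup>2 / (e * e'))"
    proof -
      have "4 * R * R' * \<sigma>\<^sup>2 / (e * e') \<le> 4 * R * R' * \<Delta>\<^sup>2 / (e * e')"
        using D4 assms den by (intro divide_right_mono mult_left_mono) auto
      then show ?thesis using Su rad by (simp add: add_divide_distrib)
    qed
    moreover have "(E - 1)\<^sup>2 / E \<le> (E - 1)\<^sup>2"
      using E1 by (simp add: divide_le_eq mult_le_cancel_left1)
    moreover have "R * R' * \<Delta>\<^sup>2 / (e * e') \<le> (E * b + b + (E - 1))\<^sup>2"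
    proof -
      have bE: "0 \<le> b * (E - 1)" using b0 E1 by simp
      have "b * (E - 1) * \<Delta> \<le> b * (E - 1) * 2" using bE assms(6) by (intro mult_left_mono) auto
      also have "\<dots> \<le> (b + (E - 1))\<^sup>2" by (simp add: power2_sum)
      finally have 1: "b * (E - 1) * \<Delta> \<le> (b + (E - 1))\<^sup>2" .
      have "E * b\<^sup>2 \<le> E * (E * b\<^sup>2)" using E1 mult_right_mono[of 1 E "b\<^sup>2"] by (intro mult_left_mono) auto
      then have 2: "E * b\<^sup>2 \<le> (E * b)\<^sup>2" by (simp add: power2_eq_square mult_ac)
      have "0 \<le> 2 * (E * b) * (b + (E - 1))" using E1 b0 by simp
      moreover have "(E * b + b + (E - 1))\<^sup>2 = (E * b)\<^sup>2 + (b + (E - 1))\<^sup>2 + 2 * (E * b) * (b + (E - 1))"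
        by (simp add: power2_eq_square algebra_simps)
      ultimately show ?thesis unfolding tan using 1 2 by linarith
    qed
    moreover have "(E - 1)\<^sup>2 + 4 * (E * b + b + (E - 1))\<^sup>2 \<le> ?X\<^sup>2"
    proof -
      have sq: "(u + 2 * v)\<^sup>2 = u\<^sup>2 + 4 * v\<^sup>2 + 4 * u * v" for u v :: real
        by (simp add: power2_eq_square algebra_simps)
      have "0 \<le> 4 * (E - 1) * (E * b + b + (E - 1))" using E1 b0 by simp
      then show ?thesis unfolding sq by linarith
    qed
    ultimately have "S\<^sup>2 \<le> ?X\<^sup>2" by linarith
    moreover have "0 \<le> ?X" using E1 b0 by (intro add_nonneg_nonneg mult_nonneg_nonneg) auto
    ultimately have "S \<le> ?X" by (rule power2_le_imp_le)
    then have "exp (d / 2) \<le> 1 + 2 * ?X" using exp_half_bounds(2)[of "d / 2"] d by simp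
    also have "\<dots> \<le> 1 + 6 * (E - 1) + 8 * E * b"
      using E1 b0 mult_right_mono[of 1 E b] by (simp add: algebra_simps)
    \<comment> \<open>Again Bernoulli: the sum becomes a product of powers of \<open>E\<close> and
      \<open>1 + b\<close>, whose logarithm splits into the two terms of the polar distance.\<close>
    also have "\<dots> \<le> E ^ 6 + 8 * (E ^ 6 * b)"
    proof -
      have "1 + 6 * (E - 1) \<le> E ^ 6" using Bernoulli_inequality[of "E - 1" 6] E1 by simp
      moreover have "E * b \<le> E ^ 6 * b" using E1 b0 self_le_power[of E 6] by (intro mult_right_mono) auto
      ultimately show ?thesis by simp
    qed
    also have "\<dots> = E ^ 6 * (1 + 8 * b)" by (simp add: algebra_simps)
    also have "\<dots> \<le> E ^ 6 * (1 + b) ^ 8"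
      using Bernoulli_inequality[of b 8] b0 E1 by (intro mult_left_mono) auto
    finally have "ln (exp (d / 2)) \<le> ln (E ^ 6 * (1 + b) ^ 8)" by (intro ln_mono) auto
    then have "d / 2 \<le> 6 * ln E + 8 * ln (1 + b)" using E1 b0 by (simp add: ln_mult ln_realpow)
    then show ?thesis unfolding pd using hd2 lnE0 by simp
  qed
qed

definition polar_angle :: "complex \<Rightarrow> real" where "polar_angle z = 2 * Arg2pi (cayley z) / pi"

definition polar_height :: "complex \<Rightarrow> real" where "polar_height z = disc_height (cmod (cayley z))"

lemma polar_height_nonneg: "0 < Im z \<Longrightarrow> 0 \<le> polar_height z"
  unfolding polar_height_def using norm_cayley(2)[of z] by (intro disc_height) auto

lemma hyperbolic_dist_commute: "hyperbolic_dist z w = hyperbolic_dist w z"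
  by (simp add: hyperbolic_dist_def norm_minus_commute mult_ac)

lemma hyperbolic_polar_ordered:
  assumes "0 < Im z" "0 < Im w" "cmod (cayley z) \<le> cmod (cayley w)"
    and "\<bar>polar_angle z - polar_angle w - 4 * of_int k\<bar> \<le> 2"
  defines "p \<equiv> polar_dist \<bar>polar_angle z - polar_angle w - 4 * of_int k\<bar> (polar_height z) (polar_height w)"
  shows "p \<le> 4 * hyperbolic_dist z w" "hyperbolic_dist z w \<le> 16 * p"
proof -
  let ?R = "cmod (cayley z)" and ?R' = "cmod (cayley w)"
  let ?D = "\<bar>polar_angle z - polar_angle w - 4 * of_int k\<bar>"
  define \<sigma> where "\<sigma> = sin (?D * pi / 4)"
  let ?t = "(Arg2pi (cayley z) - Arg2pi (cayley w)) / 2"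
  have t: "?t = (polar_angle z - polar_angle w - 4 * of_int k) * pi / 4 + of_int k * pi"
    by (simp add: polar_angle_def field_simps)
  \<comment> \<open>A full turn changes the half angle by \<open>pi\<close>, hence only the sign of
    its sine.\<close>
  have "(sin ?t)\<^sup>2 = \<sigma>\<^sup>2"
  proof -
    let ?u = "(polar_angle z - polar_angle w - 4 * of_int k) * pi / 4"
    have k: "sin (of_int k * pi) = 0" using sin_zero_iff_int2[of "of_int k * pi"] by blast
    then have "sin ?t = sin ?u * cos (of_int k * pi)" unfolding t sin_add by simp
    moreover have "(cos (of_int k * pi))\<^sup>2 = 1" using k by (simp add: cos_squared_eq)
    moreover have "sin (?D * pi / 4) = sin ?u \<or> sin (?D * pi / 4) = - sin ?u"
    proof (cases "0 \<le> polar_angle z - polar_angle w - 4 * of_int k")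
      case False
      then have "?D = - (polar_angle z - polar_angle w - 4 * of_int k)" by (simp add: abs_if)
      then have "?D * pi / 4 = - ?u" by (simp only: mult_minus_left minus_divide_left)
      then show ?thesis by (simp only: sin_minus simp_thms)
    qed simp
    ultimately show ?thesis unfolding \<sigma>_def by (auto simp: power_mult_distrib)
  qed
  then have law: "(cmod (cayley z - cayley w))\<^sup>2 = (?R - ?R')\<^sup>2 + 4 * ?R * ?R' * \<sigma>\<^sup>2"
    using polar_law[of ?R "Arg2pi (cayley z)" ?R' "Arg2pi (cayley w)"] Arg2pi_eq[of "cayley z"] Arg2pi_eq[of "cayley w"] by simp
  have pi: "3 \<le> pi" "pi \<le> 4" using pi_gt3 pi_less_4 by auto
  have D: "0 \<le> ?D" by simp
  have x: "0 \<le> ?D * pi / 4" "?D * pi / 4 \<le> ?D" "3 * ?D / 4 \<le> ?D * pi / 4"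
    using pi mult_left_mono[OF pi(2) D] mult_left_mono[OF pi(1) D] by auto
  have \<sigma>: "?D / 4 \<le> \<sigma>" "\<sigma> \<le> ?D"
    using sin_ge_third[of "?D * pi / 4"] sin_x_le_x[of "?D * pi / 4"] x assms(4) unfolding \<sigma>_def by linarith+
  moreover have "0 \<le> ?D / 4" by simp
  ultimately have "0 \<le> \<sigma>" by (metis order_trans)
  note hd = hyperbolic_dist_half_sinh[OF assms(1,2)] and hs = half_sinh_sq[OF assms(1,2)]
  show "p \<le> 4 * hyperbolic_dist z w" "hyperbolic_dist z w \<le> 16 * p"
    unfolding p_def polar_height_def
    using polar_comparison[of ?R ?R' ?D \<sigma> "half_sinh z w" "hyperbolic_dist z w"] assms(3,4) norm_cayley(2)[OF assms(2)]
      D \<open>0 \<le> \<sigma>\<close> \<sigma> hs hd unfolding law by auto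
qed

lemma hyperbolic_polar:
  assumes "0 < Im z" "0 < Im w"
    and "\<bar>polar_angle z - polar_angle w - 4 * of_int k\<bar> \<le> 2"
  defines "p \<equiv> polar_dist \<bar>polar_angle z - polar_angle w - 4 * of_int k\<bar> (polar_height z) (polar_height w)"
  shows "p \<le> 4 * hyperbolic_dist z w" "hyperbolic_dist z w \<le> 16 * p"
proof -
  have a: "\<bar>polar_angle w - polar_angle z - 4 * of_int (- k)\<bar> = \<bar>polar_angle z - polar_angle w - 4 * of_int k\<bar>"
    by simp
  have b: "\<bar>polar_angle w - polar_angle z - 4 * of_int (- k)\<bar> \<le> 2" unfolding a by (rule assms(3))
  have "p \<le> 4 * hyperbolic_dist z w \<and> hyperbolic_dist z w \<le> 16 * p"
  proof (cases "cmod (cayley z) \<le> cmod (cayley w)")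
    case True
    then show ?thesis using hyperbolic_polar_ordered[OF assms(1,2) True assms(3)] by (simp add: p_def)
  next
    case False
    then show ?thesis using hyperbolic_polar_ordered[OF assms(2,1) _ b] unfolding a
      by (simp add: p_def hyperbolic_dist_commute[of w] polar_dist_commute[of _ "polar_height w"])
  qed
  then show "p \<le> 4 * hyperbolic_dist z w" "hyperbolic_dist z w \<le> 16 * p" by auto
qed

lemma polar_angle_lift:
  assumes "0 \<le> x" "x < 4" "0 \<le> x'" "x' < 4"
  obtains k :: int where "\<bar>x - x' - 4 * of_int k\<bar> \<le> (2 :: real)"
proof -
  consider "\<bar>x - x'\<bar> \<le> 2" | "2 < x - x'" | "x - x' < - 2" by linarith
  then show ?thesis
  proof cases
    case 1 then show ?thesis using that[of 0] by simp
  next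
    case 2 then show ?thesis using that[of 1] assms by simp
  next
    case 3 then show ?thesis using that[of "-1"] assms by simp
  qed
qed

lemma polar_angle_bounds: "0 \<le> polar_angle z" "polar_angle z < 4"
  using Arg2pi_ge_0[of "cayley z"] Arg2pi_lt_2pi[of "cayley z"] by (simp_all add: polar_angle_def field_simps)

section \<open>The embedding\<close>

lemma branch_point_period:
  assumes "0 \<le> h"
  shows "branch_point (x + 4 * of_int k) h = branch_point x h"
proof -
  let ?N = "level h" and ?i = "cell_index x h"
  let ?j = "?i + 5 ^ ?N * (4 * k)"
  have x: "x + 4 * of_int k = x + of_int (4 * k)" by simp
  have i: "cell_index (x + 4 * of_int k) h = ?j" "cell_fraction (x + 4 * of_int k) h = cell_fraction x h"
    unfolding x by (rule cell_index_shift[OF assms], rule cell_fraction_shift[OF assms])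
  have "?j = ?i + 4 * 5 ^ ?N * k" by simp
  then have w: "cell_word ?N ?j = cell_word ?N ?i" unfolding cell_word_def by (simp only: mod_mult_self2)
  have e: "even_end ?j = even_end ?i + 5 ^ ?N * (4 * k)" "even ?j \<longleftrightarrow> even ?i" by (simp_all add: even_end_def)
  have "cell_depth ?N ?j f s = cell_depth ?N ?i f s" for f s
    unfolding cell_depth_def e cell_gap_shift ray_val_shift ..
  with w show ?thesis unfolding branch_point_def i cell_point_def by simp
qed

lemma branch_point_depth_bounds:
  assumes "0 \<le> h"
  shows "0 \<le> snd (branch_point x h)" "snd (branch_point x h) \<le> length (fst (branch_point x h))"
  using cell_depth_bounds[of "cell_fraction x h" "phase h" "level h" "cell_index x h"] cell_index[OF assms, of x] phase_bounds[of h] assms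
    ray_val_nonneg[of "level h" "even_end (cell_index x h)"]
  by (auto simp: branch_point_def cell_point_def)

lemma branch_dist_meet: "branch_dist a b = snd a + snd b - 2 * min (min (snd a) (snd b)) (real (length (longest_common_prefix (fst a) (fst b))))"
  by (simp add: branch_dist_def meet_depth_def)

text \<open>Recording the codes only through their diaries shortens a distance by at most twice the number of
  letters on which the diaries agree beyond the first difference of the words.\<close>

lemma folded_distance:
  fixes l l' :: "(nat \<times> int) list" and r r' \<kappa> C \<rho> d :: real
  assumes r: "0 \<le> r" "0 \<le> r'" "r \<le> length l" "r' \<le> length l'" and "0 < \<kappa>" "0 < C" "0 \<le> \<rho>"
    and abs: "\<kappa> * \<bar>r - r'\<bar> \<le> d"
    and up: "\<And>K. (\<forall>k<K. diary Q l k = diary Q l' k) \<Longrightarrow> d \<le> \<kappa> * (r + r' - 2 * min (min r r') (real K))"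
    and low: "\<And>K. (\<forall>k<K. diary Q l k = diary Q l' k) \<Longrightarrow> diary Q l K \<noteq> diary Q l' K \<Longrightarrow>
       \<kappa> * (r + r' - 2 * min (min r r') (real K)) \<le> d"
    and sep: "\<And>K. K \<le> length l \<Longrightarrow> K \<le> length l' \<Longrightarrow> (\<forall>k<K. diary Q l k = diary Q l' k) \<Longrightarrow>
       C * (real K - length (longest_common_prefix l l')) \<le> \<rho>"
  shows "d \<le> \<kappa> * branch_dist (l, r) (l', r')" "\<kappa> * (branch_dist (l, r) (l', r') - 2 * (\<rho> / C)) \<le> d"
proof -
  define m where "m = length (longest_common_prefix l l')"
  have bd: "branch_dist (l, r) (l', r') = r + r' - 2 * min (min r r') (real m)"
    by (simp add: branch_dist_meet m_def)
  have m: "m \<le> length l" "m \<le> length l'" "take m l = take m l'"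
    using le_length_lcp_iff[of m l l'] by (simp_all add: m_def)
  show "d \<le> \<kappa> * branch_dist (l, r) (l', r')"
    unfolding bd using diary_cong[OF m(3,1,2)] by (intro up) auto
  have key: "\<kappa> * (r + r' - 2 * min (min r r') (real m) - 2 * (\<rho> / C)) \<le> d"
    if "\<kappa> * (r + r' - 2 * min (min r r') (real K)) \<le> d" "C * (real K - real m) \<le> \<rho>" for K
  proof -
    have "real K - real m \<le> \<rho> / C" using that(2) \<open>0 < C\<close> by (simp add: pos_le_divide_eq mult.commute)
    moreover have "0 \<le> \<rho> / C" using assms by simp
    ultimately have "r + r' - 2 * min (min r r') (real m) - 2 * (\<rho> / C) \<le> r + r' - 2 * min (min r r') (real K)" by linarith
    then have "\<kappa> * (r + r' - 2 * min (min r r') (real m) - 2 * (\<rho> / C)) \<le> \<kappa> * (r + r' - 2 * min (min r r') (real K))"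
      using \<open>0 < \<kappa>\<close> by (intro mult_left_mono) auto
    then show ?thesis using that(1) by linarith
  qed
  \<comment> \<open>If the diaries agree to this depth, one folded point lies above the other and
    their distance is \<open>\<kappa> * \<bar>r - r'\<bar>\<close>. Otherwise the first differing
    label is where the folded branches part. Both depths are within the words, so the separation
    hypothesis applies.\<close>
  define K0 where "K0 = nat \<lceil>min r r'\<rceil>"
  have K0: "K0 \<le> length l" "K0 \<le> length l'" "min r r' \<le> real K0" using r unfolding K0_def by linarith+
  show "\<kappa> * (branch_dist (l, r) (l', r') - 2 * (\<rho> / C)) \<le> d"
  proof (cases "\<forall>k<K0. diary Q l k = diary Q l' k")
    case True
    have "r + r' - 2 * min (min r r') (real K0) = \<bar>r - r'\<bar>" using K0(3) by linarith
    then have "\<kappa> * (r + r' - 2 * min (min r r') (real K0)) \<le> d" using abs by (simp only:)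
    from key[OF this] show ?thesis unfolding bd using sep[OF K0(1,2) True] by (simp add: m_def)
  next
    case False
    define K where "K = (LEAST k. diary Q l k \<noteq> diary Q l' k)"
    obtain k0 where k0: "k0 < K0" "diary Q l k0 \<noteq> diary Q l' k0" using False by blast
    have K: "diary Q l K \<noteq> diary Q l' K" unfolding K_def by (rule LeastI[of _ k0]) (rule k0(2))
    have "K \<le> k0" unfolding K_def by (rule Least_le) (rule k0(2))
    then have le: "K \<le> length l" "K \<le> length l'" using K0 k0(1) by linarith+
    have ag: "\<forall>k<K. diary Q l k = diary Q l' k" unfolding K_def using not_less_Least by blast
    show ?thesis unfolding bd using key[OF low[OF ag K]] sep[OF le ag] by (simp add: m_def)
  qed
qed

theorem corollary1p4:
  fixes V :: "'v set" and E :: "'v set set"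
  assumes "simplicial_tree V E"
    and "exponentially_branching V E"
  shows "\<exists>\<phi>. bilipschitz_embedding
      hyperbolic_plane hyperbolic_dist
      (realization V E \<times> realization V E)
      (l1_prod_dist (simplicial_dist V E) (simplicial_dist V E)) \<phi>"
proof -
  \<comment> \<open>\<open>51800 = 8 * 6475\<close>. Folding loses at most \<open>2 * p / C\<close>
    in each tree, together half of the lower bound \<open>p / 6475\<close> for the unfolded pair;
    \<open>p / 12950\<close> remains.\<close>
  define C :: real where "C = 51800"
  obtain Q where Q: "0 < Q" and sep: "\<And>x x' h h' K. 0 \<le> h \<Longrightarrow> 0 \<le> h' \<Longrightarrow> \<bar>x - x'\<bar> \<le> 2 \<Longrightarrow>
    K \<le> length (fst (branch_point x h)) \<Longrightarrow> K \<le> length (fst (branch_point x' h')) \<Longrightarrow>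
    (\<forall>k<K. diary Q (fst (branch_point x h)) k = diary Q (fst (branch_point x' h')) k) \<Longrightarrow>
    C * (real K - length (longest_common_prefix (fst (branch_point x h)) (fst (branch_point x' h')))) \<le> polar_dist \<bar>x - x'\<bar> h h'"
    using diary_separation[of C] unfolding C_def by (metis zero_le_numeral)
  have "1 \<le> nat (Q * Q)"
  proof -
    have "0 < Q * Q" using Q by simp
    then show ?thesis by linarith
  qed
  have cardL: "card (diary_letters Q k) \<le> nat (Q * Q) ^ Suc k" for k using card_diary_letters[of Q k] Q by simp
  obtain \<kappa> and P :: "(nat \<Rightarrow> (int \<times> int) list) \<Rightarrow> real \<Rightarrow> 'v \<Rightarrow> real" where \<kappa>: "0 < \<kappa>"
    and P: "\<And>\<omega> \<omega>' r r'. (\<forall>k. \<omega> k \<in> diary_letters Q k) \<Longrightarrow> (\<forall>k. \<omega>' k \<in> diary_letters Q k) \<Longrightarrow> 0 \<le> r \<Longrightarrow> 0 \<le> r' \<Longrightarrow>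
    P \<omega> r \<in> realization V E \<and>
    \<kappa> * \<bar>r - r'\<bar> \<le> simplicial_dist V E (P \<omega> r) (P \<omega>' r') \<and>
    (\<forall>K. (\<forall>k<K. \<omega> k = \<omega>' k) \<longrightarrow>
      simplicial_dist V E (P \<omega> r) (P \<omega>' r') \<le> \<kappa> * (r + r' - 2 * min (min r r') (real K)) \<and>
      (\<omega> K \<noteq> \<omega>' K \<longrightarrow>
        \<kappa> * (r + r' - 2 * min (min r r') (real K)) \<le> simplicial_dist V E (P \<omega> r) (P \<omega>' r')))"
    using exponentially_branching_contains_labelled_tree[OF assms finite_diary_letters cardL \<open>1 \<le> nat (Q * Q)\<close>] by blast
  define F where "F a = P (diary Q (fst a)) (snd a)" for a
  have dl: "\<forall>k. diary Q l k \<in> diary_letters Q k" for l using diary_in_letters[OF Q] by blast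
  have FR: "F (branch_point x h) \<in> realization V E" if "0 \<le> h" for x h
    using P[OF dl dl branch_point_depth_bounds(1)[OF that] branch_point_depth_bounds(1)[OF that]] unfolding F_def by blast
  have Fd: "simplicial_dist V E (F a) (F a') \<le> \<kappa> * branch_dist a a' \<and>
      \<kappa> * (branch_dist a a' - 2 * (polar_dist \<bar>x - x'\<bar> h h' / C)) \<le> simplicial_dist V E (F a) (F a')"
    if h: "0 \<le> h" "0 \<le> h'" and x: "\<bar>x - x'\<bar> \<le> 2" and a: "a = branch_point x h" "a' = branch_point x' h'" for x x' h h' a a'
  proof -
    have r: "0 \<le> snd a" "0 \<le> snd a'" "snd a \<le> length (fst a)" "snd a' \<le> length (fst a')"
      using branch_point_depth_bounds h a by auto
    have \<rho>: "0 \<le> polar_dist \<bar>x - x'\<bar> h h'" using polar_dist_ge(1)[OF h, of "\<bar>x - x'\<bar>"] by linarith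
    note p = P[OF dl[of "fst a"] dl[of "fst a'"] r(1,2)]
    have C0: "0 < C" by (simp add: C_def)
    show ?thesis
      using folded_distance[OF r \<kappa> C0 \<rho>, of "simplicial_dist V E (F a) (F a')" Q] p sep[OF h x] unfolding a F_def by auto
  qed
  define \<phi> where "\<phi> z = (F (branch_point (polar_angle z) (polar_height z)), F (branch_point (polar_angle z + 1) (polar_height z)))" for z
  let ?d = "l1_prod_dist (simplicial_dist V E) (simplicial_dist V E)"
  \<comment> \<open>\<open>207200 = 16 * 12950\<close> and \<open>1376 = 4 * 344\<close> combine the
    factors 16 and 4 of the polar comparison with the lower and upper bounds for the trees.\<close>
  define L where "L = 1 + 207200 / \<kappa> + 1376 * \<kappa>"
  have L: "1 \<le> L" "207200 / \<kappa> \<le> L" "1376 * \<kappa> \<le> L" using \<kappa> by (simp_all add: L_def)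
  have est: "inverse L * hyperbolic_dist z w \<le> ?d (\<phi> z) (\<phi> w) \<and> ?d (\<phi> z) (\<phi> w) \<le> L * hyperbolic_dist z w"
    if zw: "0 < Im z" "0 < Im w" for z w
  proof -
    obtain k where k: "\<bar>polar_angle z - polar_angle w - 4 * of_int k\<bar> \<le> 2"
      using polar_angle_lift[OF polar_angle_bounds polar_angle_bounds] by blast
    \<comment> \<open>The second angle is lifted so that the points are at most half a turn apart,
      as the lower bound and the separation by diaries require.\<close>
    define x x' h h' where "x = polar_angle z" "x' = polar_angle w + 4 * of_int k" "h = polar_height z" "h' = polar_height w"
    note xd = this
    have h: "0 \<le> h" "0 \<le> h'" using zw polar_height_nonneg by (auto simp: xd)
    have xx: "\<bar>x - x'\<bar> \<le> 2" "\<bar>(x + 1) - (x' + 1)\<bar> \<le> 2" using k by (simp_all add: xd algebra_simps)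
    define p where "p = polar_dist \<bar>x - x'\<bar> h h'"
    have e: "\<bar>polar_angle z - polar_angle w - 4 * of_int k\<bar> = \<bar>x - x'\<bar>" by (simp add: xd algebra_simps)
    have hp: "p \<le> 4 * hyperbolic_dist z w" "hyperbolic_dist z w \<le> 16 * p"
      using hyperbolic_polar[OF zw k] unfolding e by (simp_all add: p_def xd(3,4))
    have per: "branch_point (polar_angle w) h' = branch_point x' h'" "branch_point (polar_angle w + 1) h' = branch_point (x' + 1) h'"
      using branch_point_period[OF h(2), of "polar_angle w" k] branch_point_period[OF h(2), of "polar_angle w + 1" k]
      by (simp_all add: xd(2) algebra_simps)
    have d: "?d (\<phi> z) (\<phi> w) = simplicial_dist V E (F (branch_point x h)) (F (branch_point x' h'))
      + simplicial_dist V E (F (branch_point (x + 1) h)) (F (branch_point (x' + 1) h'))"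
      unfolding \<phi>_def l1_prod_dist_def by (simp add: xd(1,3,4)[symmetric] per)
    have up: "?d (\<phi> z) (\<phi> w) \<le> \<kappa> * pair_dist x h x' h'"
      unfolding d pair_dist_def distrib_left using Fd[OF h xx(1) refl refl] Fd[OF h xx(2) refl refl] by linarith
    have p1: "polar_dist \<bar>x + 1 - (x' + 1)\<bar> h h' = p" by (simp add: p_def)
    have lo: "\<kappa> * (pair_dist x h x' h' - 4 * (p / C)) \<le> ?d (\<phi> z) (\<phi> w)"
    proof -
      have "\<kappa> * (pair_dist x h x' h' - 4 * (p / C))
        = \<kappa> * (branch_dist (branch_point x h) (branch_point x' h') - 2 * (p / C))
        + \<kappa> * (branch_dist (branch_point (x + 1) h) (branch_point (x' + 1) h') - 2 * (p / C))"
        by (simp add: pair_dist_def algebra_simps)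
      then show ?thesis unfolding d using Fd[OF h xx(1) refl refl] Fd[OF h xx(2) refl refl] unfolding p1 p_def[symmetric] by linarith
    qed
    have pl: "p \<le> 6475 * pair_dist x h x' h'" "pair_dist x h x' h' \<le> 344 * p"
      using pair_dist_lower[OF h xx(1)] pair_dist_upper[OF h, of x x'] by (simp_all add: p_def)
    have p0: "0 \<le> p" using polar_dist_ge(1)[OF h, of "\<bar>x - x'\<bar>"] unfolding p_def by linarith
    have dz: "0 \<le> hyperbolic_dist z w" using hp(1) p0 by linarith
    have "p / 12950 \<le> pair_dist x h x' h' - 4 * (p / C)" using pl(1) by (simp add: C_def)
    then have "\<kappa> * (p / 12950) \<le> \<kappa> * (pair_dist x h x' h' - 4 * (p / C))" using \<kappa> by (intro mult_left_mono) auto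
    with lo have "\<kappa> * (p / 12950) \<le> ?d (\<phi> z) (\<phi> w)" by (rule order_trans[rotated])
    moreover have "\<kappa> * (hyperbolic_dist z w / 207200) \<le> \<kappa> * (p / 12950)" using hp(2) \<kappa> by (intro mult_left_mono) auto
    moreover have "inverse L * hyperbolic_dist z w \<le> \<kappa> * (hyperbolic_dist z w / 207200)"
    proof -
      have "inverse L \<le> inverse (207200 / \<kappa>)" using L \<kappa> by (intro le_imp_inverse_le) auto
      then have "inverse L * hyperbolic_dist z w \<le> inverse (207200 / \<kappa>) * hyperbolic_dist z w" using dz by (intro mult_right_mono)
      then show ?thesis by simp
    qed
    ultimately have lower: "inverse L * hyperbolic_dist z w \<le> ?d (\<phi> z) (\<phi> w)" by linarith
    have "\<kappa> * pair_dist x h x' h' \<le> \<kappa> * (1376 * hyperbolic_dist z w)" using pl(2) hp(1) \<kappa> by (intro mult_left_mono) auto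
    moreover have "1376 * \<kappa> * hyperbolic_dist z w \<le> L * hyperbolic_dist z w" using L dz by (intro mult_right_mono) auto
    ultimately show ?thesis using lower up by (simp add: mult_ac)
  qed
  have "\<phi> z \<in> realization V E \<times> realization V E" if "0 < Im z" for z
    unfolding \<phi>_def using FR polar_height_nonneg[OF that] by auto
  then have "bilipschitz_embedding hyperbolic_plane hyperbolic_dist (realization V E \<times> realization V E) ?d \<phi>"
    unfolding bilipschitz_embedding_def hyperbolic_plane_def using est L(1) by blast
  then show ?thesis by blast
qed

end
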